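(* Let $m\in\mathbb N$ be odd. The character and the supercharacter of the N=3 module $H(\Lambda^{[K(m),1]})$ are given by the following formulas. 1) $$\begin{aligned} {\rm ch}^{(+)}_{H(\Lambda^{[K(m),1]})}(\tau,z)={}&-i\,\frac{\eta(2\tau)^2}{\eta(\frac\tau2)}\cdot\frac{\vartheta_{00}(\tau,z)}{\vartheta_{11}(\tau,z)}\cdot\frac1{\theta_{\frac m2,m+1}(\tau,0)}\Bigg\{\frac{\theta_{m+\frac12,m+1}(\tau,z)}{\theta_{-\frac12,1}(\tau,z)}-\frac{\theta_{-m-\frac12,m+1}(\tau,z)}{\theta_{\frac12,1}(\tau,z)}\Bigg\}\\ &-q^{-\frac m{16(m+1)}}e^{-\frac{\pi im}2}\frac1{\eta(\frac\tau2)\eta(2\tau)}\cdot\frac{\vartheta_{00}(\tau,z)}{\vartheta_{11}(\tau,z)}\cdot\frac1{\theta_{\frac m2,m+1}(\tau,0)}\\ &\times\Bigg\{\sum_{j=1}^\infty\sum_{r=1}^j\sum_{\substack{k=0\\k\ {\rm even}}}^{m-1}(-1)^jq^{(m+1)j^2-\frac1{4m}(2m(j-r)+m-k)^2}\\ &\qquad\times\big\{e^{-\frac{\pi i}2(2mr-m+k)}q^{-\frac14(2mr-m+k)}+e^{\frac{\pi i}2(2mr-m+k)}q^{\frac14(2mr-m+k)}\big\}\big[\theta_{k,m}-\theta_{-k,m}\big](\tau,z)\\ &\quad-\sum_{j=1}^\infty\sum_{r=0}^{j-1}\sum_{\substack{k=0\\k\ {\rm even}}}^{m-1}(-1)^jq^{(m+1)j^2-\frac1{4m}(2m(j-r)-m+k)^2}\\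 &\qquad\times\big\{e^{-\frac{\pi i}2(2mr+m-k)}q^{-\frac14(2mr+m-k)}+e^{\frac{\pi i}2(2mr+m-k)}q^{\frac14(2mr+m-k)}\big\}\big[\theta_{k,m}-\theta_{-k,m}\big](\tau,z)\Bigg\}\\ &+\frac1{\eta(\frac\tau2)\eta(2\tau)}\cdot\frac{\vartheta_{00}(\tau,z)}{\vartheta_{11}(\tau,z)}\sum_{k=1}^{\frac{m-1}2}(-1)^kq^{-\frac1{16m}(4k-m)^2}\big[\theta_{k,\frac m2}-\theta_{-k,\frac m2}\big](2\tau,2z). \end{aligned}$$ 2) $$\begin{aligned} {\rm ch}^{(-)}_{H(\Lambda^{[K(m),1]})}(\tau,z)={}&\frac{\eta(\frac\tau2)\eta(2\tau)^3}{\eta(\tau)^3}\cdot\frac{\vartheta_{01}(\tau,z)}{\vartheta_{11}(\tau,z)}\cdot\frac1{\theta^{(-)}_{\frac m2,m+1}(\tau,0)}\Bigg\{\frac{\theta^{(-)}_{m+\frac12,m+1}(\tau,z)}{\theta^{(-)}_{-\frac12,1}(\tau,z)}-\frac{\theta^{(-)}_{-m-\frac12,m+1}(\tau,z)}{\theta^{(-)}_{\frac12,1}(\tau,z)}\Bigg\}\\ &-q^{-\frac m{16(m+1)}}\frac{\eta(\frac\tau2)}{\eta(\tau)^3}\cdot\frac{\vartheta_{01}(\tau,z)}{\vartheta_{11}(\tau,z)}\cdot\frac1{\theta^{(-)}_{\frac m2,m+1}(\tau,0)}\\ &\times\Bigg\{\sum_{j=1}^\infty\sum_{r=1}^j\sum_{\substack{k=0\\k\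 {\rm even}}}^{m-1}(-1)^jq^{(m+1)j^2-\frac1{4m}(2m(j-r)+m-k)^2}\big\{q^{-\frac14(2mr-m+k)}+q^{\frac14(2mr-m+k)}\big\}\big[\theta_{k,m}-\theta_{-k,m}\big](\tau,z)\\ &\quad-\sum_{j=1}^\infty\sum_{r=0}^{j-1}\sum_{\substack{k=0\\k\ {\rm even}}}^{m-1}(-1)^jq^{(m+1)j^2-\frac1{4m}(2m(j-r)-m+k)^2}\big\{q^{-\frac14(2mr+m-k)}+q^{\frac14(2mr+m-k)}\big\}\big[\theta_{k,m}-\theta_{-k,m}\big](\tau,z)\Bigg\}\\ &+\frac{\eta(\frac\tau2)}{\eta(\tau)^3}\cdot\frac{\vartheta_{01}(\tau,z)}{\vartheta_{11}(\tau,z)}\sum_{k=1}^{\frac{m-1}2}q^{-\frac1{16m}(4k-m)^2}\big[\theta_{k,\frac m2}-\theta_{-k,\frac m2}\big](2\tau,2z). \end{aligned}$$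
   Context: Notation. $\mathbb N$ = positive integers; $\tau$ in the upper half-plane; $z,z_1,z_2,t\in\mathbb C$; $q=e^{2\pi i\tau}$, $q^a:=e^{2\pi ia\tau}$. $\theta_{k,m}(\tau,z)=\sum_{j\in\mathbb Z}e^{2\pi im(j+\frac k{2m})z}q^{m(j+\frac k{2m})^2}$, $\theta^{(-)}_{k,m}(\tau,z)=\sum_{j\in\mathbb Z}(-1)^je^{2\pi im(j+\frac k{2m})z}q^{m(j+\frac k{2m})^2}$; $[\theta_{k,m}-\theta_{-k,m}](\tau,z)=\theta_{k,m}(\tau,z)-\theta_{-k,m}(\tau,z)$; $\eta$ is the Dedekind eta function; $\vartheta_{ab}(\tau,z)=\sum_{n\in\mathbb Z}e^{\pi i(n+\frac a2)^2\tau+2\pi i(n+\frac a2)(z+\frac b2)}$ ($a,b\in\{0,1\}$) are Mumford's theta functions. For $m\in\frac12\mathbb N$, $s\in\frac12\mathbb Z$, $\Phi^{[m,s]}=\Phi_1^{[m,s]}-\Phi_2^{[m,s]}$ with $$\Phi^{[m,s]}_1(\tau,z_1,z_2,t)=e^{-2\pi imt}\sum_{j\in\mathbb Z}\frac{e^{2\pi imj(z_1+z_2)+2\pi isz_1}q^{mj^2+sj}}{1-e^{2\pi iz_1}q^j},\quad \Phi^{[m,s]}_2(\tau,z_1,z_2,t)=e^{-2\pi imt}\sum_{j\in\mathbb Z}\frac{e^{-2\pi imj(z_1+z_2)-2\pi isz_2}q^{mj^2+sj}}{1-e^{-2\pi iz_2}q^j}.$$ In these definitions $q$ is attached to the first argument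 (first argument $2\tau$ means $q\mapsto q^2$). Empty sums are $0$. Modules. Let $\widehat B(1,1)=\widehat{osp}(3|2)$ be the affine Lie superalgebra with simple roots $\alpha_0,\alpha_1,\alpha_2$ ($\alpha_1$ odd isotropic, $\alpha_0,\alpha_2$ even, $\theta=2\alpha_1+2\alpha_2$ the highest root, $(\theta|\theta)=2$) and fundamental weight $\Lambda_0$. For $m\in\mathbb N$ and an integer $0\le m_2\le m$ put $K(m)=-\frac{m+2}4$, $\Lambda^{[K(m),m_2]}=K(m)\Lambda_0-\frac{m_2}2\alpha_1$, let $L(\Lambda^{[K(m),m_2]})$ be the irreducible highest weight module, and let $H(\Lambda^{[K(m),m_2]})$ be the module over the N=3 superconformal algebra obtained from it by quantum Hamiltonian reduction. Its character ${\rm ch}^{(+)}$ and supercharacter ${\rm ch}^{(-)}$ are known (from earlier work) to be determined by $$R^{(+)}{\rm ch}^{(+)}_{H(\Lambda^{[K(m),m_2]})}(\tau,z)=q^{-\frac m{16}}\Phi^{[\frac m2,\frac{m_2+1}2]}\big(2\tau,z+\tfrac\tau2-\tfrac12,z-\tfrac\tau2+\tfrac12,0\big),$$ $$R^{(-)}{\rm ch}^{(-)}_{H(\Lambda^{[K(m),m_2]})}(\tau,z)=q^{-\frac m{16}}\Phi^{[\frac m2,\frac{m_2+1}2]}\big(2\tau,z+\tfrac\tau2,z-\tfrac\tau2,0\big),$$ where $R^{(+)}(\tau,z)=\eta(\frac\tau2)\eta(2\tau)\frac{\vartheta_{11}(\tau,z)}{\vartheta_{00}(\tau,z)}$ and 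$R^{(-)}(\tau,z)=\frac{\eta(\tau)^3}{\eta(\frac\tau2)}\cdot\frac{\vartheta_{11}(\tau,z)}{\vartheta_{01}(\tau,z)}$.
   Formalization: In part 1 the coefficient of the first summand is -i e^{-πim/2} instead of the printed -i; the printed coefficient contradicts the defining identity of the character (for m=1 the right-hand side is off by a factor i). *)

theory Defs
  imports "HOL-Analysis.Analysis"
begin

text \<open>
  The parameter tau always ranges over the upper half-plane, where all sums over the integers
  below converge absolutely (away from the poles of the summands) and may be taken with
  \<^const>\<open>infsum\<close>. Indices such as k, m, s are real because half-integers occur; powers of q with
  real exponent are defined through tau, so no choice of branch is involved.
\<close>

definition qpow :: "complex \<Rightarrow> real \<Rightarrow> complex" where
  "qpow \<tau> a = exp (2 * of_real pi * \<i> * of_real a * \<tau>)"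

definition theta :: "real \<Rightarrow> real \<Rightarrow> complex \<Rightarrow> complex \<Rightarrow> complex" where
  "theta k m \<tau> z = (\<Sum>\<^sub>\<infinity>j\<in>(UNIV::int set).
     exp (2 * of_real pi * \<i> * of_real (m * (of_int j + k / (2 * m))) * z)
       * qpow \<tau> (m * (of_int j + k / (2 * m))\<^sup>2))"

definition theta_minus :: "real \<Rightarrow> real \<Rightarrow> complex \<Rightarrow> complex \<Rightarrow> complex" where
  "theta_minus k m \<tau> z = (\<Sum>\<^sub>\<infinity>j\<in>(UNIV::int set). (- 1) powi j
     * exp (2 * of_real pi * \<i> * of_real (m * (of_int j + k / (2 * m))) * z)
     * qpow \<tau> (m * (of_int j + k / (2 * m))\<^sup>2))"

definition theta_odd :: "real \<Rightarrow> real \<Rightarrow> complex \<Rightarrow> complex \<Rightarrow> complex" where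
  "theta_odd k m \<tau> z = theta k m \<tau> z - theta (- k) m \<tau> z"

definition dedekind_eta :: "complex \<Rightarrow> complex" where
  "dedekind_eta \<tau> = qpow \<tau> (1 / 24) * (\<Prod>n. 1 - qpow \<tau> (real (Suc n)))"

definition mumford_theta :: "nat \<Rightarrow> nat \<Rightarrow> complex \<Rightarrow> complex \<Rightarrow> complex" where
  "mumford_theta a b \<tau> z = (\<Sum>\<^sub>\<infinity>n\<in>(UNIV::int set).
     exp (of_real pi * \<i> * (of_int n + of_nat a / 2)\<^sup>2 * \<tau>
          + 2 * of_real pi * \<i> * (of_int n + of_nat a / 2) * (z + of_nat b / 2)))"

definition Phi1 :: "real \<Rightarrow> real \<Rightarrow> complex \<Rightarrow> complex \<Rightarrow> complex \<Rightarrow> complex \<Rightarrow> complex" where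
  "Phi1 m s \<tau> z1 z2 t = exp (- 2 * of_real pi * \<i> * of_real m * t)
     * (\<Sum>\<^sub>\<infinity>j\<in>(UNIV::int set).
          exp (2 * of_real pi * \<i> * of_real m * of_int j * (z1 + z2)
               + 2 * of_real pi * \<i> * of_real s * z1)
            * qpow \<tau> (m * (of_int j)\<^sup>2 + s * of_int j)
          / (1 - exp (2 * of_real pi * \<i> * z1) * qpow \<tau> (of_int j)))"

definition Phi2 :: "real \<Rightarrow> real \<Rightarrow> complex \<Rightarrow> complex \<Rightarrow> complex \<Rightarrow> complex \<Rightarrow> complex" where
  "Phi2 m s \<tau> z1 z2 t = exp (- 2 * of_real pi * \<i> * of_real m * t)
     * (\<Sum>\<^sub>\<infinity>j\<in>(UNIV::int set).
          exp (- 2 * of_real pi * \<i> * of_real m * of_int j * (z1 + z2)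
               - 2 * of_real pi * \<i> * of_real s * z2)
            * qpow \<tau> (m * (of_int j)\<^sup>2 + s * of_int j)
          / (1 - exp (- 2 * of_real pi * \<i> * z2) * qpow \<tau> (of_int j)))"

definition Phi :: "real \<Rightarrow> real \<Rightarrow> complex \<Rightarrow> complex \<Rightarrow> complex \<Rightarrow> complex \<Rightarrow> complex" where
  "Phi m s \<tau> z1 z2 t = Phi1 m s \<tau> z1 z2 t - Phi2 m s \<tau> z1 z2 t"

definition R_plus :: "complex \<Rightarrow> complex \<Rightarrow> complex" where
  "R_plus \<tau> z = dedekind_eta (\<tau> / 2) * dedekind_eta (2 * \<tau>)
     * (mumford_theta 1 1 \<tau> z / mumford_theta 0 0 \<tau> z)"

definition R_minus :: "complex \<Rightarrow> complex \<Rightarrow> complex" where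
  "R_minus \<tau> z = dedekind_eta \<tau> ^ 3 / dedekind_eta (\<tau> / 2)
     * (mumford_theta 1 1 \<tau> z / mumford_theta 0 1 \<tau> z)"

text \<open>
  Characters and supercharacters are meromorphic functions of z. The identities are imposed at the
  points where numerator and denominator of the (super)denominator R are both nonzero; at such
  points no denominator in Phi vanishes, since with the arguments used below these denominators
  vanish only at zeros of the theta function in the denominator of R.
\<close>

definition N3_regular_plus :: "complex \<Rightarrow> complex \<Rightarrow> bool" where
  "N3_regular_plus \<tau> z \<longleftrightarrow> 0 < Im \<tau> \<and> mumford_theta 1 1 \<tau> z \<noteq> 0 \<and> mumford_theta 0 0 \<tau> z \<noteq> 0"

definition N3_regular_minus :: "complex \<Rightarrow> complex \<Rightarrow> bool" where
  "N3_regular_minus \<tau> z \<longleftrightarrow> 0 < Im \<tau> \<and> mumford_theta 1 1 \<tau> z \<noteq> 0 \<and> mumford_theta 0 1 \<tau> z \<noteq> 0"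

text \<open>
  The N=3 module H(Lambda) with Lambda = K(m) Lambda_0 - (m2/2) alpha_1 and K(m) = -(m+2)/4,
  obtained by quantum Hamiltonian reduction from the irreducible highest weight module L(Lambda)
  of the affine Lie superalgebra osp(3|2), enters only through its character and supercharacter,
  which are the functions determined by the following (known) identities.
\<close>

definition is_N3_character :: "nat \<Rightarrow> nat \<Rightarrow> (complex \<Rightarrow> complex \<Rightarrow> complex) \<Rightarrow> bool" where
  "is_N3_character m m2 ch \<longleftrightarrow> (\<forall>\<tau> z. N3_regular_plus \<tau> z \<longrightarrow>
     R_plus \<tau> z * ch \<tau> z = qpow \<tau> (- (real m / 16))
       * Phi (real m / 2) ((real m2 + 1) / 2) (2 * \<tau>)
             (z + \<tau> / 2 - 1 / 2) (z - \<tau> / 2 + 1 / 2) 0)"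

definition is_N3_supercharacter :: "nat \<Rightarrow> nat \<Rightarrow> (complex \<Rightarrow> complex \<Rightarrow> complex) \<Rightarrow> bool" where
  "is_N3_supercharacter m m2 ch \<longleftrightarrow> (\<forall>\<tau> z. N3_regular_minus \<tau> z \<longrightarrow>
     R_minus \<tau> z * ch \<tau> z = qpow \<tau> (- (real m / 16))
       * Phi (real m / 2) ((real m2 + 1) / 2) (2 * \<tau>) (z + \<tau> / 2) (z - \<tau> / 2) 0)"

text \<open>
  Erratum. In the closed formula for the character with m2 = 1, the first summand carries the
  coefficient \<open>- \<i> * exp (- (pi * \<i> * m / 2))\<close>, i.e. (-1)^((m+1)/2). In print the
  coefficient is just \<open>- \<i>\<close>, which contradicts the defining identity of the character for every
  odd m (for m = 1 that summand is the whole right-hand side, and it is off by the factor i).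
\<close>

end

theory Submission
  imports Defs
begin

text \<open>
  Put \<open>q = exp (2 \<pi> \<i> \<tau>)\<close>, \<open>w = exp (2 \<pi> \<i> z)\<close> and \<open>Y j = w q^(2 j) exp (\<pi> \<i> (\<tau> + c))\<close>, where \<open>c = 0\<close> for the
  supercharacter and \<open>c = -1\<close> for the character. With the Appell sum
  \<open>F z = \<Sum>j. w^(m j) q^(m j^2) Y j / (1 - Y j)\<close> the function on the right of the defining identity is
  \<open>F z - F (- z)\<close> in both cases (\<open>Phi_eq_appell\<close>). Hence both formulas are specialisations of one
  formula for \<open>F z - F (- z)\<close> with a parameter \<open>c\<close> (\<open>appell_difference_formula\<close>).

  Under \<open>z \<mapsto> z + 2 \<tau>\<close> the sum \<open>F\<close> has the multiplier of the theta functions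
  \<open>T n = \<Sum>k \<equiv> n (mod m). w^k q^(k^2 / m)\<close>, and it has one simple pole modulo periods. So it has to be a theta
  quotient with the same pole plus a combination of the \<open>T n\<close>. The combination is found by direct
  rearrangement of absolutely convergent series, without function theory, as follows.

  First, \<open>Y / (1 - Y) = Y^g / (1 - Y) + Y + \<dots> + Y^(g - 1)\<close> with \<open>g = (m + 1) / 2\<close>, and each \<open>Y^k\<close> contributes a
  multiple of \<open>T k\<close>; this is the last sum of the formulas (\<open>appell_shift\<close>). Next, multiply the remaining
  Appell sum by the theta null value \<open>\<Sum>i. (-1)^i q^((m + 1) i^2) exp (- \<pi> \<i> m i (\<tau> + c))\<close>, whose summand
  splits into \<open>q^(i^2)\<close> and a factor that completes a square: substituting \<open>s = j - i\<close> turns the product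
  into a double sum over \<open>(i, s)\<close> of
  \<open>(-1)^i q^(i^2) w^(m k) q^(m k^2) Y^(m i + 1/2) / (1 - Y)\<close> with \<open>k = s + 1/2\<close> and \<open>Y = Y (s + i)\<close>
  (\<open>theta_null_times_appell\<close>). The exponent \<open>m i + 1/2\<close> may be lowered to \<open>1/2\<close> at the cost of a finite
  geometric sum (\<open>appell2_geometric_difference\<close>).

  In the sum with exponent \<open>1/2\<close> the inner sum over \<open>i\<close> is the partial fraction expansion of the
  reciprocal of a theta function (\<open>reciprocal_theta_partial_fractions\<close>), the outer sum is then a theta
  series, and together they give the theta quotient (\<open>appell2_pole_part\<close>). In the geometric sums the
  summation over \<open>s\<close> gives theta functions \<open>T n\<close>, and what remains is a sum over \<open>j = |i|\<close> of \<open>m j\<close> terms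
  (\<open>appell_decomposition\<close>). Passing to \<open>F z - F (- z)\<close> replaces \<open>T n\<close> by \<open>T n - T (- n)\<close>; cutting the
  \<open>m j\<close> terms into \<open>j\<close> blocks of length \<open>m\<close> and folding each block at its centre, where \<open>T n - T (- n)\<close>
  vanishes, gives the two triple sums (\<open>odd_term_block_sum\<close>).

  The theta null value is nonzero by Jacobi's triple product. The triple product and the
  partial fractions are both limits of finite identities with Gaussian binomial coefficients, proved by
  induction; the limits are taken by dominated convergence.
\<close>

section \<open>Gaussian sums over the integers\<close>

lemma exp_neg_abs_summable_int: "(\<lambda>j::int. exp (- real_of_int \<bar>j\<bar>)) summable_on UNIV"
proof -
  have g: "(\<lambda>n::nat. exp (- real n)) summable_on UNIV"
  proof (rule norm_summable_imp_summable_on)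
    have "(\<lambda>n::nat. norm (exp (- real n))) = (\<lambda>n. exp (-1) ^ n)"
      by (auto simp: exp_of_nat_mult[symmetric])
    then show "summable (\<lambda>n::nat. norm (exp (- real n)))"
      by (simp add: summable_geometric)
  qed
  have a: "(\<lambda>j::int. exp (- real_of_int \<bar>j\<bar>)) summable_on range int"
    by (subst summable_on_reindex) (use g in \<open>auto simp: o_def\<close>)
  have b: "(\<lambda>j::int. exp (- real_of_int \<bar>j\<bar>)) summable_on range (\<lambda>n. - int n)"
    by (subst summable_on_reindex) (use g in \<open>auto simp: o_def inj_on_def\<close>)
  have "(UNIV::int set) = range int \<union> range (\<lambda>n. - int n)"
    by (auto simp: image_iff) (metis int_cases2)
  then show ?thesis using summable_on_union[OF a b] by simp
qed

text \<open>Completing the square bounds the exponent by a constant minus \<open>|j|\<close>.\<close>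

lemma gaussian_summable_int:
  fixes \<alpha> \<beta> :: real assumes "\<alpha> > 0"
  shows "(\<lambda>j::int. exp (- \<alpha> * (real_of_int j)\<^sup>2 + \<beta> * real_of_int j)) summable_on UNIV"
proof (rule summable_on_comparison_test)
  define C where "C = (\<bar>\<beta>\<bar> + 1)\<^sup>2 / (4 * \<alpha>)"
  show "(\<lambda>j::int. exp C * exp (- real_of_int \<bar>j\<bar>)) summable_on UNIV"
    by (intro summable_on_cmult_right exp_neg_abs_summable_int)
  fix j :: int
  have "0 \<le> \<alpha> * (\<bar>real_of_int j\<bar> - (\<bar>\<beta>\<bar> + 1) / (2 * \<alpha>))\<^sup>2" using assms by simp
  also have "\<dots> = \<alpha> * (real_of_int j)\<^sup>2 - (\<bar>\<beta>\<bar> + 1) * \<bar>real_of_int j\<bar> + C"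
    unfolding C_def using assms by (simp add: power2_eq_square field_simps)
  finally have "- \<alpha> * (real_of_int j)\<^sup>2 + \<bar>\<beta>\<bar> * \<bar>real_of_int j\<bar> \<le> C - \<bar>real_of_int j\<bar>"
    by (simp add: algebra_simps)
  moreover have "\<beta> * real_of_int j \<le> \<bar>\<beta>\<bar> * \<bar>real_of_int j\<bar>" by (metis abs_ge_self abs_mult)
  ultimately have "- \<alpha> * (real_of_int j)\<^sup>2 + \<beta> * real_of_int j \<le> C - \<bar>real_of_int j\<bar>" by linarith
  then show "exp (- \<alpha> * (real_of_int j)\<^sup>2 + \<beta> * real_of_int j) \<le> exp C * exp (- real_of_int \<bar>j\<bar>)"
    by (simp add: exp_add[symmetric])
qed auto

lemma theta_term_abs_summable:
  fixes y q :: complex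
  assumes "q \<noteq> 0" "norm q < 1" "y \<noteq> 0"
  shows "(\<lambda>j::int. norm (y powi j * q powi (j * j + b * j))) summable_on UNIV"
proof -
  have "norm (y powi j * q powi (j * j + b * j))
      = exp (- (- ln (norm q)) * (real_of_int j)\<^sup>2 + (ln (norm y) + of_int b * ln (norm q)) * real_of_int j)" for j
  proof -
    have e: "norm x powi k = exp (of_int k * ln (norm x))" if "x \<noteq> 0" for x :: complex and k
      using that powr_real_of_int'[of "norm x" k] by (simp add: powr_def)
    show ?thesis using assms
      by (simp add: norm_mult norm_power_int e exp_add[symmetric] power2_eq_square algebra_simps)
  qed
  then show ?thesis
    using gaussian_summable_int[of "- ln (norm q)" "ln (norm y) + of_int b * ln (norm q)"] assms by simp
qed

text \<open>
  Dominated convergence for unordered sums, obtained from the Lebesgue theorem for the counting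
  measure. It carries the finite product identities below to their limits.
\<close>

lemma tannery_infsum:
  fixes f :: "nat \<Rightarrow> 'a \<Rightarrow> complex"
  assumes "g summable_on UNIV" "\<And>N i. norm (f N i) \<le> g i" "\<And>i. (\<lambda>N. f N i) \<longlonglongrightarrow> l i"
  shows "(\<lambda>N. infsum (f N) UNIV) \<longlonglongrightarrow> infsum l UNIV"
proof -
  have g0: "0 \<le> g i" for i using assms(2)[of 0 i] norm_ge_zero order_trans by blast
  have lb: "norm (l i) \<le> g i" for i
    by (rule Lim_bounded[OF tendsto_norm[OF assms(3)]]) (use assms(2) in auto)
  have fi: "(\<lambda>i. norm (f N i)) summable_on UNIV" for N
    by (rule Infinite_Sum.abs_summable_on_comparison_test'[OF assms(1)]) (use assms(2) in auto)
  have li: "(\<lambda>i. norm (l i)) summable_on UNIV"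
    by (rule Infinite_Sum.abs_summable_on_comparison_test'[OF assms(1)]) (use lb in auto)
  have gi: "integrable (count_space UNIV) g"
    using assms(1) g0 abs_summable_equivalent[of g UNIV]
    by (simp add: Infinite_Set_Sum.abs_summable_on_def)
  have "(\<lambda>N. integral\<^sup>L (count_space UNIV) (f N)) \<longlonglongrightarrow> integral\<^sup>L (count_space UNIV) l"
    by (rule integral_dominated_convergence[where w = g]) (use assms gi in auto)
  moreover have "integral\<^sup>L (count_space UNIV) (f N) = infsum (f N) UNIV" for N
    using infsetsum_infsum[of "f N" UNIV] fi[of N] abs_summable_equivalent[of "f N" UNIV]
    by (simp add: infsetsum_def)
  moreover have "integral\<^sup>L (count_space UNIV) l = infsum l UNIV"
    using infsetsum_infsum[of l UNIV] li abs_summable_equivalent[of l UNIV]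
    by (simp add: infsetsum_def)
  ultimately show ?thesis by simp
qed

lemma has_sum_minus_diff:
  fixes f g :: "'a \<Rightarrow> 'b::real_normed_vector"
  assumes "(f has_sum a) A" "(g has_sum b) A"
  shows "((\<lambda>x. f x - g x) has_sum (a - b)) A"
  using has_sum_add[OF assms(1), of "\<lambda>x. - g x" "- b"] assms(2) by (simp add: has_sum_uminus)

lemma has_sum_int_shift:
  "((\<lambda>i::int. f (i + k)) has_sum S) UNIV \<longleftrightarrow> (f has_sum S) UNIV"
  by (rule has_sum_reindex_bij_witness[where i = "\<lambda>i. i - k" and j = "\<lambda>i. i + k"]) auto

lemma has_sum_int_reflect:
  "((\<lambda>i::int. f (k - i)) has_sum S) UNIV \<longleftrightarrow> (f has_sum S) UNIV"
  by (rule has_sum_reindex_bij_witness[where i = "\<lambda>i. k - i" and j = "\<lambda>i. k - i"]) auto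

section \<open>Jacobi's triple product and the reciprocal of a theta function\<close>

text \<open>The finite product \<open>(Q; Q)_n\<close> to the base \<open>Q = q^2\<close>; the square keeps all exponents below integral.\<close>

definition qpoch :: "complex \<Rightarrow> nat \<Rightarrow> complex" where
  "qpoch q n = (\<Prod>l<n. 1 - q ^ (2 * (l + 1)))"

text \<open>
  Extending \<open>1 / (Q; Q)_n\<close> by zero to negative \<open>n\<close> keeps the recursion \<open>inv_qpoch_rec\<close> valid for all integers.
  Sums against Gaussian binomial coefficients can then run over all integers and be shifted freely.
\<close>

definition inv_qpoch :: "complex \<Rightarrow> int \<Rightarrow> complex" where
  "inv_qpoch q n = (if n < 0 then 0 else 1 / qpoch q (nat n))"

lemma one_minus_power_nonzero:
  fixes q :: complex assumes "norm q < 1" "n > 0" shows "1 - q ^ n \<noteq> 0"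
proof -
  have "norm (q ^ n) < 1" using assms by (simp add: norm_power power_less_one_iff)
  then show ?thesis by auto
qed

lemma qpoch_nonzero:
  assumes "norm q < 1" shows "qpoch q n \<noteq> 0"
proof -
  have "1 - q ^ (2 * (l + 1)) \<noteq> 0" for l
    by (rule one_minus_power_nonzero[OF assms]) simp
  then show ?thesis unfolding qpoch_def prod_zero_iff[OF finite_lessThan] by blast
qed

lemma inv_qpoch_rec:
  assumes "norm q < 1"
  shows "inv_qpoch q (n - 1) = (1 - q powi (2 * n)) * inv_qpoch q n"
proof (cases "n > 0")
  case True
  then obtain k where k: "n = int (Suc k)" using pos_int_cases by (metis Suc_pred')
  have "q powi (2 * int (Suc k)) = q ^ (2 * (k + 1))"
    by (metis Suc_eq_plus1 int_ops(7) of_nat_numeral power_int_of_nat)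
  then show ?thesis using one_minus_power_nonzero[OF assms, of "2 * (k+1)"] qpoch_nonzero[OF assms]
    by (simp add: k inv_qpoch_def qpoch_def nat_add_distrib)
next
  case False
  then have "n = 0 \<or> n < 0" by auto
  then show ?thesis
  proof
    assume "n = 0"
    then show ?thesis by (simp add: inv_qpoch_def)
  next
    assume "n < 0"
    then show ?thesis by (simp add: inv_qpoch_def)
  qed
qed

text \<open>
  Passing from \<open>N\<close> to \<open>N + 1\<close> multiplies the product by a Laurent polynomial with three terms in \<open>y\<close>, so the
  coefficients must satisfy a three-term recursion, which the Gaussian binomial coefficients do.
\<close>

lemma finite_jacobi_triple_product:
  fixes q y :: complex
  assumes q: "q \<noteq> 0" "norm q < 1" and y: "y \<noteq> 0"
  shows "((\<lambda>i::int. (-1) powi i * y powi i * q powi (i * i - i)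
            * (inv_qpoch q (int N - i) * inv_qpoch q (int N + i))) has_sum
          (\<Prod>l<N. (1 - y * q ^ (2 * l)) * (1 - q ^ (2 * l + 2) / y)) / qpoch q (2 * N)) UNIV"
proof (induction N)
  case 0
  show ?case
  proof (rule has_sum_finite_neutralI[where B = "{0}"])
    fix i :: int assume "i \<in> UNIV - {0}"
    then have "inv_qpoch q (int 0 - i) = 0 \<or> inv_qpoch q (int 0 + i) = 0"
      unfolding inv_qpoch_def by (cases "i > 0") simp_all
    then show "(-1) powi i * y powi i * q powi (i * i - i) * (inv_qpoch q (int 0 - i) * inv_qpoch q (int 0 + i)) = 0"
      by (metis mult_zero_left mult_zero_right)
  qed (simp_all add: inv_qpoch_def qpoch_def)
next
  case (Suc N)
  define t where "t i = (-1) powi i * y powi i * q powi (i * i - i)" for i :: int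
  define a where "a N i = t i * (inv_qpoch q (int N - i) * inv_qpoch q (int N + i))" for N :: nat and i :: int
  define S where "S = (\<Prod>l<N. (1 - y * q ^ (2 * l)) * (1 - q ^ (2 * l + 2) / y)) / qpoch q (2 * N)"
  have IH: "(a N has_sum S) UNIV" using Suc.IH unfolding a_def t_def S_def by simp
  have IHm: "((\<lambda>i. a N (i - 1)) has_sum S) UNIV"
    using IH has_sum_int_shift[of "a N" "-1" S] by simp
  have IHp: "((\<lambda>i. a N (i + 1)) has_sum S) UNIV"
    using IH has_sum_int_shift[of "a N" 1 S] by simp
  define v where "v = q ^ (2 * N)"
  have vpi: "v = q powi (2 * int N)" unfolding v_def by (metis of_nat_mult of_nat_numeral power_int_of_nat)
  define d where "d = (1 - v * v * q\<^sup>2) * (1 - v * v * q ^ 4)"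
  have rec: "(1 + v * v * q\<^sup>2) * a N i - y * v * a N (i - 1) - v * q\<^sup>2 / y * a N (i + 1) = d * a (Suc N) i" for i
  proof -
    define u where "u = q powi (2 * i)"
    have u: "u \<noteq> 0" using q by (simp add: u_def)
    define A where "A = inv_qpoch q (int N + 1 - i)"
    define B where "B = inv_qpoch q (int N + 1 + i)"
    have p1: "q powi (2 * (int N + 1 - i)) = v * q\<^sup>2 / u"
      unfolding vpi u_def using q by (simp add: power_int_add power_int_diff algebra_simps)
    have p2: "q powi (2 * (int N + 1 + i)) = v * q\<^sup>2 * u"
      unfolding vpi u_def using q by (simp add: power_int_add power_int_diff algebra_simps)
    have p3: "q powi (2 * (int N - i)) = v / u"
      unfolding vpi u_def using q by (simp add: power_int_add power_int_diff algebra_simps)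
    have p4: "q powi (2 * (int N + i)) = v * u"
      unfolding vpi u_def using q by (simp add: power_int_add power_int_diff algebra_simps)
    have r1: "inv_qpoch q (int N - i) = (1 - v * q\<^sup>2 / u) * A"
      using inv_qpoch_rec[OF q(2), of "int N + 1 - i"] p1 unfolding A_def by (simp add: algebra_simps)
    have r2: "inv_qpoch q (int N + i) = (1 - v * q\<^sup>2 * u) * B"
      using inv_qpoch_rec[OF q(2), of "int N + 1 + i"] p2 unfolding B_def by (simp add: algebra_simps)
    have r3: "inv_qpoch q (int N - i - 1) = (1 - v / u) * ((1 - v * q\<^sup>2 / u) * A)"
      using inv_qpoch_rec[OF q(2), of "int N - i"] p3 r1 by simp
    have r4: "inv_qpoch q (int N + i - 1) = (1 - v * u) * ((1 - v * q\<^sup>2 * u) * B)"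
      using inv_qpoch_rec[OF q(2), of "int N + i"] p4 r2 by simp
    have tm: "t (i - 1) = - t i / y * q\<^sup>2 / u"
    proof -
      have "(i - 1) * (i - 1) - (i - 1) = (i * i - i) + (2 - 2 * i)" by (simp add: algebra_simps)
      then have "q powi ((i - 1) * (i - 1) - (i - 1)) = q powi (i * i - i) * q powi (2 - 2 * i)"
        using q by (metis power_int_add)
      also have "q powi (2 - 2 * i) = q\<^sup>2 / u"
        using q unfolding u_def by (simp add: power_int_diff)
      finally have "q powi ((i - 1) * (i - 1) - (i - 1)) = q powi (i * i - i) * (q\<^sup>2 / u)" .
      then show ?thesis unfolding t_def using y by (simp add: power_int_diff)
    qed
    have tp: "t (i + 1) = - t i * y * u"
    proof -
      have "(i + 1) * (i + 1) - (i + 1) = (i * i - i) + 2 * i" by (simp add: algebra_simps)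
      then have "q powi ((i + 1) * (i + 1) - (i + 1)) = q powi (i * i - i) * u"
        using q unfolding u_def by (metis power_int_add)
      then show ?thesis unfolding t_def using y by (simp add: power_int_add)
    qed
    have a0: "a N i = t i * ((1 - v * q\<^sup>2 / u) * A * ((1 - v * q\<^sup>2 * u) * B))"
      unfolding a_def r1 r2 by simp
    have a1: "a N (i - 1) = - t i / y * q\<^sup>2 / u * (A * ((1 - v * u) * ((1 - v * q\<^sup>2 * u) * B)))"
    proof -
      have "int N + (i - 1) = int N + i - 1" "int N - (i - 1) = int N + 1 - i" by simp_all
      then show ?thesis unfolding a_def tm by (simp only: r4 A_def[symmetric])
    qed
    have a2: "a N (i + 1) = - t i * y * u * ((1 - v / u) * ((1 - v * q\<^sup>2 / u) * A) * B)"
    proof -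
      have "int N - (i + 1) = int N - i - 1" "int N + (i + 1) = int N + 1 + i" by simp_all
      then show ?thesis unfolding a_def tp by (simp only: r3 B_def[symmetric])
    qed
    have a3: "a (Suc N) i = t i * (A * B)"
    proof -
      have "int (Suc N) - i = int N + 1 - i" "int (Suc N) + i = int N + 1 + i" by simp_all
      then show ?thesis unfolding a_def by (simp only: A_def B_def)
    qed
    define x where "x = 1 / u"
    have ux: "u * x = 1" using u by (simp add: x_def)
    \<comment> \<open>The recursion for Gaussian binomial coefficients, with \<open>g\<close> for the base and \<open>v = g^N\<close>, \<open>u = g^i\<close>.\<close>
    have poly: "(1 + v * v * g) * ((1 - v * g * x) * (1 - v * g * u)) + v * g * x * ((1 - v * u) * (1 - v * g * u))
        + v * g * u * ((1 - v * x) * (1 - v * g * x)) = (1 - v * v * g) * (1 - v * v * (g * g))" for g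
      using ux by algebra
    have "(1 + v * v * q\<^sup>2) * a N i - y * v * a N (i - 1) - v * q\<^sup>2 / y * a N (i + 1)
      = t i * A * B * ((1 + v * v * q\<^sup>2) * ((1 - v * q\<^sup>2 * x) * (1 - v * q\<^sup>2 * u))
        + v * q\<^sup>2 * x * ((1 - v * u) * (1 - v * q\<^sup>2 * u))
        + v * q\<^sup>2 * u * ((1 - v * x) * (1 - v * q\<^sup>2 * x)))"
    proof -
      have b0: "a N i = t i * A * B * ((1 - v * q\<^sup>2 * x) * (1 - v * q\<^sup>2 * u))"
        unfolding a0 x_def by (simp add: mult_ac)
      have b1: "y * v * a N (i - 1) = - (t i * A * B * (v * q\<^sup>2 * x * ((1 - v * u) * (1 - v * q\<^sup>2 * u))))"
        unfolding a1 x_def using y by (simp add: mult_ac)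
      have b2: "v * q\<^sup>2 / y * a N (i + 1) = - (t i * A * B * (v * q\<^sup>2 * u * ((1 - v * x) * (1 - v * q\<^sup>2 * x))))"
        unfolding a2 x_def using y by (simp add: mult_ac)
      show ?thesis unfolding b0 b1 b2 by algebra
    qed
    also have "\<dots> = d * a (Suc N) i"
      unfolding poly a3 d_def by (simp add: power2_eq_square power4_eq_xxxx mult_ac)
    finally show ?thesis .
  qed
  have "((\<lambda>i. (1 + v * v * q\<^sup>2) * a N i - y * v * a N (i - 1) - v * q\<^sup>2 / y * a N (i + 1)) has_sum
     ((1 + v * v * q\<^sup>2) * S - y * v * S - v * q\<^sup>2 / y * S)) UNIV"
    by (intro has_sum_minus_diff has_sum_cmult_right IH IHm IHp)
  then have H: "((\<lambda>i. d * a (Suc N) i) has_sum ((1 - y * v) * (1 - v * q\<^sup>2 / y) * S)) UNIV"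
    unfolding rec using y by (simp add: field_simps power2_eq_square)
  have e1: "v * v * q\<^sup>2 = q ^ (2 * (2 * N + 1))" and e2: "v * v * q ^ 4 = q ^ (2 * (2 * N + 2))"
    unfolding v_def power_add[symmetric] by (rule arg_cong[where f = "power q"], simp)+
  have dnz: "d \<noteq> 0" unfolding d_def e1 e2
    by (intro no_zero_divisors one_minus_power_nonzero q(2)) simp_all
  have "((\<lambda>i. a (Suc N) i) has_sum ((1 - y * v) * (1 - v * q\<^sup>2 / y) * S / d)) UNIV"
    using has_sum_cmult_right[OF H, of "1 / d"] dnz by simp
  moreover have "(1 - y * v) * (1 - v * q\<^sup>2 / y) * S / d
     = (\<Prod>l<Suc N. (1 - y * q ^ (2 * l)) * (1 - q ^ (2 * l + 2) / y)) / qpoch q (2 * Suc N)"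
  proof -
    have "qpoch q (2 * Suc N) = qpoch q (2 * N) * d"
    proof -
      have n: "2 * Suc N = Suc (Suc (2 * N))" "2 * (Suc (2 * N) + 1) = 2 * (2 * N + 2)" by simp_all
      show ?thesis unfolding qpoch_def d_def e1 e2 n(1) prod.lessThan_Suc n(2) by (simp only: mult.assoc)
    qed
    then show ?thesis unfolding S_def by (simp add: v_def power_add mult_ac power2_eq_square)
  qed
  ultimately show ?case unfolding a_def t_def by simp
qed

lemma convergent_prod_one_minus_geometric:
  fixes q a :: complex assumes "norm q < 1"
  shows "convergent_prod (\<lambda>n. 1 - a * q ^ (2 * n))"
proof (rule abs_convergent_prod_imp_convergent_prod, rule summable_imp_abs_convergent_prod)
  have "norm (q\<^sup>2) < 1" using assms by (simp add: norm_power power_less_one_iff)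
  then have "summable (\<lambda>n. norm a * norm (q\<^sup>2) ^ n)"
    by (intro summable_mult summable_geometric) simp
  then show "summable (\<lambda>i. norm (1 - a * q ^ (2 * i) - 1))"
    by (simp add: norm_mult norm_power power_mult)
qed

text \<open>The infinite product \<open>(a; q^2)\<close>.\<close>

definition qprod :: "complex \<Rightarrow> complex \<Rightarrow> complex" where
  "qprod a q = (\<Prod>n. 1 - a * q ^ (2 * n))"

lemma qprod_LIMSEQ:
  assumes "norm q < 1"
  shows "(\<lambda>N. \<Prod>l<N. 1 - a * q ^ (2 * l)) \<longlonglongrightarrow> qprod a q"
  unfolding qprod_def
  by (rule has_prod_imp_tendsto'[OF convergent_prod_has_prod[OF convergent_prod_one_minus_geometric[OF assms]]])

lemma qprod_nonzero:
  assumes "norm q < 1" "\<And>n. a * q ^ (2 * n) \<noteq> 1"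
  shows "qprod a q \<noteq> 0"
  unfolding qprod_def
  by (rule prodinf_nonzero[OF convergent_prod_one_minus_geometric[OF assms(1)]]) (use assms(2) in \<open>metis eq_iff_diff_eq_0\<close>)

lemma square_mult_even_power: "q\<^sup>2 * q ^ (2 * n) = (q::complex) ^ (2 * (n + 1))"
  unfolding power_add[symmetric] by (rule arg_cong[where f = "power q"]) simp

lemma qpoch_LIMSEQ:
  assumes "norm q < 1" shows "qpoch q \<longlonglongrightarrow> qprod (q\<^sup>2) q"
  using qprod_LIMSEQ[OF assms, of "q\<^sup>2"]
  unfolding square_mult_even_power qpoch_def[abs_def] .

lemma qpoch_limit_nonzero:
  assumes "norm q < 1" shows "qprod (q\<^sup>2) q \<noteq> 0"
proof (rule qprod_nonzero[OF assms])
  fix n show "q\<^sup>2 * q ^ (2 * n) \<noteq> 1"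
    unfolding square_mult_even_power using one_minus_power_nonzero[OF assms, of "2 * (n + 1)"] by auto
qed

lemma inv_qpoch_bounded:
  assumes "norm q < 1" obtains C where "C > 0" "\<And>n. norm (inv_qpoch q n) \<le> C"
proof -
  have "(\<lambda>n. 1 / qpoch q n) \<longlonglongrightarrow> 1 / qprod (q\<^sup>2) q"
    by (intro tendsto_intros qpoch_LIMSEQ assms qpoch_limit_nonzero)
  then have "Bseq (\<lambda>n. 1 / qpoch q n)" by (intro convergent_imp_Bseq convergentI)
  then obtain C where C: "C > 0" "\<And>n. norm (1 / qpoch q n) \<le> C" by (auto simp: Bseq_def)
  show ?thesis by (rule that[OF C(1)]) (use C in \<open>auto simp: inv_qpoch_def\<close>)
qed

lemma inv_qpoch_LIMSEQ:
  assumes "norm q < 1" shows "(\<lambda>N. inv_qpoch q (int N + i)) \<longlonglongrightarrow> 1 / qprod (q\<^sup>2) q"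
proof (rule Lim_transform_eventually)
  have "filterlim (\<lambda>N. nat (int N + i)) sequentially sequentially"
    unfolding filterlim_at_top eventually_sequentially
  proof
    fix Z :: nat
    show "\<exists>N. \<forall>n\<ge>N. Z \<le> nat (int n + i)" by (rule exI[of _ "Z + nat \<bar>i\<bar>"]) auto
  qed
  then show "(\<lambda>N. 1 / qpoch q (nat (int N + i))) \<longlonglongrightarrow> 1 / qprod (q\<^sup>2) q"
    by (intro tendsto_intros filterlim_compose[OF qpoch_LIMSEQ[OF assms]] qpoch_limit_nonzero assms)
  show "\<forall>\<^sub>F N in sequentially. 1 / qpoch q (nat (int N + i)) = inv_qpoch q (int N + i)"
    unfolding eventually_sequentially by (rule exI[of _ "nat \<bar>i\<bar>"]) (auto simp: inv_qpoch_def)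
qed

lemma inv_qpoch_pair_LIMSEQ:
  assumes "norm q < 1"
  shows "(\<lambda>N. inv_qpoch q (int N - i) * inv_qpoch q (int N + i)) \<longlonglongrightarrow> 1 / (qprod (q\<^sup>2) q)\<^sup>2"
  using tendsto_mult[OF inv_qpoch_LIMSEQ[OF assms, of "- i"] inv_qpoch_LIMSEQ[OF assms, of i]]
  by (simp add: power2_eq_square)

text \<open>The theta series normalised so that it vanishes exactly at the \<open>y\<close> that are even powers of \<open>q\<close>.\<close>

definition jtheta :: "complex \<Rightarrow> complex \<Rightarrow> complex" where
  "jtheta y q = (\<Sum>\<^sub>\<infinity>i\<in>(UNIV::int set). (-1) powi i * y powi i * q powi (i * i - i))"

lemma norm_minus_one_powi [simp]: "norm ((-1 :: complex) powi i) = 1"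
  by (simp add: norm_power_int)

theorem jacobi_triple_product:
  assumes q: "q \<noteq> 0" "norm q < 1" and y: "y \<noteq> 0"
  shows "jtheta y q = qprod (q\<^sup>2) q * qprod y q * qprod (q\<^sup>2 / y) q"
proof -
  define t where "t i = (-1) powi i * y powi i * q powi (i * i - i)" for i :: int
  define Q where "Q = qprod (q\<^sup>2) q"
  have Q: "Q \<noteq> 0" unfolding Q_def by (rule qpoch_limit_nonzero[OF q(2)])
  obtain C where C: "C > 0" "\<And>n. norm (inv_qpoch q n) \<le> C" using inv_qpoch_bounded[OF q(2)] by blast
  have sm: "(\<lambda>i. C * C * norm (t i)) summable_on UNIV"
    using theta_term_abs_summable[OF q y, of "-1"]
    by (intro summable_on_cmult_right) (simp add: t_def norm_mult)
  have "(\<lambda>N. infsum (\<lambda>i. t i * (inv_qpoch q (int N - i) * inv_qpoch q (int N + i))) UNIV)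
      \<longlonglongrightarrow> infsum (\<lambda>i. t i * (1 / Q\<^sup>2)) UNIV"
  proof (rule tannery_infsum[OF sm])
    fix N i
    have "norm (inv_qpoch q (int N - i)) * norm (inv_qpoch q (int N + i)) \<le> C * C"
      using C by (intro mult_mono) auto
    then have "norm (t i) * (norm (inv_qpoch q (int N - i)) * norm (inv_qpoch q (int N + i))) \<le> norm (t i) * (C * C)"
      by (intro mult_left_mono) auto
    then show "norm (t i * (inv_qpoch q (int N - i) * inv_qpoch q (int N + i))) \<le> C * C * norm (t i)"
      by (simp add: norm_mult mult.commute)
    show "(\<lambda>N. t i * (inv_qpoch q (int N - i) * inv_qpoch q (int N + i))) \<longlonglongrightarrow> t i * (1 / Q\<^sup>2)"
      unfolding Q_def by (intro tendsto_mult tendsto_const inv_qpoch_pair_LIMSEQ q)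
  qed
  moreover have "infsum (\<lambda>i. t i * (inv_qpoch q (int N - i) * inv_qpoch q (int N + i))) UNIV
      = (\<Prod>l<N. 1 - y * q ^ (2 * l)) * (\<Prod>l<N. 1 - q\<^sup>2 / y * q ^ (2 * l)) * (1 / qpoch q (2 * N))" for N
  proof -
    have e: "q ^ (2 * l + 2) / y = q\<^sup>2 / y * q ^ (2 * l)" for l
      unfolding power_add by (simp only: mult.commute times_divide_eq_left times_divide_eq_right)
    show ?thesis
      using infsumI[OF finite_jacobi_triple_product[OF q y, of N]]
      unfolding t_def e prod.distrib by simp
  qed
  moreover have "(\<lambda>N. (\<Prod>l<N. 1 - y * q ^ (2 * l)) * (\<Prod>l<N. 1 - q\<^sup>2 / y * q ^ (2 * l)) * (1 / qpoch q (2 * N)))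
     \<longlonglongrightarrow> qprod y q * qprod (q\<^sup>2 / y) q * (1 / Q)"
  proof (intro tendsto_mult qprod_LIMSEQ q tendsto_divide tendsto_const Q)
    have "filterlim (\<lambda>N::nat. 2 * N) sequentially sequentially"
      by (rule filterlim_subseq) (auto simp: strict_mono_def)
    then show "(\<lambda>N. qpoch q (2 * N)) \<longlonglongrightarrow> Q"
      unfolding Q_def by (rule filterlim_compose[OF qpoch_LIMSEQ[OF q(2)]])
  qed
  ultimately have "infsum (\<lambda>i. t i * (1 / Q\<^sup>2)) UNIV = qprod y q * qprod (q\<^sup>2 / y) q * (1 / Q)"
    using LIMSEQ_unique by simp
  moreover have "infsum (\<lambda>i. t i * (1 / Q\<^sup>2)) UNIV = jtheta y q * (1 / Q\<^sup>2)"
    unfolding jtheta_def t_def by (rule infsum_cmult_left')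
  ultimately show ?thesis using Q unfolding Q_def[symmetric]
    by (simp add: field_simps power2_eq_square)
qed

lemma qprod_nonzero_powi:
  assumes q: "q \<noteq> 0" "norm q < 1" and y: "y \<noteq> 0" and nz: "\<And>i::int. y * q powi (2 * i) \<noteq> 1"
  shows "qprod y q \<noteq> 0" "qprod (q\<^sup>2 / y) q \<noteq> 0"
proof -
  show "qprod y q \<noteq> 0"
  proof (rule qprod_nonzero[OF q(2)])
    fix n show "y * q ^ (2 * n) \<noteq> 1"
      using nz[of "int n"] power_int_of_nat[of q "2 * n"] by simp
  qed
  show "qprod (q\<^sup>2 / y) q \<noteq> 0"
  proof (rule qprod_nonzero[OF q(2)])
    fix n
    have "2 * (- int n - 1) = - int (2 * (n + 1))" by simp
    then have "q powi (2 * (- int n - 1)) = inverse (q ^ (2 * (n + 1)))"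
      by (metis power_int_minus power_int_of_nat)
    then have "y \<noteq> q ^ (2 * (n + 1))"
      using nz[of "- int n - 1"] q by (metis power_not_zero right_inverse)
    moreover have "q\<^sup>2 / y * q ^ (2 * n) = q ^ (2 * (n + 1)) / y"
      unfolding square_mult_even_power[symmetric] by simp
    ultimately show "q\<^sup>2 / y * q ^ (2 * n) \<noteq> 1"
      using y by (metis divide_eq_1_iff)
  qed
qed

lemma jtheta_nonzero:
  assumes "q \<noteq> 0" "norm q < 1" "y \<noteq> 0" "\<And>i::int. y * q powi (2 * i) \<noteq> 1"
  shows "jtheta y q \<noteq> 0"
  using jacobi_triple_product[OF assms(1-3)] qpoch_limit_nonzero[OF assms(2)] qprod_nonzero_powi[OF assms]
  by simp

text \<open>The denominators tend to \<open>1\<close> in one direction and to infinity in the other.\<close>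

lemma bounded_inverse_one_minus:
  fixes q y :: complex
  assumes q: "q \<noteq> 0" "norm q < 1" and y: "y \<noteq> 0" and nz: "\<And>i::int. y * q powi (2 * i) \<noteq> 1"
  obtains C where "C > 0" "\<And>i::int. norm (1 / (1 - y * q powi (2 * i))) \<le> C"
proof -
  have "norm (q\<^sup>2) < 1" using q by (simp add: norm_power power_less_one_iff)
  then have lim: "(\<lambda>n. q ^ (2 * n)) \<longlonglongrightarrow> 0"
    using LIMSEQ_power_zero[of "q\<^sup>2"] by (simp add: power_mult)
  have "(\<lambda>n. 1 / (1 - y * q ^ (2 * n))) \<longlonglongrightarrow> 1 / (1 - y * 0)"
    by (intro tendsto_intros lim) auto
  then have "Bseq (\<lambda>n. 1 / (1 - y * q ^ (2 * n)))" by (intro convergent_imp_Bseq convergentI)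
  then obtain C1 where C1: "C1 > 0" "\<And>n. norm (1 / (1 - y * q ^ (2 * n))) \<le> C1" by (auto simp: Bseq_def)
  have "(\<lambda>n. q ^ (2 * n) / (q ^ (2 * n) - y)) \<longlonglongrightarrow> 0 / (0 - y)"
    by (intro tendsto_intros lim) (use y in auto)
  then have "Bseq (\<lambda>n. q ^ (2 * n) / (q ^ (2 * n) - y))" by (intro convergent_imp_Bseq convergentI)
  then obtain C2 where C2: "C2 > 0" "\<And>n. norm (q ^ (2 * n) / (q ^ (2 * n) - y)) \<le> C2" by (auto simp: Bseq_def)
  show ?thesis
  proof (rule that[of "max C1 C2"])
    show "max C1 C2 > 0" using C1 by simp
    fix i :: int
    show "norm (1 / (1 - y * q powi (2 * i))) \<le> max C1 C2"
    proof (cases "i \<ge> 0")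
      case True
      then obtain n where n: "i = int n" using nonneg_int_cases by blast
      have "q powi (2 * i) = q ^ (2 * n)" unfolding n by (metis of_nat_mult of_nat_numeral power_int_of_nat)
      then show ?thesis using C1(2)[of n] by simp
    next
      case False
      then obtain n where n: "i = - int n" by (metis int_cases2 of_nat_0_le_iff)
      have "q powi (2 * i) = inverse (q ^ (2 * n))"
        unfolding n by (metis mult_minus_right of_nat_mult of_nat_numeral power_int_minus power_int_of_nat)
      moreover have "1 - y * inverse X = (X - y) / X" if "X \<noteq> 0" for X
        using that by (simp add: field_simps)
      ultimately have "1 / (1 - y * q powi (2 * i)) = q ^ (2 * n) / (q ^ (2 * n) - y)"
        using q by simp
      then show ?thesis using C2(2)[of n] by simp
    qed
  qed
qed

text \<open>
  With \<open>s N i\<close> for the summand, the induction step rests on the identity that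
  \<open>(1 - y Q^(N+1)) (1 - Q^(N+1) / y) s (N + 1) i - s N i\<close> no longer has the pole at \<open>y Q^i = 1\<close>: it is \<open>Q^(N+1)\<close> times
  a combination of \<open>w i Q^(-i)\<close> and \<open>w i\<close>. Both of these sum to zero by the finite triple product at \<open>y = 1\<close>.
\<close>

lemma finite_reciprocal_partial_fractions:
  fixes q y :: complex
  assumes q: "q \<noteq> 0" "norm q < 1" and y: "y \<noteq> 0" and nz: "\<And>i::int. y * q powi (2 * i) \<noteq> 1"
  shows "((\<lambda>i::int. (-1) powi i * q powi (i * i + i) / (1 - y * q powi (2 * i))
            * (inv_qpoch q (int N - i) * inv_qpoch q (int N + i))) has_sum
          1 / ((\<Prod>l<Suc N. 1 - y * q ^ (2 * l)) * (\<Prod>l<N. 1 - q\<^sup>2 / y * q ^ (2 * l)))) UNIV"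
proof (induction N)
  case 0
  show ?case
  proof (rule has_sum_finite_neutralI[where B = "{0}"])
    fix i :: int assume "i \<in> UNIV - {0}"
    then have "inv_qpoch q (int 0 - i) = 0 \<or> inv_qpoch q (int 0 + i) = 0"
      unfolding inv_qpoch_def by (cases "i > 0") simp_all
    then show "(-1) powi i * q powi (i * i + i) / (1 - y * q powi (2 * i))
            * (inv_qpoch q (int 0 - i) * inv_qpoch q (int 0 + i)) = 0"
      by (metis mult_zero_left mult_zero_right)
  qed (simp_all add: inv_qpoch_def qpoch_def)
next
  case (Suc N)
  define s where "s N i = (-1) powi i * q powi (i * i + i) / (1 - y * q powi (2 * i))
            * (inv_qpoch q (int N - i) * inv_qpoch q (int N + i))" for N :: nat and i :: int
  define S where "S = 1 / ((\<Prod>l<Suc N. 1 - y * q ^ (2 * l)) * (\<Prod>l<N. 1 - q\<^sup>2 / y * q ^ (2 * l)))"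
  have IH: "(s N has_sum S) UNIV" using Suc.IH unfolding s_def S_def .
  define w where "w i = (-1) powi i * q powi (i * i + i)
     * (inv_qpoch q (int N + 1 - i) * inv_qpoch q (int N + 1 + i))" for i :: int
  \<comment> \<open>At \<open>y = 1\<close> the factor \<open>l = 0\<close> of the product vanishes.\<close>
  have p0: "(\<Prod>l<Suc N. (1 - 1 * q ^ (2 * l)) * (1 - q ^ (2 * l + 2) / 1)) = 0"
    by (rule prod_zero) (auto intro!: bexI[of _ 0])
  have "((\<lambda>i::int. (-1) powi i * 1 powi i * q powi (i * i - i)
            * (inv_qpoch q (int (Suc N) - i) * inv_qpoch q (int (Suc N) + i))) has_sum 0) UNIV"
    using finite_jacobi_triple_product[OF q, of 1 "Suc N"] unfolding p0 by simp
  then have w0: "((\<lambda>i::int. (-1) powi i * q powi (i * i - i)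
            * (inv_qpoch q (int N + 1 - i) * inv_qpoch q (int N + 1 + i))) has_sum 0) UNIV"
    by (simp add: add.commute)
  have w1: "((\<lambda>i. w i * q powi (- 2 * i)) has_sum 0) UNIV"
  proof -
    have "w i * q powi (- 2 * i) = (-1) powi i * q powi (i * i - i)
            * (inv_qpoch q (int N + 1 - i) * inv_qpoch q (int N + 1 + i))" for i
    proof -
      have "i * i - i = (i * i + i) + (- 2 * i)" by simp
      then have "q powi (i * i - i) = q powi (i * i + i) * q powi (- 2 * i)"
        using q by (metis power_int_add)
      then show ?thesis unfolding w_def by (simp only: mult_ac)
    qed
    then show ?thesis using w0 by simp
  qed
  \<comment> \<open>Reflection in \<open>i\<close> exchanges \<open>q^(i^2 - i)\<close> and \<open>q^(i^2 + i)\<close>.\<close>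
  have w2: "(w has_sum 0) UNIV"
  proof -
    have "w (0 - i) = (-1) powi i * q powi (i * i - i)
            * (inv_qpoch q (int N + 1 - i) * inv_qpoch q (int N + 1 + i))" for i
      unfolding w_def by (simp add: power_int_minus_left mult_ac power_int_minus)
    then have "((\<lambda>i. w (0 - i)) has_sum 0) UNIV" using w0 by simp
    then show ?thesis unfolding has_sum_int_reflect .
  qed
  define v where "v = q ^ (2 * Suc N)"
  have vpi: "v = q powi (2 * (int N + 1))" unfolding v_def
    by (metis int_ops(7) of_nat_Suc of_nat_numeral power_int_of_nat add.commute)
  define d where "d = (1 - y * v) * (1 - v / y)"
  have v1: "1 - y * v \<noteq> 0" using nz[of "int N + 1"] unfolding vpi by auto
  have v2: "1 - v / y \<noteq> 0"
  proof
    assume "1 - v / y = 0"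
    then have "y * inverse v = 1" using y by (auto simp: field_simps)
    moreover have "inverse v = q powi (2 * (- int N - 1))"
      unfolding vpi power_int_minus[symmetric] by (rule arg_cong[where f = "power_int q"]) simp
    ultimately show False using nz[of "- int N - 1"] by simp
  qed
  have rec: "s N i + v * (w i * q powi (- 2 * i) - w i * (1 / y)) = d * s (Suc N) i" for i
  proof -
    define u where "u = q powi (2 * i)"
    have u: "u \<noteq> 0" using q by (simp add: u_def)
    define x where "x = 1 / u"
    have ux: "u * x = 1" using u by (simp add: x_def)
    have xp: "q powi (- 2 * i) = x" unfolding x_def u_def by (simp add: power_int_minus field_simps)
    define A where "A = inv_qpoch q (int N + 1 - i)"
    define B where "B = inv_qpoch q (int N + 1 + i)"
    define t where "t = (-1) powi i * q powi (i * i + i)"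
    have D: "1 - y * u \<noteq> 0" using nz[of i] unfolding u_def by auto
    define D where "D = 1 / (1 - y * u)"
    have DD: "D * (1 - y * u) = 1" using D by (simp add: D_def)
    define z where "z = 1 / y"
    have yz: "y * z = 1" using y by (simp add: z_def)
    have p1: "q powi (2 * (int N + 1 - i)) = v * x"
    proof -
      have "2 * (int N + 1 - i) = 2 * (int N + 1) + (- 2 * i)" by simp
      then show ?thesis unfolding vpi xp[symmetric] using q by (metis power_int_add)
    qed
    have p2: "q powi (2 * (int N + 1 + i)) = v * u"
    proof -
      have "2 * (int N + 1 + i) = 2 * (int N + 1) + 2 * i" by simp
      then show ?thesis unfolding vpi u_def using q by (metis power_int_add)
    qed
    have r1: "inv_qpoch q (int N - i) = (1 - v * x) * A"
      using inv_qpoch_rec[OF q(2), of "int N + 1 - i"] p1 unfolding A_def by (simp add: algebra_simps)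
    have r2: "inv_qpoch q (int N + i) = (1 - v * u) * B"
      using inv_qpoch_rec[OF q(2), of "int N + 1 + i"] p2 unfolding B_def by (simp add: algebra_simps)
    have s0: "s N i = t * D * ((1 - v * x) * A * ((1 - v * u) * B))"
      unfolding s_def r1 r2 D_def u_def t_def by simp
    have s1: "s (Suc N) i = t * D * (A * B)"
    proof -
      have e: "int (Suc N) - i = int N + 1 - i" "int (Suc N) + i = int N + 1 + i" by simp_all
      show ?thesis unfolding s_def e D_def u_def t_def A_def B_def by simp
    qed
    have wi: "w i = t * (A * B)" unfolding w_def t_def A_def B_def by simp
    have "(1 - v * x) * (1 - v * u) * D + v * (x - z) = (1 - y * v) * (1 - v * z) * D"
      using ux yz DD by algebra
    moreover have "s N i + v * (w i * q powi (- 2 * i) - w i * (1 / y))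
        = t * (A * B) * ((1 - v * x) * (1 - v * u) * D + v * (x - z))"
      unfolding s0 wi xp z_def[symmetric] by (simp add: algebra_simps)
    moreover have "d * s (Suc N) i = t * (A * B) * ((1 - y * v) * (1 - v * z) * D)"
      unfolding s1 d_def z_def by (simp add: mult_ac)
    ultimately show ?thesis by simp
  qed
  have "((\<lambda>i. s N i + v * (w i * q powi (- 2 * i) - w i * (1 / y))) has_sum (S + v * (0 - 0 * (1 / y)))) UNIV"
    by (intro has_sum_add IH has_sum_cmult_right has_sum_minus_diff has_sum_cmult_left w1 w2)
  then have "((\<lambda>i. d * s (Suc N) i) has_sum S) UNIV" unfolding rec by simp
  from has_sum_cmult_right[OF this, of "1 / d"]
  have "(s (Suc N) has_sum (S / d)) UNIV" using v1 v2 by (simp add: d_def)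
  moreover have "S / d = 1 / ((\<Prod>l<Suc (Suc N). 1 - y * q ^ (2 * l)) * (\<Prod>l<Suc N. 1 - q\<^sup>2 / y * q ^ (2 * l)))"
  proof -
    have "1 - v / y = 1 - q\<^sup>2 / y * q ^ (2 * N)" unfolding v_def by (simp add: power2_eq_square)
    then show ?thesis unfolding S_def d_def prod.lessThan_Suc[of _ "Suc N"] prod.lessThan_Suc[of "\<lambda>l. 1 - q\<^sup>2 / y * q ^ (2 * l)" N]
      v_def by (simp only: divide_divide_eq_left mult_ac)
  qed
  ultimately show ?case unfolding s_def by (simp only:)
qed

text \<open>
  The summands are dominated because both \<open>inv_qpoch\<close> and the denominators are bounded, which leaves a
  Gaussian factor.
\<close>

theorem reciprocal_theta_partial_fractions:
  assumes q: "q \<noteq> 0" "norm q < 1" and y: "y \<noteq> 0" and nz: "\<And>i::int. y * q powi (2 * i) \<noteq> 1"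
  shows "(\<Sum>\<^sub>\<infinity>i\<in>(UNIV::int set). (-1) powi i * q powi (i * i + i) / (1 - y * q powi (2 * i)))
    = qprod (q\<^sup>2) q ^ 3 / jtheta y q"
proof -
  define t where "t i = (-1) powi i * q powi (i * i + i) / (1 - y * q powi (2 * i))" for i :: int
  define Q where "Q = qprod (q\<^sup>2) q"
  have Q: "Q \<noteq> 0" unfolding Q_def by (rule qpoch_limit_nonzero[OF q(2)])
  obtain C where C: "C > 0" "\<And>n. norm (inv_qpoch q n) \<le> C" using inv_qpoch_bounded[OF q(2)] by blast
  obtain K where K: "K > 0" "\<And>i. norm (1 / (1 - y * q powi (2 * i))) \<le> K"
    using bounded_inverse_one_minus[OF q y nz] by metis
  have sm: "(\<lambda>i. C * C * K * norm (q powi (i * i + i))) summable_on UNIV"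
    using theta_term_abs_summable[OF q, of 1 1] by (intro summable_on_cmult_right) (simp add: norm_mult)
  have "(\<lambda>N. infsum (\<lambda>i. t i * (inv_qpoch q (int N - i) * inv_qpoch q (int N + i))) UNIV)
      \<longlonglongrightarrow> infsum (\<lambda>i. t i * (1 / Q\<^sup>2)) UNIV"
  proof (rule tannery_infsum[OF sm])
    fix N i
    have "norm (t i) \<le> K * norm (q powi (i * i + i))"
      using mult_right_mono[OF K(2)[of i], of "norm (q powi (i * i + i))"]
      by (simp add: t_def norm_mult norm_divide)
    moreover have "norm (inv_qpoch q (int N - i)) * norm (inv_qpoch q (int N + i)) \<le> C * C"
      using C by (intro mult_mono) auto
    ultimately have "norm (t i) * (norm (inv_qpoch q (int N - i)) * norm (inv_qpoch q (int N + i)))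
       \<le> (K * norm (q powi (i * i + i))) * (C * C)"
      using K(1) by (intro mult_mono[of "norm (t i)"]) auto
    then show "norm (t i * (inv_qpoch q (int N - i) * inv_qpoch q (int N + i))) \<le> C * C * K * norm (q powi (i * i + i))"
      by (simp add: norm_mult mult_ac)
    show "(\<lambda>N. t i * (inv_qpoch q (int N - i) * inv_qpoch q (int N + i))) \<longlonglongrightarrow> t i * (1 / Q\<^sup>2)"
      unfolding Q_def by (intro tendsto_mult tendsto_const inv_qpoch_pair_LIMSEQ q)
  qed
  moreover have "infsum (\<lambda>i. t i * (inv_qpoch q (int N - i) * inv_qpoch q (int N + i))) UNIV
      = 1 / ((\<Prod>l<Suc N. 1 - y * q ^ (2 * l)) * (\<Prod>l<N. 1 - q\<^sup>2 / y * q ^ (2 * l)))" for N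
    unfolding t_def by (rule infsumI[OF finite_reciprocal_partial_fractions[OF q y nz]])
  moreover have "(\<lambda>N. 1 / ((\<Prod>l<Suc N. 1 - y * q ^ (2 * l)) * (\<Prod>l<N. 1 - q\<^sup>2 / y * q ^ (2 * l))))
     \<longlonglongrightarrow> 1 / (qprod y q * qprod (q\<^sup>2 / y) q)"
    using qprod_nonzero_powi[OF q y nz]
    by (intro tendsto_mult qprod_LIMSEQ q tendsto_divide tendsto_const LIMSEQ_Suc[OF qprod_LIMSEQ[OF q(2)]]) auto
  ultimately have "infsum (\<lambda>i. t i * (1 / Q\<^sup>2)) UNIV = 1 / (qprod y q * qprod (q\<^sup>2 / y) q)"
    using LIMSEQ_unique by simp
  moreover have "infsum (\<lambda>i. t i * (1 / Q\<^sup>2)) UNIV = infsum t UNIV * (1 / Q\<^sup>2)"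
    by (rule infsum_cmult_left')
  ultimately have "infsum t UNIV = Q\<^sup>2 / (qprod y q * qprod (q\<^sup>2 / y) q)"
    using Q by (simp add: field_simps)
  also have "\<dots> = Q ^ 3 / jtheta y q"
    unfolding jacobi_triple_product[OF q y] Q_def[symmetric]
    using Q by (simp add: power2_eq_square power3_eq_cube)
  finally show ?thesis unfolding t_def Q_def .
qed

lemma jtheta_quasiperiodic:
  assumes q: "q \<noteq> 0" and y: "y \<noteq> 0"
  shows "jtheta (y * q powi (2 * s)) q = (-1) powi s * y powi (- s) * q powi (s - s * s) * jtheta y q"
proof -
  define t where "t i = (-1) powi i * y powi i * q powi (i * i - i)" for i :: int
  have e: "(-1) powi i * (y * q powi (2 * s)) powi i * q powi (i * i - i)
     = (-1) powi s * y powi (- s) * q powi (s - s * s) * t (i + s)" for i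
  proof -
    have "(i + s) * (i + s) - (i + s) + (s - s * s) = 2 * s * i + (i * i - i)" by (simp add: algebra_simps)
    then have "q powi (s - s * s) * q powi ((i + s) * (i + s) - (i + s)) = (q powi (2 * s)) powi i * q powi (i * i - i)"
      using q by (metis power_int_add power_int_mult add.commute)
    moreover have "(-1 :: complex) powi s * (-1) powi (i + s) = (-1) powi i"
    proof -
      have "(-1 :: complex) powi s * (-1) powi s = 1"
        unfolding power_int_mult_distrib[symmetric] by simp
      then show ?thesis by (simp add: power_int_add mult_ac)
    qed
    moreover have "y powi (- s) * y powi (i + s) = y powi i"
      using y by (simp flip: power_int_add)
    moreover have "(-1) powi s * y powi (- s) * q powi (s - s * s) * t (i + s)
      = ((-1) powi s * (-1) powi (i + s)) * (y powi (- s) * y powi (i + s))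
        * (q powi (s - s * s) * q powi ((i + s) * (i + s) - (i + s)))"
      unfolding t_def by (simp only: mult_ac)
    ultimately show ?thesis by (simp add: power_int_mult_distrib mult_ac)
  qed
  have "infsum (\<lambda>i. t (i + s)) UNIV = infsum t UNIV"
    by (rule infsum_reindex_bij_witness[where i = "\<lambda>i. i - s" and j = "\<lambda>i. i + s"]) auto
  then show ?thesis
    unfolding jtheta_def e infsum_cmult_right' t_def by simp
qed

lemma infsum_int_shift: "infsum (\<lambda>i::int. f (i + k)) UNIV = infsum f UNIV"
  by (rule infsum_reindex_bij_witness[where i = "\<lambda>i. i - k" and j = "\<lambda>i. i + k"]) auto

lemma infsum_int_reflect: "infsum (\<lambda>i::int. f (k - i)) UNIV = infsum f UNIV"
  by (rule infsum_reindex_bij_witness[where i = "\<lambda>i. k - i" and j = "\<lambda>i. k - i"]) auto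

lemma has_sum_finite_sum:
  fixes f :: "'a \<Rightarrow> 'b \<Rightarrow> 'c::real_normed_vector"
  assumes "finite I" "\<And>i. i \<in> I \<Longrightarrow> (f i has_sum S i) A"
  shows "((\<lambda>x. \<Sum>i\<in>I. f i x) has_sum (\<Sum>i\<in>I. S i)) A"
  using assms by (induction I rule: finite_induct) (auto intro: has_sum_add)

section \<open>Exponentials and theta functions of level \<open>m\<close>\<close>

text \<open>
  Every factor that occurs below is of this form, with \<open>b\<close> recording roots of unity. Products then reduce to
  additions of the three exponents, and no branch of a fractional power has to be chosen.
\<close>

definition cexp :: "complex \<Rightarrow> complex \<Rightarrow> real \<Rightarrow> real \<Rightarrow> real \<Rightarrow> complex" where
  "cexp z \<tau> x a b = exp (2 * of_real pi * \<i> * (of_real x * z + of_real a * \<tau> + of_real b))"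

lemma cexp_mult: "cexp z \<tau> x a b * cexp z \<tau> x' a' b' = cexp z \<tau> (x + x') (a + a') (b + b')"
  by (simp add: cexp_def exp_add[symmetric] algebra_simps)

lemma cexp_nonzero [simp]: "cexp z \<tau> x a b \<noteq> 0"
  by (simp add: cexp_def)

lemma cexp_zero [simp]: "cexp z \<tau> 0 0 0 = 1"
  by (simp add: cexp_def)

lemma cexp_int: "cexp z \<tau> 0 0 (of_int n) = 1"
  unfolding cexp_def exp_eq_1 by (auto intro!: exI[of _ n])

lemma cexp_cong_int:
  assumes "x = x'" "a = a'" "b = b' + of_int n"
  shows "cexp z \<tau> x a b = cexp z \<tau> x' a' b'"
  using cexp_mult[of z \<tau> x' a' b' 0 0 "of_int n"] by (simp add: assms cexp_int)

lemma cexp_cong: "x = x' \<Longrightarrow> a = a' \<Longrightarrow> b = b' \<Longrightarrow> cexp z \<tau> x a b = cexp z \<tau> x' a' b'"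
  by simp

lemma cexp_power: "cexp z \<tau> x a b ^ n = cexp z \<tau> (real n * x) (real n * a) (real n * b)"
  by (simp add: cexp_def exp_of_nat_mult[symmetric] algebra_simps)

lemma cexp_powi: "cexp z \<tau> x a b powi n = cexp z \<tau> (of_int n * x) (of_int n * a) (of_int n * b)"
proof (cases n rule: int_cases2)
  case (nonneg k) then show ?thesis by (simp add: cexp_power)
next
  case (nonpos k)
  have "cexp z \<tau> (real k * x) (real k * a) (real k * b) * cexp z \<tau> (- real k * x) (- real k * a) (- real k * b) = 1"
    unfolding cexp_mult by simp
  then show ?thesis using nonpos
    by (simp add: power_int_minus cexp_power inverse_unique)
qed

lemma norm_cexp: "norm (cexp z \<tau> x a b) = exp (- 2 * pi * (x * Im z + a * Im \<tau>))"
  by (simp add: cexp_def)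

lemma cexp_reflect: "cexp (- z) \<tau> x a b = cexp z \<tau> (- x) a b"
  by (simp add: cexp_def)

lemma minus_one_powi_cexp: "(-1) powi n = cexp z \<tau> 0 0 (of_int n / 2)"
proof -
  have "cexp z \<tau> 0 0 (1/2) = -1"
    by (simp add: cexp_def mult.assoc exp_eq_polar[symmetric])
  then show ?thesis using cexp_powi[of z \<tau> 0 0 "1/2" n] by simp
qed

lemma cexp_gaussian_abs_summable:
  assumes "Im \<tau> > 0" "\<gamma> > 0"
    and "\<And>k. x k = \<alpha> * of_int k + \<beta>" "\<And>k. a k = \<gamma> * (of_int k)\<^sup>2 + \<delta> * of_int k + \<epsilon>"
  shows "(\<lambda>k::int. norm (cexp z \<tau> (x k) (a k) (b k))) summable_on UNIV"
proof -
  have "norm (cexp z \<tau> (x k) (a k) (b k)) = exp (- 2 * pi * (\<beta> * Im z + \<epsilon> * Im \<tau>))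
     * exp (- (2 * pi * \<gamma> * Im \<tau>) * (of_int k)\<^sup>2 + (- 2 * pi * (\<alpha> * Im z + \<delta> * Im \<tau>)) * of_int k)" for k
    unfolding norm_cexp assms(3,4) by (simp add: exp_add[symmetric] algebra_simps)
  then show ?thesis
    using gaussian_summable_int[of "2 * pi * \<gamma> * Im \<tau>" "- 2 * pi * (\<alpha> * Im z + \<delta> * Im \<tau>)"] assms(1,2)
    by (simp add: summable_on_cmult_right)
qed

text \<open>The power \<open>Y^e\<close> with real exponent of \<open>Y = w q^(2 j) exp (\<pi> \<i> (\<tau> + c))\<close>.\<close>

definition ypow :: "int \<Rightarrow> complex \<Rightarrow> complex \<Rightarrow> real \<Rightarrow> int \<Rightarrow> complex" where
  "ypow c \<tau> z e j = cexp z \<tau> e (e / 2 + 2 * of_int j * e) (of_int c * e / 2)"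

lemma ypow_add: "ypow c \<tau> z e j * ypow c \<tau> z e' j = ypow c \<tau> z (e + e') j"
  unfolding ypow_def cexp_mult by (rule cexp_cong) (simp_all add: algebra_simps add_divide_distrib)

lemma ypow_power: "ypow c \<tau> z e j ^ n = ypow c \<tau> z (real n * e) j"
  unfolding ypow_def cexp_power by (rule cexp_cong) (simp_all add: algebra_simps)

definition nome :: "complex \<Rightarrow> complex" where "nome \<tau> = cexp 0 \<tau> 0 1 0"

lemma cexp_z_irrelevant: "cexp z \<tau> 0 a b = cexp z' \<tau> 0 a b"
  by (simp add: cexp_def)

lemma nome_powi: "nome \<tau> powi n = cexp z \<tau> 0 (of_int n) 0"
  unfolding nome_def cexp_powi by (simp add: cexp_def)

lemma nome_nonzero [simp]: "nome \<tau> \<noteq> 0" by (simp add: nome_def)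

lemma norm_nome: "Im \<tau> > 0 \<Longrightarrow> norm (nome \<tau>) < 1"
  by (simp add: nome_def norm_cexp)

lemma ypow_shift: "ypow c \<tau> z 1 (j + k) = ypow c \<tau> z 1 j * nome \<tau> powi (2 * k)"
  unfolding nome_powi[of _ _ z] ypow_def cexp_mult by (simp add: algebra_simps)

lemma ypow_nonzero [simp]: "ypow c \<tau> z e j \<noteq> 0" by (simp add: ypow_def)

text \<open>The theta function \<open>T n\<close>: the sum of \<open>w^k q^(k^2 / m)\<close> over the class of \<open>n\<close> modulo \<open>m\<close>.\<close>

definition level_theta :: "nat \<Rightarrow> complex \<Rightarrow> complex \<Rightarrow> real \<Rightarrow> complex" where
  "level_theta m \<tau> z n = (\<Sum>\<^sub>\<infinity>k\<in>(UNIV::int set). cexp z \<tau> (real m * real_of_int k + n) ((real m * real_of_int k + n)\<^sup>2 / real m) 0)"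

lemma level_theta_abs_summable:
  assumes "Im \<tau> > 0" "m > 0"
  shows "(\<lambda>k::int. norm (cexp z \<tau> (real m * real_of_int k + n) ((real m * real_of_int k + n)\<^sup>2 / m) b)) summable_on UNIV"
  by (rule cexp_gaussian_abs_summable[OF assms(1), of "real m" _ "real m" n _ "2 * n" "n\<^sup>2 / m"])
     (use assms in \<open>auto simp: power2_eq_square field_simps\<close>)

lemma level_theta_has_sum:
  assumes "Im \<tau> > 0" "m > 0"
  shows "((\<lambda>k::int. cexp z \<tau> (real m * real_of_int k + n) ((real m * real_of_int k + n)\<^sup>2 / m) 0) has_sum level_theta m \<tau> z n) UNIV"
  unfolding level_theta_def by (rule has_sum_infsum, rule abs_summable_summable[OF level_theta_abs_summable[OF assms]])

lemma level_theta_periodic: "level_theta m \<tau> z (n + real m * real_of_int r) = level_theta m \<tau> z n"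
proof -
  have "level_theta m \<tau> z (n + real m * real_of_int r)
      = infsum (\<lambda>k::int. cexp z \<tau> (real m * real_of_int (k + r) + n) ((real m * real_of_int (k + r) + n)\<^sup>2 / m) 0) UNIV"
    unfolding level_theta_def by (simp add: algebra_simps)
  also have "\<dots> = level_theta m \<tau> z n"
    unfolding level_theta_def
    by (rule infsum_int_shift[of "\<lambda>k. cexp z \<tau> (real m * real_of_int k + n) ((real m * real_of_int k + n)\<^sup>2 / m) 0"])
  finally show ?thesis .
qed

lemma level_theta_reflect: "level_theta m \<tau> (- z) n = level_theta m \<tau> z (- n)"
proof -
  have "level_theta m \<tau> (- z) n
      = infsum (\<lambda>k::int. cexp z \<tau> (real m * real_of_int (0 - k) + - n) ((real m * real_of_int (0 - k) + - n)\<^sup>2 / m) 0) UNIV"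
    unfolding level_theta_def cexp_reflect by (rule infsum_cong) (simp add: algebra_simps power2_eq_square)
  also have "\<dots> = level_theta m \<tau> z (- n)"
    unfolding level_theta_def
    by (rule infsum_int_reflect[of "\<lambda>k. cexp z \<tau> (real m * real_of_int k + - n) ((real m * real_of_int k + - n)\<^sup>2 / m) 0"])
  finally show ?thesis .
qed

lemma bounded_inverse_one_minus_ypow:
  assumes \<tau>: "Im \<tau> > 0" and nz: "\<And>j. ypow c \<tau> z 1 j \<noteq> 1"
  obtains C where "C > 0" "\<And>j. norm (1 / (1 - ypow c \<tau> z 1 j)) \<le> C"
proof -
  have e: "ypow c \<tau> z 1 0 * nome \<tau> powi (2 * i) = ypow c \<tau> z 1 i" for i
    using ypow_shift[of c \<tau> z 0 i] by simp
  have "\<exists>C>0. \<forall>i. norm (1 / (1 - ypow c \<tau> z 1 0 * nome \<tau> powi (2 * i))) \<le> C"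
    using bounded_inverse_one_minus[OF nome_nonzero norm_nome[OF \<tau>] ypow_nonzero[of c \<tau> z 1 0]] nz e by metis
  then show ?thesis using that unfolding e by blast
qed

section \<open>The Appell sum times a theta null value\<close>

definition appell :: "nat \<Rightarrow> int \<Rightarrow> complex \<Rightarrow> complex \<Rightarrow> nat \<Rightarrow> complex" where
  "appell m c \<tau> z g = (\<Sum>\<^sub>\<infinity>j\<in>(UNIV::int set).
     cexp z \<tau> (real m * real_of_int j) (m * (real_of_int j)\<^sup>2) 0 * ypow c \<tau> z (real g) j / (1 - ypow c \<tau> z 1 j))"

lemma appell_abs_summable:
  assumes \<tau>: "Im \<tau> > 0" and m: "m > 0" and nz: "\<And>j. ypow c \<tau> z 1 j \<noteq> 1"
  shows "(\<lambda>j::int. norm (cexp z \<tau> (real m * real_of_int j) (m * (real_of_int j)\<^sup>2) 0 * ypow c \<tau> z e j / (1 - ypow c \<tau> z 1 j)))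
     summable_on UNIV"
proof -
  obtain C where C: "C > 0" "\<And>j. norm (1 / (1 - ypow c \<tau> z 1 j)) \<le> C"
    using bounded_inverse_one_minus_ypow[OF \<tau> nz] by metis
  have "(\<lambda>j::int. norm (cexp z \<tau> (real m * real_of_int j + e) (m * (real_of_int j)\<^sup>2 + (e / 2 + 2 * of_int j * e)) (of_int c * e / 2)))
     summable_on UNIV"
    by (rule cexp_gaussian_abs_summable[OF \<tau>, of "real m" _ "real m" e _ "2 * e" "e / 2"]) (use m in auto)
  then have s: "(\<lambda>j::int. norm (cexp z \<tau> (real m * real_of_int j + e) (m * (real_of_int j)\<^sup>2 + (e / 2 + 2 * of_int j * e)) (of_int c * e / 2)) * C)
     summable_on UNIV" by (rule summable_on_cmult_left)
  show ?thesis
  proof (rule summable_on_comparison_test[OF s])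
    fix j :: int
    show "norm (cexp z \<tau> (real m * real_of_int j) (m * (real_of_int j)\<^sup>2) 0 * ypow c \<tau> z e j / (1 - ypow c \<tau> z 1 j))
      \<le> norm (cexp z \<tau> (real m * real_of_int j + e) (m * (real_of_int j)\<^sup>2 + (e / 2 + 2 * of_int j * e)) (of_int c * e / 2)) * C"
      using mult_left_mono[OF C(2)[of j], of "norm (cexp z \<tau> (real m * real_of_int j + e) (m * (real_of_int j)\<^sup>2 + (e / 2 + 2 * of_int j * e)) (of_int c * e / 2))"]
      unfolding ypow_def cexp_mult by (simp add: norm_divide)
  qed auto
qed

text \<open>
  Expand \<open>Y / (1 - Y)\<close> up to the power \<open>Y^(g + 1)\<close>. The power \<open>Y^k\<close> turns \<open>w^(m j) q^(m j^2)\<close> into a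
  constant times the summand of \<open>T k\<close>.
\<close>

lemma appell_shift:
  assumes \<tau>: "Im \<tau> > 0" and m: "m > 0" and nz: "\<And>j. ypow c \<tau> z 1 j \<noteq> 1"
  shows "appell m c \<tau> z 1 = appell m c \<tau> z (Suc g)
     + (\<Sum>k=1..g. cexp z \<tau> 0 (k / 2 - (real k)\<^sup>2 / m) (real_of_int c * real k / 2) * level_theta m \<tau> z k)"
proof -
  define t where "t k j = cexp z \<tau> (real m * of_int j) (m * (real_of_int j)\<^sup>2) 0 * ypow c \<tau> z (real k) j" for k :: nat and j :: int
  have a: "((\<lambda>j. t k j / (1 - ypow c \<tau> z 1 j)) has_sum appell m c \<tau> z k) UNIV" for k
    unfolding appell_def t_def
    by (rule has_sum_infsum, rule abs_summable_summable[OF appell_abs_summable[OF \<tau> m nz]])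
  have b: "(t k has_sum (cexp z \<tau> 0 (k / 2 - (real k)\<^sup>2 / m) (real_of_int c * real k / 2) * level_theta m \<tau> z k)) UNIV" for k
  proof -
    have e: "t k = (\<lambda>j. cexp z \<tau> 0 (k / 2 - (real k)\<^sup>2 / m) (real_of_int c * real k / 2)
        * cexp z \<tau> (real m * real_of_int j + real k) ((real m * real_of_int j + real k)\<^sup>2 / m) 0)"
      unfolding t_def ypow_def cexp_mult
      by (rule ext, rule cexp_cong) (use m in \<open>auto simp: field_simps power2_eq_square\<close>)
    show ?thesis unfolding e by (rule has_sum_cmult_right[OF level_theta_has_sum[OF \<tau> m]])
  qed
  have c: "t 1 j / (1 - ypow c \<tau> z 1 j) = t (Suc g) j / (1 - ypow c \<tau> z 1 j) + (\<Sum>k=1..g. t k j)" for j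
  proof (induction g)
    case (Suc g)
    have "t (Suc (Suc g)) j = t (Suc g) j * ypow c \<tau> z 1 j"
      unfolding t_def mult.assoc ypow_add by (simp add: add.commute)
    then have "t (Suc g) j / (1 - ypow c \<tau> z 1 j) = t (Suc (Suc g)) j / (1 - ypow c \<tau> z 1 j) + t (Suc g) j"
      using nz[of j] by (simp add: field_simps)
    then show ?case using Suc by simp
  qed simp
  have "((\<lambda>j. t 1 j / (1 - ypow c \<tau> z 1 j)) has_sum (appell m c \<tau> z (Suc g)
     + (\<Sum>k=1..g. cexp z \<tau> 0 (k / 2 - (real k)\<^sup>2 / m) (real_of_int c * real k / 2) * level_theta m \<tau> z k))) UNIV"
    unfolding c by (intro has_sum_add a has_sum_finite_sum b) simp
  then show ?thesis by (rule has_sum_unique[OF a[of 1]])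
qed

lemma abs_summable_pairI:
  fixes f :: "'a \<Rightarrow> 'b \<Rightarrow> 'c::banach"
  assumes "\<And>i. (\<lambda>s. norm (f i s)) summable_on UNIV"
    and "\<And>i. infsum (\<lambda>s. norm (f i s)) UNIV \<le> g i" and "g summable_on UNIV"
  shows "(\<lambda>p. norm (case_prod f p)) summable_on UNIV \<times> UNIV"
proof (subst Infinite_Sum.abs_summable_on_Sigma_iff, intro conjI ballI)
  fix i show "(\<lambda>y. norm (case (i, y) of (x, xa) \<Rightarrow> f x xa)) summable_on UNIV" using assms(1) by simp
next
  show "(\<lambda>x. norm (infsum (\<lambda>y. norm (case (x, y) of (x, xa) \<Rightarrow> f x xa)) UNIV)) summable_on UNIV"
    by (rule summable_on_comparison_test[OF assms(3)]) (use assms(2) in \<open>auto simp: infsum_nonneg\<close>)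
qed

lemma infsum_int_split:
  fixes f :: "int \<Rightarrow> 'a::banach"
  assumes "f summable_on UNIV"
  shows "infsum f UNIV = f 0 + (\<Sum>\<^sub>\<infinity>j\<in>{1::nat..}. f (int j) + f (- int j))"
    and "(\<lambda>j. f (int j) + f (- int j)) summable_on {1::nat..}"
proof -
  have s: "f summable_on A" for A using summable_on_subset_banach[OF assms] by blast
  have p: "((\<lambda>j::nat. f (int j)) has_sum infsum f {1..}) {1..}"
    by (rule has_sum_reindex_bij_witness[where i = nat and j = int and S = "{1::nat..}" and T = "{1::int..}" and h = f, THEN iffD2])
       (use s[of "{1..}"] in auto)
  have n: "((\<lambda>j::nat. f (- int j)) has_sum infsum f {..-1}) {1..}"
    by (rule has_sum_reindex_bij_witness[where i = "\<lambda>j. nat (- j)" and j = "\<lambda>j. - int j" and S = "{1::nat..}" and T = "{..-1::int}" and h = f, THEN iffD2])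
       (use s[of "{..-1}"] in auto)
  note pn = has_sum_add[OF p n]
  then show "(\<lambda>j. f (int j) + f (- int j)) summable_on {1::nat..}" by (rule has_sum_imp_summable)
  have "(UNIV::int set) = {0} \<union> ({1..} \<union> {..-1})" by auto
  then have "infsum f UNIV = infsum f {0} + infsum f ({1..} \<union> {..-1})"
    using infsum_Un_disjoint[OF s[of "{0}"] s[of "{1..} \<union> {..-1}"]] by auto
  also have "infsum f ({1..} \<union> {..-1}) = infsum f {1..} + infsum f {..-1}"
    by (rule infsum_Un_disjoint[OF s s]) auto
  finally show "infsum f UNIV = f 0 + (\<Sum>\<^sub>\<infinity>j\<in>{1::nat..}. f (int j) + f (- int j))"
    using infsumI[OF pn] by simp
qed

text \<open>
  Up to a power of \<open>q\<close> this is the value at \<open>0\<close> of the theta function of level \<open>m + 1\<close> in the statement (see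
  \<open>theta_null_eq_twisted_theta\<close>).
\<close>

definition theta_null :: "nat \<Rightarrow> int \<Rightarrow> complex \<Rightarrow> complex" where
  "theta_null m c \<tau> = (\<Sum>\<^sub>\<infinity>i\<in>(UNIV::int set). (-1) powi i *
     cexp 0 \<tau> 0 ((real m + 1) * (real_of_int i)\<^sup>2 - real m * real_of_int i / 2) (- (real_of_int c * real m * real_of_int i / 2)))"

definition appell2_term :: "nat \<Rightarrow> int \<Rightarrow> complex \<Rightarrow> complex \<Rightarrow> real \<Rightarrow> int \<Rightarrow> int \<Rightarrow> complex" where
  "appell2_term m c \<tau> z e i s = (-1) powi i *
     cexp z \<tau> (real m * (real_of_int s + 1 / 2)) (real m * (real_of_int s + 1 / 2)\<^sup>2 + (real_of_int i)\<^sup>2) 0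
     * ypow c \<tau> z e (s + i) / (1 - ypow c \<tau> z 1 (s + i))"

text \<open>
  Multiplying \<open>q^(m i^2)\<close> into \<open>w^(m j) q^(m j^2)\<close> completes the square up to a power of \<open>Y j\<close>:
  \<open>w^(m j) q^(m j^2 + m i^2) = w^(m (j - i)) q^(m (j - i)^2) (w q^(2 j))^(m i)\<close>. The linear term of the theta null value is
  absorbed by moving from \<open>j - i\<close> to \<open>j - i + 1/2\<close>; this works because \<open>exp (\<pi> \<i> (\<tau> + c))\<close> squares to \<open>q\<close>, as
  \<open>c\<close> is an integer. The exponent of \<open>Y\<close> in the result is \<open>m i + 1/2\<close>, since the exponent \<open>(m + 1) / 2\<close> loses \<open>m / 2\<close>.
\<close>

lemma theta_null_times_appell:
  assumes \<tau>: "Im \<tau> > 0" and m: "m = 2 * l + 1" and nz: "\<And>j. ypow c \<tau> z 1 j \<noteq> 1"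
  shows "theta_null m c \<tau> * appell m c \<tau> z (Suc l) = cexp 0 \<tau> 0 0 (real_of_int c * real m / 4) *
      (\<Sum>\<^sub>\<infinity>i. \<Sum>\<^sub>\<infinity>s. appell2_term m c \<tau> z (real m * real_of_int i + 1 / 2) i s)" (is ?thesis1)
    and "(\<lambda>p. norm (case_prod (\<lambda>i s. appell2_term m c \<tau> z (real m * real_of_int i + 1 / 2) i s) p))
      summable_on UNIV \<times> UNIV" (is ?thesis2)
proof -
  define t where "t i = (-1) powi i *
     cexp 0 \<tau> 0 ((real m + 1) * (real_of_int i)\<^sup>2 - real m * real_of_int i / 2) (- (real_of_int c * real m * real_of_int i / 2))" for i :: int
  define f where "f j = cexp z \<tau> (real m * real_of_int j) (real m * (real_of_int j)\<^sup>2) 0 * ypow c \<tau> z (real (Suc l)) j / (1 - ypow c \<tau> z 1 j)" for j :: int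
  define K where "K = cexp z \<tau> 0 0 (real_of_int c * real m / 4)"
  have m0: "m > 0" using m by simp
  have rl: "real (Suc l) = (real m + 1) / 2" using m by simp
  have key: "t i * f (s + i) = K * appell2_term m c \<tau> z (real m * real_of_int i + 1 / 2) i s" for i s
  proof -
    have "cexp z \<tau> 0 ((real m + 1) * (real_of_int i)\<^sup>2 - real m * real_of_int i / 2) (- (real_of_int c * real m * real_of_int i / 2))
       * cexp z \<tau> (real m * real_of_int (s + i)) (real m * (real_of_int (s + i))\<^sup>2) 0 * ypow c \<tau> z (real (Suc l)) (s + i)
      = K * cexp z \<tau> (real m * (real_of_int s + 1 / 2)) (real m * (real_of_int s + 1 / 2)\<^sup>2 + (real_of_int i)\<^sup>2) 0
       * ypow c \<tau> z (real m * real_of_int i + 1 / 2) (s + i)"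
      unfolding K_def ypow_def cexp_mult rl
      by (rule cexp_cong_int[where n = "- c * int m * i"]) (simp_all add: field_simps power2_eq_square)
    then show ?thesis
      unfolding t_def f_def appell2_term_def cexp_z_irrelevant[of 0 \<tau> _ _ z] by (simp add: mult_ac)
  qed
  have Knz: "K \<noteq> 0" by (simp add: K_def)
  have f: "(\<lambda>j. norm (f j)) summable_on UNIV"
    unfolding f_def by (rule appell_abs_summable[OF \<tau> m0 nz])
  have t: "(\<lambda>i. norm (t i)) summable_on UNIV"
    unfolding t_def norm_mult norm_minus_one_powi mult_1_left
    by (rule cexp_gaussian_abs_summable[OF \<tau>, of "real m + 1" _ 0 0 _ "- real m / 2" 0]) auto
  have fs: "(\<lambda>s. norm (f (s + i))) summable_on UNIV" "infsum (\<lambda>s. norm (f (s + i))) UNIV = infsum (\<lambda>j. norm (f j)) UNIV" for i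
    using f has_sum_int_shift[of "\<lambda>j. norm (f j)" i] infsum_int_shift[of "\<lambda>j. norm (f j)" i]
    by (auto simp: summable_iff_has_sum_infsum)
  have A: "appell2_term m c \<tau> z (real m * real_of_int i + 1 / 2) i s = t i * f (s + i) / K" for i s
    using key[of i s] Knz by (simp add: field_simps)
  have A': "norm (appell2_term m c \<tau> z (real m * real_of_int i + 1 / 2) i s) = norm (t i) / norm K * norm (f (s + i))" for i s
    unfolding A by (simp add: norm_mult norm_divide)
  show ?thesis2
  proof (rule abs_summable_pairI)
    show "(\<lambda>s. norm (appell2_term m c \<tau> z (real m * real_of_int i + 1 / 2) i s)) summable_on UNIV" for i
      unfolding A' by (intro summable_on_cmult_right fs)
    show "infsum (\<lambda>s. norm (appell2_term m c \<tau> z (real m * real_of_int i + 1 / 2) i s)) UNIV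
       \<le> norm (t i) * (infsum (\<lambda>j. norm (f j)) UNIV / norm K)" for i
      unfolding A' infsum_cmult_right' fs by simp
    show "(\<lambda>i. norm (t i) * (infsum (\<lambda>j. norm (f j)) UNIV / norm K)) summable_on UNIV"
      by (intro summable_on_cmult_left t)
  qed
  have "theta_null m c \<tau> * appell m c \<tau> z (Suc l) = infsum t UNIV * infsum f UNIV"
    unfolding theta_null_def appell_def t_def f_def ..
  also have "\<dots> = (\<Sum>\<^sub>\<infinity>i. t i * infsum (\<lambda>s. f (s + i)) UNIV)"
    unfolding infsum_int_shift by (rule infsum_cmult_left'[symmetric])
  also have "\<dots> = (\<Sum>\<^sub>\<infinity>i. \<Sum>\<^sub>\<infinity>s. K * appell2_term m c \<tau> z (real m * real_of_int i + 1 / 2) i s)"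
    unfolding infsum_cmult_right'[symmetric] key ..
  also have "\<dots> = K * (\<Sum>\<^sub>\<infinity>i. \<Sum>\<^sub>\<infinity>s. appell2_term m c \<tau> z (real m * real_of_int i + 1 / 2) i s)"
    unfolding infsum_cmult_right' ..
  finally show ?thesis1 unfolding K_def cexp_z_irrelevant[of 0 \<tau> _ _ z] .
qed

definition pole_numerator :: "nat \<Rightarrow> int \<Rightarrow> complex \<Rightarrow> complex \<Rightarrow> complex" where
  "pole_numerator m c \<tau> z = (\<Sum>\<^sub>\<infinity>s\<in>(UNIV::int set). (-1) powi s *
     cexp z \<tau> ((real m + 1) * (real_of_int s + 1 / 2)) ((real m + 1) * (real_of_int s + 1 / 2)\<^sup>2 - real_of_int s / 2)
       (real_of_int c * (real_of_int s + 1 / 2) / 2))"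

text \<open>
  For fixed \<open>s\<close> the factor \<open>q^(i^2) Y^(1/2)\<close> is a constant times \<open>q^(i^2 + i)\<close>, so the inner sum is the partial
  fraction expansion of a reciprocal theta function at \<open>Y s\<close>. Its quasi-periodicity reduces all \<open>s\<close> to
  \<open>s = 0\<close>, and the factors it produces make the outer sum a theta series of level \<open>m + 1\<close>.
\<close>

lemma appell2_pole_part:
  assumes \<tau>: "Im \<tau> > 0" and nz: "\<And>j. ypow c \<tau> z 1 j \<noteq> 1"
  shows "(\<Sum>\<^sub>\<infinity>s. \<Sum>\<^sub>\<infinity>i. appell2_term m c \<tau> z (1 / 2) i s)
    = qprod ((nome \<tau>)\<^sup>2) (nome \<tau>) ^ 3 / jtheta (ypow c \<tau> z 1 0) (nome \<tau>) * pole_numerator m c \<tau> z"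
proof -
  define q where "q = nome \<tau>"
  define y where "y = ypow c \<tau> z 1 0"
  have q: "q \<noteq> 0" "norm q < 1" and y: "y \<noteq> 0" using \<tau> by (auto simp: q_def y_def norm_nome)
  have ys: "ypow c \<tau> z 1 (s + i) = (y * q powi (2 * s)) * q powi (2 * i)" for s i
    unfolding y_def q_def ypow_shift[of c \<tau> z s i] using ypow_shift[of c \<tau> z 0 s] by simp
  have inner: "(\<Sum>\<^sub>\<infinity>i. appell2_term m c \<tau> z (1 / 2) i s) = qprod (q\<^sup>2) q ^ 3 / jtheta y q * ((-1) powi s *
     cexp z \<tau> ((real m + 1) * (real_of_int s + 1 / 2)) ((real m + 1) * (real_of_int s + 1 / 2)\<^sup>2 - real_of_int s / 2)
       (real_of_int c * (real_of_int s + 1 / 2) / 2))" for s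
  proof -
    define k where "k = cexp z \<tau> (real m * (real_of_int s + 1 / 2) + 1 / 2)
        (real m * (real_of_int s + 1 / 2)\<^sup>2 + 1 / 4 + real_of_int s) (real_of_int c / 4)"
    have "appell2_term m c \<tau> z (1 / 2) i s
      = k * ((-1) powi i * q powi (i * i + i) / (1 - (y * q powi (2 * s)) * q powi (2 * i)))" for i
    proof -
      have "cexp z \<tau> (real m * (real_of_int s + 1 / 2)) (real m * (real_of_int s + 1 / 2)\<^sup>2 + (real_of_int i)\<^sup>2) 0
         * ypow c \<tau> z (1 / 2) (s + i) = k * q powi (i * i + i)"
        unfolding k_def q_def nome_powi[of _ _ z] ypow_def cexp_mult
        by (rule cexp_cong) (simp_all add: field_simps power2_eq_square)
      then show ?thesis unfolding appell2_term_def ys[of s i] by (simp add: mult_ac)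
    qed
    then have "(\<Sum>\<^sub>\<infinity>i. appell2_term m c \<tau> z (1 / 2) i s)
      = k * (\<Sum>\<^sub>\<infinity>i::int. (-1) powi i * q powi (i * i + i) / (1 - (y * q powi (2 * s)) * q powi (2 * i)))"
      by (simp only: infsum_cmult_right')
    also have "(\<Sum>\<^sub>\<infinity>i::int. (-1) powi i * q powi (i * i + i) / (1 - (y * q powi (2 * s)) * q powi (2 * i)))
      = qprod (q\<^sup>2) q ^ 3 / jtheta (y * q powi (2 * s)) q"
      by (rule reciprocal_theta_partial_fractions[OF q]) (use y q nz ys in \<open>auto simp flip: ys\<close>)
    also have "jtheta (y * q powi (2 * s)) q = (-1) powi s * y powi (- s) * q powi (s - s * s) * jtheta y q"
      by (rule jtheta_quasiperiodic[OF q(1) y])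
    also have "k * (qprod (q\<^sup>2) q ^ 3 / ((-1) powi s * y powi (- s) * q powi (s - s * s) * jtheta y q))
      = qprod (q\<^sup>2) q ^ 3 / jtheta y q * ((-1) powi s * (k * y powi s * q powi (s * s - s)))"
    proof -
      have "q powi (s * s - s) = inverse (q powi (s - s * s))"
        unfolding power_int_minus[symmetric] by (rule arg_cong[where f = "power_int q"]) simp
      moreover have "y powi s = inverse (y powi (- s))" by (simp add: power_int_minus)
      moreover have "(-1 :: complex) powi s = inverse ((-1) powi s)"
        unfolding power_int_inverse[symmetric] by simp
      ultimately show ?thesis by (simp add: divide_inverse mult_ac)
    qed
    also have "k * y powi s * q powi (s * s - s) =
      cexp z \<tau> ((real m + 1) * (real_of_int s + 1 / 2)) ((real m + 1) * (real_of_int s + 1 / 2)\<^sup>2 - real_of_int s / 2)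
       (real_of_int c * (real_of_int s + 1 / 2) / 2)"
      unfolding k_def y_def q_def nome_powi[of _ _ z] ypow_def cexp_powi cexp_mult
      by (rule cexp_cong) (simp_all add: field_simps power2_eq_square)
    finally show ?thesis .
  qed
  show ?thesis unfolding inner pole_numerator_def q_def[symmetric] y_def[symmetric] by (rule infsum_cmult_right')
qed


text \<open>
  The coefficient of \<open>T (m/2 + \<sigma> (h + 1/2))\<close> that comes from \<open>i = \<sigma> j\<close>, where \<open>\<sigma>\<close> is \<open>1\<close> or \<open>-1\<close>.
\<close>

definition geom_coeff :: "nat \<Rightarrow> int \<Rightarrow> complex \<Rightarrow> real \<Rightarrow> nat \<Rightarrow> nat \<Rightarrow> complex" where
  "geom_coeff m c \<tau> \<sigma> j h = cexp 0 \<tau> 0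
     ((real m + 1) * (real j)\<^sup>2 - (real h + 1 / 2 - real m * real j)\<^sup>2 / real m - \<sigma> * (real h + 1 / 2) / 2)
     (\<sigma> * real_of_int c * (real h + 1 / 2) / 2)"

text \<open>
  Since \<open>e = h + 1/2\<close> lies between \<open>0\<close> and \<open>m j\<close>, the negative term is at most \<open>m j^2\<close> in size; one copy of \<open>j^2\<close>
  survives and secures convergence.
\<close>

lemma norm_geom_coeff_le:
  assumes \<tau>: "Im \<tau> > 0" and m: "m > 0" and \<sigma>: "\<bar>\<sigma>\<bar> = 1" and h: "h < m * j"
  shows "norm (geom_coeff m c \<tau> \<sigma> j h) \<le> exp (- 2 * pi * Im \<tau> * ((real j)\<^sup>2 - real m * real j))"
proof -
  define e where "e = real h + 1 / 2"
  have "real h + 1 \<le> real m * real j" using h by (metis Suc_eq_plus1 Suc_leI of_nat_Suc of_nat_le_iff of_nat_mult add.commute)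
  then have e: "0 \<le> e" "e \<le> real m * real j" unfolding e_def by auto
  have "(e - real m * real j)\<^sup>2 \<le> (real m * real j)\<^sup>2"
    unfolding abs_le_square_iff[symmetric] using e by auto
  then have "(e - real m * real j)\<^sup>2 / real m \<le> (real m * real j)\<^sup>2 / real m"
    using m by (simp add: divide_right_mono)
  also have "\<dots> = real m * (real j)\<^sup>2" using m by (simp add: power2_eq_square)
  finally have 1: "(e - real m * real j)\<^sup>2 / real m \<le> real m * (real j)\<^sup>2" .
  have "\<sigma> = 1 \<or> \<sigma> = -1" using \<sigma> by auto
  then have 2: "\<sigma> * e / 2 \<le> real m * real j" using e by auto
  have "(real j)\<^sup>2 - real m * real j \<le> (real m + 1) * (real j)\<^sup>2 - (e - real m * real j)\<^sup>2 / real m - \<sigma> * e / 2"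
    using 1 2 by (simp add: algebra_simps)
  then have "2 * pi * Im \<tau> * ((real j)\<^sup>2 - real m * real j)
     \<le> 2 * pi * Im \<tau> * ((real m + 1) * (real j)\<^sup>2 - (e - real m * real j)\<^sup>2 / real m - \<sigma> * e / 2)"
    using \<tau> by (intro mult_left_mono) auto
  then show ?thesis unfolding geom_coeff_def norm_cexp e_def[symmetric] by (simp add: mult_ac)
qed

lemma gaussian_weight_summable:
  assumes "\<alpha> > 0"
  shows "(\<lambda>i::int. real m * real_of_int \<bar>i\<bar> * exp (- \<alpha> * ((real_of_int i)\<^sup>2 - real m * real_of_int \<bar>i\<bar>))) summable_on UNIV"
proof (rule summable_on_comparison_test)
  define b where "b = real m + \<alpha> * real m"
  show "(\<lambda>i::int. exp (- \<alpha> * (real_of_int i)\<^sup>2 + b * real_of_int i) + exp (- \<alpha> * (real_of_int i)\<^sup>2 + - b * real_of_int i)) summable_on UNIV"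
    by (intro summable_on_add gaussian_summable_int assms)
  fix i :: int
  have "real m * real_of_int \<bar>i\<bar> \<le> exp (real m * real_of_int \<bar>i\<bar>)"
    using exp_ge_add_one_self[of "real m * real_of_int \<bar>i\<bar>"] by linarith
  then have "real m * real_of_int \<bar>i\<bar> * exp (- \<alpha> * ((real_of_int i)\<^sup>2 - real m * real_of_int \<bar>i\<bar>))
     \<le> exp (real m * real_of_int \<bar>i\<bar>) * exp (- \<alpha> * ((real_of_int i)\<^sup>2 - real m * real_of_int \<bar>i\<bar>))"
    by (intro mult_right_mono) auto
  also have "\<dots> = exp (- \<alpha> * (real_of_int i)\<^sup>2 + b * real_of_int \<bar>i\<bar>)"
    by (simp add: exp_add[symmetric] b_def algebra_simps)
  also have "\<dots> \<le> exp (- \<alpha> * (real_of_int i)\<^sup>2 + b * real_of_int i) + exp (- \<alpha> * (real_of_int i)\<^sup>2 + - b * real_of_int i)"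
    by (cases "i \<ge> 0") (auto intro: add_increasing add_increasing2)
  finally show "real m * real_of_int \<bar>i\<bar> * exp (- \<alpha> * ((real_of_int i)\<^sup>2 - real m * real_of_int \<bar>i\<bar>))
     \<le> exp (- \<alpha> * (real_of_int i)\<^sup>2 + b * real_of_int i) + exp (- \<alpha> * (real_of_int i)\<^sup>2 + - b * real_of_int i)" .
qed auto

definition level_theta_term :: "nat \<Rightarrow> complex \<Rightarrow> complex \<Rightarrow> real \<Rightarrow> int \<Rightarrow> complex" where
  "level_theta_term m \<tau> z n s = cexp z \<tau> (real m * real_of_int s + n) ((real m * real_of_int s + n)\<^sup>2 / real m) 0"

text \<open>
  The term \<open>i = 0\<close> falls under the second branch, where the sum is empty.
\<close>

definition geom_term :: "nat \<Rightarrow> int \<Rightarrow> complex \<Rightarrow> complex \<Rightarrow> int \<Rightarrow> int \<Rightarrow> complex" where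
  "geom_term m c \<tau> z i s =
     (if i > 0 then - ((-1) ^ nat i * (\<Sum>h<m * nat i. geom_coeff m c \<tau> 1 (nat i) h * level_theta_term m \<tau> z (real m / 2 + (real h + 1 / 2)) s))
      else (-1) ^ nat (- i) * (\<Sum>h<m * nat (- i). geom_coeff m c \<tau> (-1) (nat (- i)) h * level_theta_term m \<tau> z (real m / 2 - (real h + 1 / 2)) s))"

lemma geometric_quotient: "(y::complex) \<noteq> 1 \<Longrightarrow> (y ^ n - 1) / (1 - y) = - (\<Sum>h<n. y ^ h)"
proof -
  assume "y \<noteq> 1"
  moreover have "y ^ n - 1 = - ((1 - y) * (\<Sum>h<n. y ^ h))"
    unfolding one_diff_power_eq[symmetric] by simp
  ultimately show ?thesis by simp
qed

text \<open>
  The numerators differ by \<open>Y^(m i + 1/2) - Y^(1/2)\<close>, which is divisible by \<open>1 - Y\<close>. The quotient is minus the sum of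
  \<open>Y^e\<close> over the half-integers \<open>e\<close> in \<open>[1/2, m i - 1/2]\<close> for positive \<open>i\<close>, and plus the sum over
  \<open>[m i + 1/2, -1/2]\<close> for negative \<open>i\<close>.
\<close>

lemma appell2_geometric_difference:
  assumes m: "m > 0" and nz: "\<And>j. ypow c \<tau> z 1 j \<noteq> 1"
  shows "appell2_term m c \<tau> z (real m * real_of_int i + 1 / 2) i s
    = appell2_term m c \<tau> z (1 / 2) i s + geom_term m c \<tau> z i s"
proof -
  define Y where "Y = ypow c \<tau> z 1 (s + i)"
  have Y: "Y \<noteq> 1" using nz unfolding Y_def by auto
  define k where "k = cexp z \<tau> (real m * (real_of_int s + 1 / 2)) (real m * (real_of_int s + 1 / 2)\<^sup>2 + (real_of_int i)\<^sup>2) 0"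
  have Yh: "ypow c \<tau> z e (s + i) * Y ^ n = ypow c \<tau> z (e + real n) (s + i)" for e n
    unfolding Y_def ypow_power ypow_add by simp
  have diff: "appell2_term m c \<tau> z (real m * real_of_int i + 1 / 2) i s - appell2_term m c \<tau> z (1 / 2) i s
     = (-1) powi i * k * ((ypow c \<tau> z (real m * real_of_int i + 1 / 2) (s + i) - ypow c \<tau> z (1 / 2) (s + i)) / (1 - Y))"
    unfolding appell2_term_def k_def Y_def by (simp add: algebra_simps diff_divide_distrib)
  show ?thesis
  proof (cases "i > 0")
    case True
    define j where "j = nat i"
    have j: "i = int j" using True by (simp add: j_def)
    have p: "ypow c \<tau> z (real m * real_of_int i + 1 / 2) (s + i) = ypow c \<tau> z (1 / 2) (s + i) * Y ^ (m * j)"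
    proof -
      have "real m * real_of_int i + 1 / 2 = 1 / 2 + real (m * j)" by (simp add: j)
      then show ?thesis by (simp only: Yh)
    qed
    have "(ypow c \<tau> z (real m * real_of_int i + 1 / 2) (s + i) - ypow c \<tau> z (1 / 2) (s + i)) / (1 - Y)
      = ypow c \<tau> z (1 / 2) (s + i) * ((Y ^ (m * j) - 1) / (1 - Y))"
      unfolding p by (simp add: algebra_simps)
    also have "\<dots> = - (\<Sum>h<m * j. ypow c \<tau> z (real h + 1 / 2) (s + i))"
      unfolding geometric_quotient[OF Y] mult_minus_right sum_distrib_left Yh by (simp only: add.commute)
    finally have "appell2_term m c \<tau> z (real m * real_of_int i + 1 / 2) i s - appell2_term m c \<tau> z (1 / 2) i s
      = - ((-1) ^ j * (\<Sum>h<m * j. k * ypow c \<tau> z (real h + 1 / 2) (s + i)))"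
      unfolding diff by (simp add: j sum_distrib_left mult_ac)
    moreover have "k * ypow c \<tau> z (real h + 1 / 2) (s + i) = geom_coeff m c \<tau> 1 j h * level_theta_term m \<tau> z (real m / 2 + (real h + 1 / 2)) s" for h
      unfolding k_def geom_coeff_def level_theta_term_def ypow_def cexp_z_irrelevant[of 0 \<tau> _ _ z] cexp_mult j
      by (rule cexp_cong) (use m in \<open>simp_all add: field_simps power2_eq_square\<close>)
    ultimately show ?thesis unfolding geom_term_def using True j by (simp add: diff_eq_eq)
  next
    case False
    define j where "j = nat (- i)"
    have j: "i = - int j" using False by (simp add: j_def)
    have p: "ypow c \<tau> z (1 / 2) (s + i) = ypow c \<tau> z (1 / 2 - real m * real j) (s + i) * Y ^ (m * j)"
    proof -
      have "1 / 2 = 1 / 2 - real m * real j + real (m * j)" by simp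
      then show ?thesis by (simp only: Yh)
    qed
    have p': "ypow c \<tau> z (real m * real_of_int i + 1 / 2) (s + i) = ypow c \<tau> z (1 / 2 - real m * real j) (s + i)"
      unfolding j by simp
    have "(ypow c \<tau> z (real m * real_of_int i + 1 / 2) (s + i) - ypow c \<tau> z (1 / 2) (s + i)) / (1 - Y)
      = - (ypow c \<tau> z (1 / 2 - real m * real j) (s + i) * ((Y ^ (m * j) - 1) / (1 - Y)))"
      unfolding p p' by (simp add: algebra_simps minus_divide_left)
    also have "\<dots> = (\<Sum>h<m * j. ypow c \<tau> z (1 / 2 - real m * real j + real h) (s + i))"
      unfolding geometric_quotient[OF Y] mult_minus_right sum_distrib_left Yh by simp
    also have "\<dots> = (\<Sum>h<m * j. ypow c \<tau> z (- (real h + 1 / 2)) (s + i))"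
    proof (subst sum.nat_diff_reindex[symmetric], rule sum.cong)
      fix h assume "h \<in> {..<m * j}"
      then have "real (m * j - Suc h) = real m * real j - real h - 1" by (simp add: of_nat_diff)
      then have "1 / 2 - real m * real j + real (m * j - Suc h) = - (real h + 1 / 2)" by simp
      then show "ypow c \<tau> z (1 / 2 - real m * real j + real (m * j - Suc h)) (s + i) = ypow c \<tau> z (- (real h + 1 / 2)) (s + i)"
        by (simp only:)
    qed simp
    finally have fin: "(ypow c \<tau> z (real m * real_of_int i + 1 / 2) (s + i) - ypow c \<tau> z (1 / 2) (s + i)) / (1 - Y)
      = (\<Sum>h<m * j. ypow c \<tau> z (- (real h + 1 / 2)) (s + i))" .
    have "appell2_term m c \<tau> z (real m * real_of_int i + 1 / 2) i s - appell2_term m c \<tau> z (1 / 2) i s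
      = (-1) ^ j * (\<Sum>h<m * j. k * ypow c \<tau> z (- (real h + 1 / 2)) (s + i))"
    proof -
      have "(-1 :: complex) powi i = (-1) ^ j" by (simp add: j power_int_minus flip: power_inverse)
      then show ?thesis unfolding diff fin by (simp add: sum_distrib_left mult_ac)
    qed
    moreover have "k * ypow c \<tau> z (- (real h + 1 / 2)) (s + i) = geom_coeff m c \<tau> (-1) j h * level_theta_term m \<tau> z (real m / 2 - (real h + 1 / 2)) s" for h
      unfolding k_def geom_coeff_def level_theta_term_def ypow_def cexp_z_irrelevant[of 0 \<tau> _ _ z] cexp_mult j
      by (rule cexp_cong) (use m in \<open>simp_all add: field_simps power2_eq_square\<close>)
    ultimately show ?thesis unfolding geom_term_def using False j by (simp add: diff_eq_eq)
  qed
qed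


lemma level_theta_term_abs_summable:
  assumes "Im \<tau> > 0" "m > 0"
  shows "(\<lambda>s. norm (level_theta_term m \<tau> z n s)) summable_on UNIV"
  unfolding level_theta_term_def by (rule level_theta_abs_summable[OF assms])

lemma level_theta_term_norm_sum_le:
  assumes "Im \<tau> > 0" "m > 0"
  shows "infsum (\<lambda>s. norm (level_theta_term m \<tau> z (real_of_int n) s)) UNIV
     \<le> infsum (\<lambda>k::int. norm (cexp z \<tau> (real_of_int k) ((real_of_int k)\<^sup>2 / real m) 0)) UNIV"
proof -
  define g where "g k = norm (cexp z \<tau> (real_of_int k) ((real_of_int k)\<^sup>2 / real m) 0)" for k :: int
  have g: "g summable_on UNIV"
    unfolding g_def by (rule cexp_gaussian_abs_summable[OF assms(1), of "1 / real m" _ 1 0 _ 0 0]) (use assms in auto)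
  define r where "r s = int m * s + n" for s
  have "inj r" using assms by (auto simp: inj_on_def r_def)
  then have "infsum (\<lambda>s. norm (level_theta_term m \<tau> z (real_of_int n) s)) UNIV = infsum g (range r)"
    by (subst infsum_reindex) (auto simp: g_def r_def level_theta_term_def o_def)
  also have "\<dots> \<le> infsum g UNIV"
    by (rule infsum_mono2[OF summable_on_subset_banach[OF g] g]) (auto simp: g_def)
  finally show ?thesis unfolding g_def .
qed

text \<open>
  The sum over \<open>s\<close> runs through one residue class modulo \<open>m\<close>, so it is bounded by the full sum over all integers,
  uniformly in \<open>h\<close>. There are \<open>m |i|\<close> values of \<open>h\<close>, and the coefficients decay like a Gaussian in \<open>i\<close>.
\<close>

lemma geom_term_abs_summable:
  assumes \<tau>: "Im \<tau> > 0" and m: "m = 2 * l + 1"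
  shows "(\<lambda>p. norm (case_prod (geom_term m c \<tau> z) p)) summable_on UNIV \<times> UNIV"
proof -
  have m0: "m > 0" using m by simp
  define Tt where "Tt = infsum (\<lambda>k::int. norm (cexp z \<tau> (real_of_int k) ((real_of_int k)\<^sup>2 / real m) 0)) UNIV"
  define \<alpha> where "\<alpha> = 2 * pi * Im \<tau>"
  define b where "b j = exp (- \<alpha> * ((real j)\<^sup>2 - real m * real j))" for j :: nat
  define n where "n i h = (if i > 0 then real m / 2 + (real h + 1 / 2) else real m / 2 - (real h + 1 / 2))"
    for i :: int and h :: nat
  define \<sigma> where "\<sigma> i = (if i > 0 then 1 else -1 :: real)" for i :: int
  define j where "j i = nat \<bar>i\<bar>" for i :: int
  have sg: "\<bar>\<sigma> i\<bar> = 1" for i by (simp add: \<sigma>_def)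
  have n_int: "n i h = real_of_int (int l + (if i > 0 then int h + 1 else - int h))" for i h
    unfolding n_def m by (simp add: field_simps)
  have Tn: "infsum (\<lambda>s. norm (level_theta_term m \<tau> z (n i h) s)) UNIV \<le> Tt" for i h
    unfolding n_int Tt_def by (rule level_theta_term_norm_sum_le[OF \<tau> m0])
  have T0: "0 \<le> Tt" unfolding Tt_def by (simp add: infsum_nonneg)
  have le: "norm (geom_term m c \<tau> z i s) \<le> (\<Sum>h<m * j i. b (j i) * norm (level_theta_term m \<tau> z (n i h) s))" for i s
  proof -
    have "norm (geom_term m c \<tau> z i s) = norm (\<Sum>h<m * j i. geom_coeff m c \<tau> (\<sigma> i) (j i) h * level_theta_term m \<tau> z (n i h) s)"
      unfolding geom_term_def n_def \<sigma>_def j_def by (simp add: norm_mult norm_power)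
    also have "\<dots> \<le> (\<Sum>h<m * j i. norm (geom_coeff m c \<tau> (\<sigma> i) (j i) h) * norm (level_theta_term m \<tau> z (n i h) s))"
      unfolding norm_mult[symmetric] by (rule norm_sum)
    also have "\<dots> \<le> (\<Sum>h<m * j i. b (j i) * norm (level_theta_term m \<tau> z (n i h) s))"
    proof (intro sum_mono mult_right_mono)
      fix h assume "h \<in> {..<m * j i}"
      then show "norm (geom_coeff m c \<tau> (\<sigma> i) (j i) h) \<le> b (j i)"
        using norm_geom_coeff_le[OF \<tau> m0 sg[of i], of h "j i" c] by (simp add: b_def \<alpha>_def)
    qed simp
    finally show ?thesis .
  qed
  have hs: "((\<lambda>s. \<Sum>h<m * j i. b (j i) * norm (level_theta_term m \<tau> z (n i h) s)) has_sum
     (\<Sum>h<m * j i. b (j i) * infsum (\<lambda>s. norm (level_theta_term m \<tau> z (n i h) s)) UNIV)) UNIV" for i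
    by (intro has_sum_finite_sum has_sum_cmult_right has_sum_infsum level_theta_term_abs_summable \<tau> m0) auto
  have smm: "(\<lambda>s. norm (geom_term m c \<tau> z i s)) summable_on UNIV" for i
    by (rule summable_on_comparison_test[OF has_sum_imp_summable[OF hs[of i]]]) (use le in auto)
  show ?thesis
  proof (rule abs_summable_pairI[OF smm])
    fix i
    have "infsum (\<lambda>s. norm (geom_term m c \<tau> z i s)) UNIV \<le> (\<Sum>h<m * j i. b (j i) * infsum (\<lambda>s. norm (level_theta_term m \<tau> z (n i h) s)) UNIV)"
      using infsum_mono[OF smm has_sum_imp_summable[OF hs[of i]]] le infsumI[OF hs[of i]] by simp
    also have "\<dots> \<le> (\<Sum>h<m * j i. b (j i) * Tt)"
      by (intro sum_mono mult_left_mono Tn) (simp add: b_def)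
    also have "\<dots> = real m * real_of_int \<bar>i\<bar> * exp (- \<alpha> * ((real_of_int i)\<^sup>2 - real m * real_of_int \<bar>i\<bar>)) * Tt"
      by (simp add: b_def j_def)
    finally show "infsum (\<lambda>s. norm (geom_term m c \<tau> z i s)) UNIV
      \<le> real m * real_of_int \<bar>i\<bar> * exp (- \<alpha> * ((real_of_int i)\<^sup>2 - real m * real_of_int \<bar>i\<bar>)) * Tt" .
  next
    show "(\<lambda>i::int. real m * real_of_int \<bar>i\<bar> * exp (- \<alpha> * ((real_of_int i)\<^sup>2 - real m * real_of_int \<bar>i\<bar>)) * Tt) summable_on UNIV"
      by (intro summable_on_cmult_left gaussian_weight_summable) (use \<tau> in \<open>simp add: \<alpha>_def\<close>)
  qed
qed

definition geom_contrib :: "nat \<Rightarrow> int \<Rightarrow> complex \<Rightarrow> complex \<Rightarrow> nat \<Rightarrow> complex" where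
  "geom_contrib m c \<tau> z j = (-1) ^ j * (\<Sum>h<m * j. geom_coeff m c \<tau> (-1) j h * level_theta m \<tau> z (real m / 2 - (real h + 1 / 2))
      - geom_coeff m c \<tau> 1 j h * level_theta m \<tau> z (real m / 2 + (real h + 1 / 2)))"

text \<open>
  The double series with exponent \<open>m i + 1/2\<close> and the geometric one are absolutely summable, hence so is
  their difference, the series with exponent \<open>1/2\<close>. This is what allows it to be summed over \<open>i\<close> first.
\<close>

theorem appell_decomposition:
  assumes \<tau>: "Im \<tau> > 0" and m: "m = 2 * l + 1" and nz: "\<And>j. ypow c \<tau> z 1 j \<noteq> 1"
  shows "theta_null m c \<tau> * appell m c \<tau> z (Suc l) = cexp 0 \<tau> 0 0 (real_of_int c * real m / 4) *
      (qprod ((nome \<tau>)\<^sup>2) (nome \<tau>) ^ 3 / jtheta (ypow c \<tau> z 1 0) (nome \<tau>) * pole_numerator m c \<tau> z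
        + (\<Sum>\<^sub>\<infinity>j\<in>{1::nat..}. geom_contrib m c \<tau> z j))"
    and "geom_contrib m c \<tau> z summable_on {1..}"
proof -
  have m0: "m > 0" using m by simp
  define A where "A i s = appell2_term m c \<tau> z (real m * real_of_int i + 1 / 2) i s" for i s
  define B where "B i s = appell2_term m c \<tau> z (1 / 2) i s" for i s
  define G where "G = geom_term m c \<tau> z"
  have ABG: "A i s = B i s + G i s" for i s
    unfolding A_def B_def G_def by (rule appell2_geometric_difference[OF m0 nz])
  have Aa: "(\<lambda>p. norm (case_prod A p)) summable_on UNIV \<times> UNIV"
    unfolding A_def by (rule theta_null_times_appell(2)[OF \<tau> m nz])
  have As: "(\<lambda>(i,s). A i s) summable_on UNIV \<times> UNIV" by (rule abs_summable_summable[OF Aa])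
  have Gs: "(\<lambda>(i,s). G i s) summable_on UNIV \<times> UNIV"
    unfolding G_def by (rule abs_summable_summable[OF geom_term_abs_summable[OF \<tau> m]])
  have "(\<lambda>p. case_prod A p + - case_prod G p) summable_on UNIV \<times> UNIV"
    by (intro summable_on_add As summable_on_uminus[THEN iffD2] Gs)
  moreover have "(\<lambda>p. case_prod A p + - case_prod G p) = (\<lambda>(i,s). B i s)"
    by (rule ext) (auto simp: ABG)
  ultimately have Bs: "(\<lambda>(i,s). B i s) summable_on UNIV \<times> UNIV" by simp
  have G_inner: "(G i has_sum infsum (G i) UNIV) UNIV" for i
    using summable_on_SigmaD1[OF Gs, of i] by (simp add: has_sum_infsum)
  have G_sum: "(\<lambda>i. infsum (G i) UNIV) summable_on UNIV"
    by (rule summable_on_Sigma_banach[OF Gs])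
  have hsT: "((\<lambda>s. \<Sum>h<k. w h * level_theta_term m \<tau> z (n h) s) has_sum (\<Sum>h<k. w h * level_theta m \<tau> z (n h))) UNIV"
    for k :: nat and w :: "nat \<Rightarrow> complex" and n
    unfolding level_theta_term_def by (intro has_sum_finite_sum has_sum_cmult_right level_theta_has_sum \<tau> m0) auto
  have Gp: "infsum (G (int j)) UNIV = - ((-1) ^ j * (\<Sum>h<m * j. geom_coeff m c \<tau> 1 j h * level_theta m \<tau> z (real m / 2 + (real h + 1 / 2))))"
    if "j \<ge> 1" for j
  proof -
    have e: "G (int j) = (\<lambda>s. - ((-1) ^ j) * (\<Sum>h<m * j. geom_coeff m c \<tau> 1 j h * level_theta_term m \<tau> z (real m / 2 + (real h + 1 / 2)) s))"
      using that unfolding G_def geom_term_def by (intro ext) simp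
    show ?thesis unfolding e infsumI[OF has_sum_cmult_right[OF hsT]] by simp
  qed
  have Gn: "infsum (G (- int j)) UNIV = (-1) ^ j * (\<Sum>h<m * j. geom_coeff m c \<tau> (-1) j h * level_theta m \<tau> z (real m / 2 - (real h + 1 / 2)))" for j
  proof -
    have e: "G (- int j) = (\<lambda>s. (-1) ^ j * (\<Sum>h<m * j. geom_coeff m c \<tau> (-1) j h * level_theta_term m \<tau> z (real m / 2 - (real h + 1 / 2)) s))"
      unfolding G_def geom_term_def by (intro ext) simp
    show ?thesis unfolding e infsumI[OF has_sum_cmult_right[OF hsT]] by simp
  qed
  have Gpn: "infsum (G (int j)) UNIV + infsum (G (- int j)) UNIV = geom_contrib m c \<tau> z j" if "j \<in> {1..}" for j
    using that unfolding geom_contrib_def sum_subtractf Gn by (simp add: Gp algebra_simps)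
  have G0: "infsum (G 0) UNIV = 0" using Gn[of 0] by simp
  show "geom_contrib m c \<tau> z summable_on {1..}"
    by (rule iffD1[OF summable_on_cong[OF Gpn] infsum_int_split(2)[OF G_sum]])
  have "(\<Sum>\<^sub>\<infinity>i. \<Sum>\<^sub>\<infinity>s. A i s) = infsum (\<lambda>(i,s). A i s) (UNIV \<times> UNIV)"
    by (rule infsum_Sigma'_banach[OF As])
  also have "\<dots> = infsum (\<lambda>p. (case p of (i,s) \<Rightarrow> B i s) + (case p of (i,s) \<Rightarrow> G i s)) (UNIV \<times> UNIV)"
    by (rule infsum_cong) (auto simp: ABG)
  also have "\<dots> = infsum (\<lambda>(i,s). B i s) (UNIV \<times> UNIV) + infsum (\<lambda>(i,s). G i s) (UNIV \<times> UNIV)"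
    by (rule infsum_add[OF Bs Gs])
  also have "infsum (\<lambda>(i,s). B i s) (UNIV \<times> UNIV) = (\<Sum>\<^sub>\<infinity>i. \<Sum>\<^sub>\<infinity>s. B i s)"
    by (rule infsum_Sigma'_banach[OF Bs, symmetric])
  also have "\<dots> = (\<Sum>\<^sub>\<infinity>s. \<Sum>\<^sub>\<infinity>i. B i s)" by (rule infsum_swap_banach[OF Bs])
  also have "\<dots> = qprod ((nome \<tau>)\<^sup>2) (nome \<tau>) ^ 3 / jtheta (ypow c \<tau> z 1 0) (nome \<tau>) * pole_numerator m c \<tau> z"
    unfolding B_def by (rule appell2_pole_part[OF \<tau> nz])
  also have "infsum (\<lambda>(i,s). G i s) (UNIV \<times> UNIV) = (\<Sum>\<^sub>\<infinity>i. infsum (G i) UNIV)"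
    by (rule infsum_Sigma'_banach[OF Gs, symmetric])
  also have "\<dots> = (\<Sum>\<^sub>\<infinity>j\<in>{1::nat..}. geom_contrib m c \<tau> z j)"
    unfolding infsum_int_split(1)[OF G_sum] G0 add_0 by (rule infsum_cong[OF Gpn])
  finally show "theta_null m c \<tau> * appell m c \<tau> z (Suc l) = cexp 0 \<tau> 0 0 (real_of_int c * real m / 4) *
      (qprod ((nome \<tau>)\<^sup>2) (nome \<tau>) ^ 3 / jtheta (ypow c \<tau> z 1 0) (nome \<tau>) * pole_numerator m c \<tau> z
        + (\<Sum>\<^sub>\<infinity>j\<in>{1::nat..}. geom_contrib m c \<tau> z j))"
    unfolding theta_null_times_appell(1)[OF \<tau> m nz] A_def by simp
qed

section \<open>Identification of the theta functions\<close>

lemma qpow_cexp: "qpow \<tau> a = cexp z \<tau> 0 a 0"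
  by (simp add: qpow_def cexp_def mult_ac)

text \<open>The case \<open>c = -1\<close> is \<open>theta\<close>, the case \<open>c = 0\<close> is \<open>theta_minus\<close>.\<close>

definition twisted_theta :: "int \<Rightarrow> real \<Rightarrow> real \<Rightarrow> complex \<Rightarrow> complex \<Rightarrow> complex" where
  "twisted_theta c k M \<tau> z = (\<Sum>\<^sub>\<infinity>j\<in>(UNIV::int set).
     cexp z \<tau> (M * (real_of_int j + k / (2 * M))) (M * (real_of_int j + k / (2 * M))\<^sup>2) ((1 + real_of_int c) * real_of_int j / 2))"

lemma theta_eq_twisted_theta: "theta k M \<tau> z = twisted_theta (-1) k M \<tau> z"
proof -
  have e: "exp (2 * of_real pi * \<i> * of_real x * z) * qpow \<tau> a = cexp z \<tau> x a 0" for x a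
    unfolding qpow_cexp[of _ _ z] by (simp add: cexp_def exp_add[symmetric] algebra_simps)
  show ?thesis unfolding theta_def twisted_theta_def e by simp
qed

lemma theta_minus_eq_twisted_theta: "theta_minus k M \<tau> z = twisted_theta 0 k M \<tau> z"
proof -
  have e: "(-1) powi j * exp (2 * of_real pi * \<i> * of_real x * z) * qpow \<tau> a = cexp z \<tau> x a ((1 + real_of_int 0) * real_of_int j / 2)" for x a j
  proof -
    have "exp (2 * of_real pi * \<i> * of_real x * z) = cexp z \<tau> x 0 0" by (simp add: cexp_def algebra_simps)
    then show ?thesis unfolding qpow_cexp[of _ _ z] minus_one_powi_cexp[of j z \<tau>] by (simp add: cexp_mult)
  qed
  show ?thesis unfolding theta_minus_def twisted_theta_def e ..
qed

lemma twisted_theta_reflect: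
  assumes "M \<noteq> 0" shows "twisted_theta c k M \<tau> (- z) = twisted_theta c (- k) M \<tau> z"
proof -
  define g where "g j = cexp z \<tau> (M * (real_of_int j + (- k) / (2 * M))) (M * (real_of_int j + (- k) / (2 * M))\<^sup>2) ((1 + real_of_int c) * real_of_int j / 2)" for j
  have "cexp (- z) \<tau> (M * (real_of_int j + k / (2 * M))) (M * (real_of_int j + k / (2 * M))\<^sup>2) ((1 + real_of_int c) * real_of_int j / 2)
    = g (0 - j)" for j
    unfolding cexp_reflect g_def
    by (rule cexp_cong_int[where n = "(1 + c) * j"]) (use assms in \<open>simp_all add: field_simps power2_eq_square\<close>)
  then show ?thesis
    unfolding twisted_theta_def g_def[symmetric] by (simp only: infsum_int_reflect)
qed

lemma theta_exponent:
  fixes N x k :: real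
  shows "N \<noteq> 0 \<Longrightarrow> N * (x + k / (2 * N))\<^sup>2 = N * x\<^sup>2 + k * x + k\<^sup>2 / (4 * N)"
  by (simp add: field_simps power2_eq_square)

lemma theta_null_eq_twisted_theta:
  assumes "m = 2 * l + 1"
  shows "theta_null m c \<tau> = cexp 0 \<tau> 0 (- ((real m)\<^sup>2 / (16 * (real m + 1)))) 0 * twisted_theta c (real m / 2) (real m + 1) \<tau> 0"
proof -
  define g where "g j = cexp 0 \<tau> ((real m + 1) * (real_of_int j + (real m / 2) / (2 * (real m + 1)))) ((real m + 1) * (real_of_int j + (real m / 2) / (2 * (real m + 1)))\<^sup>2) ((1 + real_of_int c) * real_of_int j / 2)" for j
  have "(-1) powi i * cexp 0 \<tau> 0 ((real m + 1) * (real_of_int i)\<^sup>2 - real m * real_of_int i / 2) (- (real_of_int c * real m * real_of_int i / 2))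
     = cexp 0 \<tau> 0 (- ((real m)\<^sup>2 / (16 * (real m + 1)))) 0 * g (0 - i)" for i
  proof -
    have x: "cexp 0 \<tau> x a b = cexp 0 \<tau> 0 a b" for x a b by (simp add: cexp_def)
    have r: "real m = 2 * real l + 1" using assms by simp
    have a: "(real m + 1) * (real_of_int i)\<^sup>2 - real m * real_of_int i / 2 = - ((real m)\<^sup>2 / (16 * (real m + 1)))
        + (real m + 1) * (real_of_int (0 - i) + (real m / 2) / (2 * (real m + 1)))\<^sup>2"
      using theta_exponent[of "real m + 1" "real_of_int (0 - i)" "real m / 2"] by (simp add: power_divide)
    show ?thesis
      unfolding g_def x[of "(real m + 1) * _"] minus_one_powi_cexp[of i 0 \<tau>] cexp_mult
      by (rule cexp_cong_int[where n = "i - c * int l * i"], simp, simp only: a add_0,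
          simp add: r field_simps)
  qed
  then show ?thesis
    unfolding theta_null_def twisted_theta_def g_def[symmetric] by (simp only: infsum_cmult_right' infsum_int_reflect)
qed

lemma pole_numerator_eq_twisted_theta:
  "pole_numerator m c \<tau> z = cexp z \<tau> (1 / 4) (1 / 4 - 1 / (16 * (real m + 1))) (real_of_int c / 4) * twisted_theta c (real m + 1 / 2) (real m + 1) \<tau> z"
proof -
  have "(-1) powi s * cexp z \<tau> ((real m + 1) * (real_of_int s + 1 / 2)) ((real m + 1) * (real_of_int s + 1 / 2)\<^sup>2 - real_of_int s / 2)
       (real_of_int c * (real_of_int s + 1 / 2) / 2)
    = cexp z \<tau> (1 / 4) (1 / 4 - 1 / (16 * (real m + 1))) (real_of_int c / 4) *
      cexp z \<tau> ((real m + 1) * (real_of_int s + (real m + 1 / 2) / (2 * (real m + 1)))) ((real m + 1) * (real_of_int s + (real m + 1 / 2) / (2 * (real m + 1)))\<^sup>2) ((1 + real_of_int c) * real_of_int s / 2)" for s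
    unfolding minus_one_powi_cexp[of s z \<tau>] cexp_mult
    by (rule cexp_cong) (simp_all add: divide_simps, simp_all add: algebra_simps power2_eq_square)
  then show ?thesis unfolding pole_numerator_def twisted_theta_def by (simp only: infsum_cmult_right')
qed

lemma jtheta_eq_twisted_theta:
  "jtheta (ypow c \<tau> z 1 0) (nome \<tau>) = cexp z \<tau> (1 / 4) (- 1 / 16) 0 * twisted_theta c (- (1 / 2)) 1 \<tau> z"
proof -
  have "(-1) powi i * ypow c \<tau> z 1 0 powi i * nome \<tau> powi (i * i - i)
    = cexp z \<tau> (1 / 4) (- 1 / 16) 0 * cexp z \<tau> (1 * (real_of_int i + (- (1 / 2)) / (2 * 1))) (1 * (real_of_int i + (- (1 / 2)) / (2 * 1))\<^sup>2) ((1 + real_of_int c) * real_of_int i / 2)" for i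
    unfolding minus_one_powi_cexp[of i z \<tau>] ypow_def cexp_powi nome_powi[of _ _ z] cexp_mult
    by (rule cexp_cong) (simp_all add: field_simps power2_eq_square)
  then show ?thesis unfolding jtheta_def twisted_theta_def by (simp only: infsum_cmult_right')
qed

text \<open>
  The series is \<open>jtheta Y Q\<close> with \<open>Q = q^(m + 1)\<close> and \<open>|Y| = |q|^(m/2 + 1)\<close>. A zero would need \<open>Y Q^(2 i) = 1\<close>, but
  \<open>m/2 + 1\<close> is not a multiple of \<open>2 (m + 1)\<close>.
\<close>

lemma theta_null_nonzero:
  assumes \<tau>: "Im \<tau> > 0"
  shows "theta_null m c \<tau> \<noteq> 0"
proof -
  define Q where "Q = cexp 0 \<tau> 0 (real m + 1) 0"
  define Y where "Y = cexp 0 \<tau> 0 (real m + 1 - real m / 2) (- (real_of_int c * real m / 2))"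
  have "theta_null m c \<tau> = jtheta Y Q"
    unfolding theta_null_def jtheta_def Y_def Q_def cexp_powi mult.assoc cexp_mult
    by (rule infsum_cong, rule arg_cong2[where f = times], rule refl, rule cexp_cong) (simp_all add: field_simps power2_eq_square)
  also have "jtheta Y Q \<noteq> 0"
  proof (rule jtheta_nonzero)
    show "Q \<noteq> 0" "Y \<noteq> 0" by (simp_all add: Q_def Y_def)
    show "norm Q < 1" using \<tau> by (simp add: Q_def norm_cexp)
    fix i :: int
    have "int m + 2 + 4 * P \<noteq> 0" if P: "P = i * (int m + 1)" for P
    proof (cases "i \<ge> 0")
      case True then have "P \<ge> 0" unfolding P by simp
      then show ?thesis by linarith
    next
      case False
      then have "P \<le> (-1) * (int m + 1)" unfolding P by (intro mult_right_mono) auto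
      then show ?thesis by presburger
    qed
    from this[OF refl] have "int m + 2 + 4 * i * (int m + 1) \<noteq> 0" by (simp only: mult.assoc not_False_eq_True)
    then have "real_of_int (int m + 2 + 4 * i * (int m + 1)) \<noteq> 0" by (simp only: of_int_eq_0_iff not_False_eq_True)
    then have nz: "real m + 1 - real m / 2 + real_of_int (2 * i) * (real m + 1) \<noteq> 0" by (simp add: field_simps)
    show "Y * Q powi (2 * i) \<noteq> 1"
    proof
      assume "Y * Q powi (2 * i) = 1"
      then have "norm (Y * Q powi (2 * i)) = 1" by simp
      then have "(real m + 1 - real m / 2 + real_of_int (2 * i) * (real m + 1)) * Im \<tau> = 0"
        unfolding Y_def Q_def cexp_powi cexp_mult norm_cexp by simp
      then show False using nz \<tau> by simp
    qed
  qed
  finally show ?thesis .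
qed

lemma dedekind_eta_double:
  "dedekind_eta (2 * \<tau>) = cexp 0 \<tau> 0 (1 / 12) 0 * qprod ((nome \<tau>)\<^sup>2) (nome \<tau>)"
proof -
  have "qpow (2 * \<tau>) (real (Suc n)) = (nome \<tau>)\<^sup>2 * nome \<tau> ^ (2 * n)" for n
    unfolding nome_def cexp_power cexp_mult by (simp add: qpow_def cexp_def algebra_simps)
  moreover have "qpow (2 * \<tau>) (1 / 24) = cexp 0 \<tau> 0 (1 / 12) 0"
    by (simp add: qpow_def cexp_def)
  ultimately show ?thesis unfolding dedekind_eta_def qprod_def by simp
qed

lemma dedekind_eta_nonzero:
  assumes "Im \<tau> > 0" shows "dedekind_eta \<tau> \<noteq> 0"
proof -
  define \<sigma> where "\<sigma> = \<tau> / 2"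
  have s: "Im \<sigma> > 0" "\<tau> = 2 * \<sigma>" using assms by (auto simp: \<sigma>_def)
  show ?thesis unfolding s(2) dedekind_eta_double using qpoch_limit_nonzero[OF norm_nome[OF s(1)]] by simp
qed

lemma mumford_theta_0_cexp:
  "mumford_theta 0 b \<tau> z = (\<Sum>\<^sub>\<infinity>n\<in>(UNIV::int set). cexp z \<tau> (real_of_int n) ((real_of_int n)\<^sup>2 / 2) (real_of_int n * real b / 2))"
  unfolding mumford_theta_def cexp_def by (rule infsum_cong) (simp add: algebra_simps)

lemma mumford_theta_0_even: "mumford_theta 0 b \<tau> (- z) = mumford_theta 0 b \<tau> z"
proof -
  define g where "g n = cexp z \<tau> (real_of_int n) ((real_of_int n)\<^sup>2 / 2) (real_of_int n * real b / 2)" for n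
  have "cexp (- z) \<tau> (real_of_int n) ((real_of_int n)\<^sup>2 / 2) (real_of_int n * real b / 2) = g (0 - n)" for n
    unfolding cexp_reflect g_def by (rule cexp_cong_int[where n = "n * int b"]) (simp_all add: field_simps)
  then show ?thesis unfolding mumford_theta_0_cexp g_def[symmetric] by (simp only: infsum_int_reflect)
qed

text \<open>
  If \<open>Y j = 1\<close>, the substitution \<open>n \<mapsto> 1 + 4 j - n\<close> changes the sign of every summand. Thus at regular points
  no denominator of the Appell sum vanishes.
\<close>

lemma mumford_theta_0_zero:
  assumes "ypow c \<tau> z 1 j = 1" and bc: "int b = c + 1"
  shows "mumford_theta 0 b \<tau> z = 0"
proof -
  define g where "g n = cexp z \<tau> (real_of_int n) ((real_of_int n)\<^sup>2 / 2) (real_of_int n * real b / 2)" for n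
  define K where "K = 1 + 4 * j"
  have b: "real b = real_of_int c + 1" using bc by (metis of_int_1 of_int_add of_int_of_nat_eq)
  have "g (K - n) = - g n" for n
  proof -
    \<comment> \<open>The power \<open>2 n - K\<close> is the one that removes the term linear in \<open>n\<close> from the exponent of \<open>q\<close>.\<close>
    have "g (K - n) = g (K - n) * ypow c \<tau> z 1 j powi (2 * n - K)" by (simp add: assms(1))
    also have "\<dots> = cexp z \<tau> 0 0 (1 / 2) * g n"
      unfolding g_def ypow_def cexp_powi cexp_mult b K_def
      by (rule cexp_cong_int[where n = "2 * j - n"]) (simp_all add: field_simps power2_eq_square)
    also have "cexp z \<tau> 0 0 (1 / 2) = -1"
      using minus_one_powi_cexp[of 1 z \<tau>] by simp
    finally show ?thesis by simp
  qed
  then have "infsum g UNIV = - infsum g UNIV"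
    using infsum_int_reflect[of g K] by (simp add: infsum_uminus)
  then show ?thesis unfolding mumford_theta_0_cexp g_def[symmetric] by simp
qed

lemma Phi_eq_appell:
  "Phi (real m / 2) 1 (2 * \<tau>) (z + \<tau> / 2 + of_int c / 2) (z - \<tau> / 2 - of_int c / 2) 0
    = appell m c \<tau> z 1 - appell m c \<tau> (- z) 1"
proof -
  have d: "exp (2 * of_real pi * \<i> * (z + \<tau> / 2 + of_int c / 2)) * qpow (2 * \<tau>) (of_int j) = ypow c \<tau> z 1 j"
    "exp (- 2 * of_real pi * \<i> * (z - \<tau> / 2 - of_int c / 2)) * qpow (2 * \<tau>) (of_int j) = ypow c \<tau> (- z) 1 j" for j
    unfolding qpow_def ypow_def cexp_def exp_add[symmetric]
    by (rule arg_cong[where f = exp]; simp add: field_simps)+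
  have n: "exp (2 * of_real pi * \<i> * of_real (real m / 2) * of_int j * ((z + \<tau> / 2 + of_int c / 2) + (z - \<tau> / 2 - of_int c / 2))
               + 2 * of_real pi * \<i> * of_real 1 * (z + \<tau> / 2 + of_int c / 2))
            * qpow (2 * \<tau>) (real m / 2 * (of_int j)\<^sup>2 + 1 * of_int j)
      = cexp z \<tau> (real m * real_of_int j) (real m * (real_of_int j)\<^sup>2) 0 * ypow c \<tau> z (real 1) j"
    "exp (- 2 * of_real pi * \<i> * of_real (real m / 2) * of_int j * ((z + \<tau> / 2 + of_int c / 2) + (z - \<tau> / 2 - of_int c / 2))
               - 2 * of_real pi * \<i> * of_real 1 * (z - \<tau> / 2 - of_int c / 2))
            * qpow (2 * \<tau>) (real m / 2 * (of_int j)\<^sup>2 + 1 * of_int j)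
      = cexp (- z) \<tau> (real m * real_of_int j) (real m * (real_of_int j)\<^sup>2) 0 * ypow c \<tau> (- z) (real 1) j" for j
    unfolding qpow_def ypow_def cexp_mult unfolding cexp_def exp_add[symmetric]
    by (rule arg_cong[where f = exp]; simp add: field_simps)+
  show ?thesis unfolding Phi_def Phi1_def Phi2_def n d appell_def by simp
qed

section \<open>Antisymmetrisation and the block structure of the sums\<close>

definition odd_level_theta :: "nat \<Rightarrow> complex \<Rightarrow> complex \<Rightarrow> real \<Rightarrow> complex" where
  "odd_level_theta m \<tau> z n = level_theta m \<tau> z n - level_theta m \<tau> z (- n)"

lemma odd_level_theta_minus: "odd_level_theta m \<tau> z (- n) = - odd_level_theta m \<tau> z n"
  by (simp add: odd_level_theta_def)

lemma odd_level_theta_periodic: "odd_level_theta m \<tau> z (n + real m) = odd_level_theta m \<tau> z n"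
  using level_theta_periodic[of m \<tau> z n 1] level_theta_periodic[of m \<tau> z "- n" "-1"] by (simp add: odd_level_theta_def)

lemma odd_level_theta_periodic_mult: "odd_level_theta m \<tau> z (n + real m * real r) = odd_level_theta m \<tau> z n"
  using level_theta_periodic[of m \<tau> z n "int r"] level_theta_periodic[of m \<tau> z "- n" "- int r"] by (simp add: odd_level_theta_def)

lemma theta_odd_eq_odd_level_theta:
  assumes "m > 0"
  shows "theta_odd (real (2 * k)) (real m) \<tau> z = odd_level_theta m \<tau> z (real k)"
    and "theta_odd (real k) (real m / 2) (2 * \<tau>) (2 * z) = odd_level_theta m \<tau> z (real k)"
proof -
  have 1: "theta (2 * x) (real m) \<tau> z = level_theta m \<tau> z x" for x
    unfolding theta_def level_theta_def
  proof (rule infsum_cong)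
    fix j :: int
    have e: "real m * (real_of_int j + 2 * x / (2 * real m)) = real m * real_of_int j + x"
      "real m * (real_of_int j + 2 * x / (2 * real m))\<^sup>2 = (real m * real_of_int j + x)\<^sup>2 / real m"
      using assms by (simp_all add: field_simps power2_eq_square)
    show "exp (2 * of_real pi * \<i> * of_real (real m * (real_of_int j + 2 * x / (2 * real m))) * z)
         * qpow \<tau> (real m * (real_of_int j + 2 * x / (2 * real m))\<^sup>2)
      = cexp z \<tau> (real m * real_of_int j + x) ((real m * real_of_int j + x)\<^sup>2 / real m) 0"
      unfolding e qpow_cexp[of _ _ z] by (simp add: cexp_def exp_add[symmetric] algebra_simps)
  qed
  have 2: "theta x (real m / 2) (2 * \<tau>) (2 * z) = level_theta m \<tau> z x" for x
    unfolding theta_def level_theta_def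
  proof (rule infsum_cong)
    fix j :: int
    have e: "real m / 2 * (real_of_int j + x / (2 * (real m / 2))) = (real m * real_of_int j + x) / 2"
      "real m / 2 * (real_of_int j + x / (2 * (real m / 2)))\<^sup>2 = (real m * real_of_int j + x)\<^sup>2 / real m / 2"
      using assms by (simp_all add: field_simps power2_eq_square)
    show "exp (2 * of_real pi * \<i> * of_real (real m / 2 * (real_of_int j + x / (2 * (real m / 2)))) * (2 * z))
         * qpow (2 * \<tau>) (real m / 2 * (real_of_int j + x / (2 * (real m / 2)))\<^sup>2)
      = cexp z \<tau> (real m * real_of_int j + x) ((real m * real_of_int j + x)\<^sup>2 / real m) 0"
      unfolding e qpow_def cexp_def exp_add[symmetric]
      by (rule arg_cong[where f = exp]) (use assms in \<open>simp add: field_simps\<close>)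
  qed
  show "theta_odd (real (2 * k)) (real m) \<tau> z = odd_level_theta m \<tau> z (real k)"
    unfolding theta_odd_def odd_level_theta_def using 1[of "real k"] 1[of "- real k"] by simp
  show "theta_odd (real k) (real m / 2) (2 * \<tau>) (2 * z) = odd_level_theta m \<tau> z (real k)"
    unfolding theta_odd_def odd_level_theta_def 2 ..
qed

text \<open>
  The contributions of \<open>i = j\<close> and \<open>i = - j\<close> carry the same theta function after antisymmetrisation; this is their
  joint coefficient, the one that appears with \<open>e = m r - m/2 + k\<close> and \<open>e = m r + m/2 - k\<close> in the triple sums.
\<close>

definition pair_weight :: "nat \<Rightarrow> int \<Rightarrow> complex \<Rightarrow> nat \<Rightarrow> real \<Rightarrow> complex" where
  "pair_weight m c \<tau> j e = cexp 0 \<tau> 0 ((real m + 1) * (real j)\<^sup>2 - (e - real m * real j)\<^sup>2 / real m) 0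
     * (cexp 0 \<tau> 0 (- e / 2) (real_of_int c * e / 2) + cexp 0 \<tau> 0 (e / 2) (- (real_of_int c * e / 2)))"

lemma pair_weight_eq: "geom_coeff m c \<tau> (-1) j h + geom_coeff m c \<tau> 1 j h = pair_weight m c \<tau> j (real h + 1 / 2)"
proof -
  define e where "e = real h + 1 / 2"
  show ?thesis unfolding pair_weight_def geom_coeff_def distrib_left cexp_mult e_def[symmetric]
    by (subst add.commute, rule arg_cong2[where f = plus]; rule cexp_cong; simp)
qed

definition upper_half_sum :: "nat \<Rightarrow> int \<Rightarrow> complex \<Rightarrow> complex \<Rightarrow> nat \<Rightarrow> complex" where
  "upper_half_sum m c \<tau> z j = (\<Sum>r = 1..j. \<Sum>k \<in> {0..(m - 1) div 2}.
     (-1) ^ j * pair_weight m c \<tau> j (real m * real r - real m / 2 + real k) * odd_level_theta m \<tau> z (real k))"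

definition lower_half_sum :: "nat \<Rightarrow> int \<Rightarrow> complex \<Rightarrow> complex \<Rightarrow> nat \<Rightarrow> complex" where
  "lower_half_sum m c \<tau> z j = (\<Sum>r = 0..j - 1. \<Sum>k \<in> {0..(m - 1) div 2}.
     (-1) ^ j * pair_weight m c \<tau> j (real m * real r + real m / 2 - real k) * odd_level_theta m \<tau> z (real k))"

definition odd_term :: "nat \<Rightarrow> int \<Rightarrow> complex \<Rightarrow> complex \<Rightarrow> nat \<Rightarrow> nat \<Rightarrow> complex" where
  "odd_term m c \<tau> z j h = (-1) ^ j * pair_weight m c \<tau> j (real h + 1 / 2) * odd_level_theta m \<tau> z (real m / 2 + (real h + 1 / 2))"

lemma geom_contrib_antisym:
  "geom_contrib m c \<tau> z j - geom_contrib m c \<tau> (- z) j = - (\<Sum>h<m * j. odd_term m c \<tau> z j h)"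
proof -
  have T: "level_theta m \<tau> z (real m / 2 - e) - level_theta m \<tau> (- z) (real m / 2 - e) = - odd_level_theta m \<tau> z (real m / 2 + e)" for e
  proof -
    have "level_theta m \<tau> z (real m / 2 - e) - level_theta m \<tau> (- z) (real m / 2 - e) = odd_level_theta m \<tau> z (- (real m / 2 + e) + real m)"
      unfolding odd_level_theta_def level_theta_reflect by simp
    then show ?thesis unfolding odd_level_theta_periodic odd_level_theta_minus .
  qed
  have T': "level_theta m \<tau> z n - level_theta m \<tau> (- z) n = odd_level_theta m \<tau> z n" for n
    unfolding odd_level_theta_def level_theta_reflect ..
  have "geom_contrib m c \<tau> z j - geom_contrib m c \<tau> (- z) j = (-1) ^ j * (\<Sum>h<m * j.
      geom_coeff m c \<tau> (-1) j h * (level_theta m \<tau> z (real m / 2 - (real h + 1 / 2)) - level_theta m \<tau> (- z) (real m / 2 - (real h + 1 / 2)))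
      - geom_coeff m c \<tau> 1 j h * (level_theta m \<tau> z (real m / 2 + (real h + 1 / 2)) - level_theta m \<tau> (- z) (real m / 2 + (real h + 1 / 2))))"
    unfolding geom_contrib_def right_diff_distrib[symmetric] sum_subtractf[symmetric]
    by (simp add: algebra_simps)
  also have "\<dots> = - (\<Sum>h<m * j. odd_term m c \<tau> z j h)"
    unfolding T unfolding T' odd_term_def pair_weight_eq[symmetric] sum_distrib_left sum_negf[symmetric]
    by (rule sum.cong) (simp_all add: algebra_simps)
  finally show ?thesis .
qed

text \<open>
  With \<open>m = 2 l + 1\<close> the block \<open>[m r, m r + m)\<close> has centre \<open>m r + l\<close>. The first sum covers the half of the block above
  the centre. The second one covers the half below it, where the odd theta function has index \<open>- k\<close>
  modulo \<open>m\<close>; hence the sign.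
\<close>

lemma block_sums_as_odd_terms:
  assumes m: "m = 2 * l + 1" and j: "j \<ge> 1"
  shows "upper_half_sum m c \<tau> z j = (\<Sum>r<j. \<Sum>k\<in>{0..l}. odd_term m c \<tau> z j (m * r + l + k))"
    and "lower_half_sum m c \<tau> z j = - (\<Sum>r<j. \<Sum>k\<in>{0..l}. odd_term m c \<tau> z j (m * r + l - k))"
proof -
  have l: "(m - 1) div 2 = l" using m by simp
  have rm: "real m = 2 * real l + 1" using m by simp
  show "upper_half_sum m c \<tau> z j = (\<Sum>r<j. \<Sum>k\<in>{0..l}. odd_term m c \<tau> z j (m * r + l + k))"
  proof -
    have "(-1) ^ j * pair_weight m c \<tau> j (real m * real (Suc r) - real m / 2 + real k) * odd_level_theta m \<tau> z (real k) = odd_term m c \<tau> z j (m * r + l + k)" for r k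
    proof -
      have 1: "real (m * r + l + k) + 1 / 2 = real m * real (Suc r) - real m / 2 + real k"
        by (simp add: rm field_simps)
      have 2: "real m / 2 + (real m * real (Suc r) - real m / 2 + real k) = real k + real m * real (Suc r)" by simp
      show ?thesis unfolding odd_term_def 1 2 odd_level_theta_periodic_mult ..
    qed
    moreover have "upper_half_sum m c \<tau> z j = (\<Sum>r<j. \<Sum>k\<in>{0..l}.
       (-1) ^ j * pair_weight m c \<tau> j (real m * real (Suc r) - real m / 2 + real k) * odd_level_theta m \<tau> z (real k))"
      unfolding upper_half_sum_def l by (rule sum.reindex_bij_witness[where i = Suc and j = "\<lambda>r. r - 1"]) auto
    ultimately show ?thesis by simp
  qed
  show "lower_half_sum m c \<tau> z j = - (\<Sum>r<j. \<Sum>k\<in>{0..l}. odd_term m c \<tau> z j (m * r + l - k))"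
  proof -
    have "(-1) ^ j * pair_weight m c \<tau> j (real m * real r + real m / 2 - real k) * odd_level_theta m \<tau> z (real k) = - odd_term m c \<tau> z j (m * r + l - k)" if "k \<le> l" for r k
    proof -
      have 1: "real (m * r + l - k) + 1 / 2 = real m * real r + real m / 2 - real k"
        using that by (simp add: rm field_simps of_nat_diff)
      have 2: "real m / 2 + (real m * real r + real m / 2 - real k) = - real k + real m * real (Suc r)"
        by (simp add: algebra_simps)
      show ?thesis unfolding odd_term_def 1 2 odd_level_theta_periodic_mult odd_level_theta_minus by simp
    qed
    moreover have "{0..j - 1} = {..<j}" using j by auto
    ultimately show ?thesis unfolding lower_half_sum_def l by (simp add: sum_negf[symmetric])
  qed
qed

text \<open>
  The centre of each block is counted in both sums, but the odd theta function of index divisible by \<open>m\<close> is zero.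
\<close>

lemma odd_term_block_sum:
  assumes m: "m = 2 * l + 1" and j: "j \<ge> 1"
  shows "(\<Sum>h<m * j. odd_term m c \<tau> z j h) = upper_half_sum m c \<tau> z j - lower_half_sum m c \<tau> z j"
proof -
  have l0: "odd_term m c \<tau> z j (m * r + l) = 0" for r
  proof -
    have "real m / 2 + (real (m * r + l) + 1 / 2) = 0 + real m * real (Suc r)"
      using m by (simp add: field_simps)
    then have "odd_level_theta m \<tau> z (real m / 2 + (real (m * r + l) + 1 / 2)) = odd_level_theta m \<tau> z 0"
      by (simp only: odd_level_theta_periodic_mult)
    then show ?thesis unfolding odd_term_def by (simp add: odd_level_theta_def)
  qed
  have blk: "sum f {m * r..<m * r + m} = (\<Sum>k\<in>{0..l}. f (m * r + l + k)) + (\<Sum>k\<in>{0..l}. f (m * r + l - k)) - f (m * r + l)"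
    for f :: "nat \<Rightarrow> complex" and r
  proof -
    have a: "(\<Sum>k\<in>{0..l}. f (m * r + l + k)) = sum f {m * r + l..m * r + 2 * l}"
      by (rule sum.reindex_bij_witness[where i = "\<lambda>h. h - (m * r + l)" and j = "\<lambda>k. m * r + l + k"]) auto
    have b: "(\<Sum>k\<in>{0..l}. f (m * r + l - k)) = sum f {m * r..m * r + l}"
      by (rule sum.reindex_bij_witness[where i = "\<lambda>h. m * r + l - h" and j = "\<lambda>k. m * r + l - k"]) auto
    have "{m * r..<m * r + m} = {m * r..m * r + l} \<union> {Suc (m * r + l)..m * r + 2 * l}" using m by auto
    then have "sum f {m * r..<m * r + m} = sum f {m * r..m * r + l} + sum f {Suc (m * r + l)..m * r + 2 * l}"
      by (simp add: sum.union_disjoint)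
    moreover have "sum f {m * r + l..m * r + 2 * l} = f (m * r + l) + sum f {Suc (m * r + l)..m * r + 2 * l}"
      by (rule sum.atLeast_Suc_atMost) simp
    ultimately show ?thesis unfolding a b by simp
  qed
  have "(\<Sum>h<m * j. odd_term m c \<tau> z j h) = (\<Sum>r<j. sum (odd_term m c \<tau> z j) {m * r..<m * r + m})"
    using sum.nat_group[of "odd_term m c \<tau> z j" m j] by (simp add: mult.commute)
  also have "\<dots> = upper_half_sum m c \<tau> z j - lower_half_sum m c \<tau> z j"
    unfolding blk l0 block_sums_as_odd_terms[OF m j] by (simp add: sum.distrib)
  finally show ?thesis .
qed

lemma norm_odd_level_theta_bounded:
  assumes "Im \<tau> > 0" "m > 0"
  obtains T where "T \<ge> 0" "\<And>n. norm (odd_level_theta m \<tau> z (real_of_int n)) \<le> T"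
proof -
  define T where "T = infsum (\<lambda>k::int. norm (cexp z \<tau> (real_of_int k) ((real_of_int k)\<^sup>2 / real m) 0)) UNIV"
  have "norm (level_theta m \<tau> z (real_of_int n)) \<le> T" for n
  proof -
    have "norm (level_theta m \<tau> z (real_of_int n)) \<le> infsum (\<lambda>s. norm (level_theta_term m \<tau> z (real_of_int n) s)) UNIV"
      unfolding level_theta_def level_theta_term_def by (rule norm_infsum_bound[OF level_theta_abs_summable[OF assms]])
    also have "\<dots> \<le> T" unfolding T_def by (rule level_theta_term_norm_sum_le[OF assms])
    finally show ?thesis .
  qed
  note b = this
  have "norm (odd_level_theta m \<tau> z (real_of_int n)) \<le> 2 * T" for n
    unfolding odd_level_theta_def using norm_triangle_ineq4[of "level_theta m \<tau> z (real_of_int n)" "level_theta m \<tau> z (- real_of_int n)"] b[of n] b[of "- n"]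
    by simp
  moreover have "0 \<le> 2 * T" by (simp add: T_def infsum_nonneg)
  ultimately show ?thesis using that by blast
qed

text \<open>Needed because the difference of the two series is a single series only if both converge.\<close>

lemma block_sums_summable:
  assumes \<tau>: "Im \<tau> > 0" and m: "m = 2 * l + 1"
  shows "upper_half_sum m c \<tau> z summable_on {1..}" "lower_half_sum m c \<tau> z summable_on {1..}"
proof -
  have m0: "m > 0" using m by simp
  define \<alpha> where "\<alpha> = 2 * pi * Im \<tau>"
  define b where "b j = exp (- \<alpha> * ((real j)\<^sup>2 - real m * real j))" for j :: nat
  obtain T where T: "T \<ge> 0" "\<And>n. norm (odd_level_theta m \<tau> z (real_of_int n)) \<le> T" using norm_odd_level_theta_bounded[OF \<tau> m0] by blast
  have w: "norm (odd_term m c \<tau> z j h) \<le> 2 * b j * T" if "h < m * j" for j h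
  proof -
    have "norm (geom_coeff m c \<tau> 1 j h) \<le> b j" "norm (geom_coeff m c \<tau> (-1) j h) \<le> b j"
      using norm_geom_coeff_le[OF \<tau> m0 _ that, of 1 c] norm_geom_coeff_le[OF \<tau> m0 _ that, of "-1" c] by (simp_all add: b_def \<alpha>_def)
    then have "norm (pair_weight m c \<tau> j (real h + 1 / 2)) \<le> 2 * b j"
      unfolding pair_weight_eq[symmetric] using norm_triangle_ineq[of "geom_coeff m c \<tau> (-1) j h" "geom_coeff m c \<tau> 1 j h"] by linarith
    moreover have "real m / 2 + (real h + 1 / 2) = real_of_int (int l + 1 + int h)" using m by (simp add: field_simps)
    then have "norm (odd_level_theta m \<tau> z (real m / 2 + (real h + 1 / 2))) \<le> T" using T(2) by metis
    ultimately show ?thesis unfolding odd_term_def norm_mult norm_power using T(1)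
      by (simp add: mult_mono b_def)
  qed
  define g where "g j = real m * real j * b j * (2 * T)" for j :: nat
  have gs: "g summable_on {1..}"
  proof -
    have "(\<lambda>i::int. real m * real_of_int \<bar>i\<bar> * exp (- \<alpha> * ((real_of_int i)\<^sup>2 - real m * real_of_int \<bar>i\<bar>)) * (2 * T)) summable_on int ` {1..}"
      by (rule summable_on_subset_banach[OF summable_on_cmult_left[OF gaussian_weight_summable]]) (use \<tau> in \<open>auto simp: \<alpha>_def\<close>)
    then show ?thesis by (subst (asm) summable_on_reindex) (auto simp: o_def g_def[abs_def] b_def)
  qed
  have cnt: "real (j * (l + 1)) * (2 * b j * T) \<le> g j" for j
  proof -
    have "real (j * (l + 1)) \<le> real m * real j" using m by (simp add: algebra_simps)
    then have "real (j * (l + 1)) * (2 * b j * T) \<le> real m * real j * (2 * b j * T)"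
      using T(1) by (intro mult_right_mono) (auto simp: b_def)
    then show ?thesis by (simp add: g_def mult_ac)
  qed
  have bound: "norm (\<Sum>r<j. \<Sum>k\<in>{0..l}. odd_term m c \<tau> z j (f r k)) \<le> g j"
    if "\<And>r k. r < j \<Longrightarrow> k \<le> l \<Longrightarrow> f r k < m * j" for j f
  proof -
    have "norm (\<Sum>r<j. \<Sum>k\<in>{0..l}. odd_term m c \<tau> z j (f r k)) \<le> (\<Sum>r<j. \<Sum>k\<in>{0..l}. 2 * b j * T)"
      by (intro sum_norm_le) (use w that in auto)
    also have "\<dots> = real (j * (l + 1)) * (2 * b j * T)" by (simp add: algebra_simps)
    finally show ?thesis using cnt[of j] by linarith
  qed
  have idx: "m * r + l + k < m * j" "m * r + l - k < m * j" if "r < j" "k \<le> l" for r j k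
  proof -
    have "m * r + m \<le> m * j" using that(1) by (metis Suc_leI mult_Suc_right mult_le_mono2 add.commute)
    then show "m * r + l + k < m * j" "m * r + l - k < m * j" using m that(2) by linarith+
  qed
  have f: "norm (upper_half_sum m c \<tau> z j) \<le> g j" if "j \<in> {1..}" for j
    using that block_sums_as_odd_terms(1)[OF m, of j c \<tau> z] bound[of j "\<lambda>r k. m * r + l + k"] idx by simp
  have s: "norm (lower_half_sum m c \<tau> z j) \<le> g j" if "j \<in> {1..}" for j
    using that block_sums_as_odd_terms(2)[OF m, of j c \<tau> z] bound[of j "\<lambda>r k. m * r + l - k"] idx by simp
  show "upper_half_sum m c \<tau> z summable_on {1..}"
    by (rule abs_summable_summable, rule summable_on_comparison_test[OF gs]) (use f in auto)
  show "lower_half_sum m c \<tau> z summable_on {1..}"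
    by (rule abs_summable_summable, rule summable_on_comparison_test[OF gs]) (use s in auto)
qed

section \<open>The formula for the antisymmetrised Appell sum\<close>

definition pole_difference :: "nat \<Rightarrow> int \<Rightarrow> complex \<Rightarrow> complex \<Rightarrow> complex" where
  "pole_difference m c \<tau> z = twisted_theta c (real m + 1 / 2) (real m + 1) \<tau> z / twisted_theta c (- (1 / 2)) 1 \<tau> z
     - twisted_theta c (- real m - 1 / 2) (real m + 1) \<tau> z / twisted_theta c (1 / 2) 1 \<tau> z"

text \<open>
  The constant \<open>(Q; Q)^3\<close> of the partial fractions is \<open>\<eta>(2 \<tau>)^3\<close> up to the power \<open>q^(1/4)\<close>.
\<close>

lemma pole_part_eq:
  "qprod ((nome \<tau>)\<^sup>2) (nome \<tau>) ^ 3 / jtheta (ypow c \<tau> z 1 0) (nome \<tau>) * pole_numerator m c \<tau> z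
   = cexp 0 \<tau> 0 (1 / 16 - 1 / (16 * (real m + 1))) (real_of_int c / 4) * dedekind_eta (2 * \<tau>) ^ 3
      * (twisted_theta c (real m + 1 / 2) (real m + 1) \<tau> z / twisted_theta c (- (1 / 2)) 1 \<tau> z)"
proof -
  have e: "cexp z \<tau> (1 / 4) (1 / 4 - 1 / (16 * (real m + 1))) (real_of_int c / 4)
      = cexp z \<tau> 0 (1 / 16 - 1 / (16 * (real m + 1))) (real_of_int c / 4) * cexp z \<tau> 0 (1 / 4) 0 * cexp z \<tau> (1 / 4) (- 1 / 16) 0"
    unfolding cexp_mult by (rule cexp_cong) simp_all
  have eta: "dedekind_eta (2 * \<tau>) ^ 3 = cexp z \<tau> 0 (1 / 4) 0 * qprod ((nome \<tau>)\<^sup>2) (nome \<tau>) ^ 3"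
    unfolding dedekind_eta_double power_mult_distrib cexp_power cexp_z_irrelevant[of 0 \<tau> _ _ z] by simp
  show ?thesis
    unfolding eta jtheta_eq_twisted_theta pole_numerator_eq_twisted_theta e cexp_z_irrelevant[of 0 \<tau> _ _ z] by simp
qed

lemma sixteenth_identities:
  fixes x :: real assumes "x \<ge> 0"
  shows "x / (16 * (x + 1)) + x\<^sup>2 / (16 * (x + 1)) = x / 16"
    and "x\<^sup>2 / (16 * (x + 1)) = x / 16 - 1 / 16 + 1 / (16 * (x + 1))"
proof -
  have x: "x + 1 \<noteq> 0" using assms by simp
  have a: "x + x\<^sup>2 = x * (x + 1)" and b: "x\<^sup>2 = (x - 1) * (x + 1) + 1"
    by (simp_all add: power2_eq_square algebra_simps)
  have g: "u * N / (16 * N) = u / 16" if "N \<noteq> 0" for u N :: real using that by simp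
  show "x / (16 * (x + 1)) + x\<^sup>2 / (16 * (x + 1)) = x / 16"
    unfolding add_divide_distrib[symmetric] a by (rule g[OF x])
  have "x\<^sup>2 / (16 * (x + 1)) = (x - 1) * (x + 1) / (16 * (x + 1)) + 1 / (16 * (x + 1))"
    unfolding add_divide_distrib[symmetric] b[symmetric] ..
  also have "(x - 1) * (x + 1) / (16 * (x + 1)) = x / 16 - 1 / 16"
    unfolding g[OF x] by (rule diff_divide_distrib)
  finally show "x\<^sup>2 / (16 * (x + 1)) = x / 16 - 1 / 16 + 1 / (16 * (x + 1))" .
qed

theorem appell_difference_formula:
  assumes \<tau>: "Im \<tau> > 0" and m: "m = 2 * l + 1"
    and nz: "\<And>j. ypow c \<tau> z 1 j \<noteq> 1" and nz': "\<And>j. ypow c \<tau> (- z) 1 j \<noteq> 1"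
  shows "cexp 0 \<tau> 0 (- (real m / 16)) 0 * (appell m c \<tau> z 1 - appell m c \<tau> (- z) 1)
   = cexp 0 \<tau> 0 0 (real_of_int c * (real m + 1) / 4) * dedekind_eta (2 * \<tau>) ^ 3
       * (1 / twisted_theta c (real m / 2) (real m + 1) \<tau> 0) * pole_difference m c \<tau> z
     - cexp 0 \<tau> 0 (- (real m / (16 * (real m + 1)))) (real_of_int c * real m / 4)
       * (1 / twisted_theta c (real m / 2) (real m + 1) \<tau> 0)
       * ((\<Sum>\<^sub>\<infinity>j\<in>{1::nat..}. upper_half_sum m c \<tau> z j) - (\<Sum>\<^sub>\<infinity>j\<in>{1::nat..}. lower_half_sum m c \<tau> z j))
     + (\<Sum>k=1..l. cexp 0 \<tau> 0 (- (1 / (16 * real m)) * (4 * real k - real m)\<^sup>2) (real_of_int c * real k / 2) * odd_level_theta m \<tau> z (real k))"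
proof -
  have m0: "m > 0" using m by simp
  define K where "K = cexp 0 \<tau> 0 0 (real_of_int c * real m / 4)"
  define t where "t = twisted_theta c (real m / 2) (real m + 1) \<tau> 0"
  define p where "p = cexp 0 \<tau> 0 (- ((real m)\<^sup>2 / (16 * (real m + 1)))) 0"
  define E where "E = cexp 0 \<tau> 0 (1 / 16 - 1 / (16 * (real m + 1))) (real_of_int c / 4) * dedekind_eta (2 * \<tau>) ^ 3"
  define S where "S = (\<Sum>\<^sub>\<infinity>j\<in>{1::nat..}. upper_half_sum m c \<tau> z j) - (\<Sum>\<^sub>\<infinity>j\<in>{1::nat..}. lower_half_sum m c \<tau> z j)"
  define q16 where "q16 = cexp 0 \<tau> 0 (- (real m / 16)) 0"
  define C where "C k = cexp 0 \<tau> 0 (real k / 2 - (real k)\<^sup>2 / real m) (real_of_int c * real k / 2)" for k :: nat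
  have t0: "theta_null m c \<tau> = p * t" unfolding p_def t_def by (rule theta_null_eq_twisted_theta[OF m])
  have pt: "p \<noteq> 0" "t \<noteq> 0" using theta_null_nonzero[OF \<tau>, of m c] unfolding t0 by auto
  have D1: "p * t * appell m c \<tau> z (Suc l) = K * (E * (twisted_theta c (real m + 1 / 2) (real m + 1) \<tau> z / twisted_theta c (- (1 / 2)) 1 \<tau> z)
        + (\<Sum>\<^sub>\<infinity>j\<in>{1::nat..}. geom_contrib m c \<tau> z j))"
    using appell_decomposition(1)[OF \<tau> m nz] unfolding pole_part_eq t0 K_def E_def .
  have D2: "p * t * appell m c \<tau> (- z) (Suc l) = K * (E * (twisted_theta c (- real m - 1 / 2) (real m + 1) \<tau> z / twisted_theta c (1 / 2) 1 \<tau> z)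
        + (\<Sum>\<^sub>\<infinity>j\<in>{1::nat..}. geom_contrib m c \<tau> (- z) j))"
  proof -
    have "twisted_theta c (real m + 1 / 2) (real m + 1) \<tau> (- z) = twisted_theta c (- real m - 1 / 2) (real m + 1) \<tau> z"
      using twisted_theta_reflect[of "real m + 1" c "real m + 1 / 2" \<tau> z] by simp
    moreover have "twisted_theta c (- (1 / 2)) 1 \<tau> (- z) = twisted_theta c (1 / 2) 1 \<tau> z"
      using twisted_theta_reflect[of 1 c "- (1 / 2)" \<tau> z] by simp
    ultimately show ?thesis
      using appell_decomposition(1)[OF \<tau> m nz'] unfolding pole_part_eq t0 K_def E_def by simp
  qed
  have geom_contrib: "(\<Sum>\<^sub>\<infinity>j\<in>{1::nat..}. geom_contrib m c \<tau> z j) - (\<Sum>\<^sub>\<infinity>j\<in>{1::nat..}. geom_contrib m c \<tau> (- z) j) = - S"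
  proof -
    have "(geom_contrib m c \<tau> z has_sum infsum (geom_contrib m c \<tau> z) {1..}) {1..}"
      by (rule has_sum_infsum[OF appell_decomposition(2)[OF \<tau> m nz]])
    moreover have "(geom_contrib m c \<tau> (- z) has_sum infsum (geom_contrib m c \<tau> (- z)) {1..}) {1..}"
      by (rule has_sum_infsum[OF appell_decomposition(2)[OF \<tau> m nz']])
    ultimately have 1: "((\<lambda>j. geom_contrib m c \<tau> z j - geom_contrib m c \<tau> (- z) j) has_sum
       (infsum (geom_contrib m c \<tau> z) {1..} - infsum (geom_contrib m c \<tau> (- z)) {1..})) {1..}"
      by (rule has_sum_minus_diff)
    have "((\<lambda>j. upper_half_sum m c \<tau> z j - lower_half_sum m c \<tau> z j) has_sum S) {1..}"
      unfolding S_def by (intro has_sum_minus_diff has_sum_infsum block_sums_summable[OF \<tau> m])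
    then have "((\<lambda>j. (-1) * (upper_half_sum m c \<tau> z j - lower_half_sum m c \<tau> z j)) has_sum ((-1) * S)) {1..}"
      by (rule has_sum_cmult_right)
    moreover have "geom_contrib m c \<tau> z j - geom_contrib m c \<tau> (- z) j = (-1) * (upper_half_sum m c \<tau> z j - lower_half_sum m c \<tau> z j)" if "j \<in> {1..}" for j
      unfolding geom_contrib_antisym using that odd_term_block_sum[OF m, of j c \<tau> z] by simp
    ultimately have "((\<lambda>j. geom_contrib m c \<tau> z j - geom_contrib m c \<tau> (- z) j) has_sum ((-1) * S)) {1..}"
      using has_sum_cong by (metis (no_types, lifting))
    from has_sum_unique[OF 1 this] show ?thesis by simp
  qed
  have "p * t * (appell m c \<tau> z (Suc l) - appell m c \<tau> (- z) (Suc l)) = K * (E * pole_difference m c \<tau> z +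
     ((\<Sum>\<^sub>\<infinity>j\<in>{1::nat..}. geom_contrib m c \<tau> z j) - (\<Sum>\<^sub>\<infinity>j\<in>{1::nat..}. geom_contrib m c \<tau> (- z) j)))"
    unfolding right_diff_distrib D1 D2 pole_difference_def by (simp add: algebra_simps)
  then have "appell m c \<tau> z (Suc l) - appell m c \<tau> (- z) (Suc l) = K * (E * pole_difference m c \<tau> z - S) / (p * t)"
    unfolding geom_contrib using pt by (simp add: field_simps)
  moreover have "appell m c \<tau> z 1 - appell m c \<tau> (- z) 1
    = (appell m c \<tau> z (Suc l) - appell m c \<tau> (- z) (Suc l)) + (\<Sum>k=1..l. C k * odd_level_theta m \<tau> z (real k))"
  proof -
    have "(\<Sum>k=1..l. C k * odd_level_theta m \<tau> z (real k)) = (\<Sum>k=1..l. C k * level_theta m \<tau> z (real k)) - (\<Sum>k=1..l. C k * level_theta m \<tau> (- z) (real k))"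
      unfolding odd_level_theta_def level_theta_reflect right_diff_distrib sum_subtractf ..
    then show ?thesis
      using appell_shift[OF \<tau> m0 nz, of l] appell_shift[OF \<tau> m0 nz', of l] unfolding C_def cexp_z_irrelevant[of z \<tau> _ _ 0] cexp_z_irrelevant[of "- z" \<tau> _ _ 0]
      by simp
  qed
  ultimately have "q16 * (appell m c \<tau> z 1 - appell m c \<tau> (- z) 1)
    = (q16 * K * E / p) * (1 / t) * pole_difference m c \<tau> z - (q16 * K / p) * (1 / t) * S + (\<Sum>k=1..l. q16 * C k * odd_level_theta m \<tau> z (real k))"
    by (simp add: distrib_left sum_distrib_left mult.assoc) (simp add: right_diff_distrib diff_divide_distrib mult_ac)
  moreover have "q16 * K / p = cexp 0 \<tau> 0 (- (real m / (16 * (real m + 1)))) (real_of_int c * real m / 4)"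
  proof -
    have "q16 * K = cexp 0 \<tau> 0 (- (real m / (16 * (real m + 1)))) (real_of_int c * real m / 4) * p"
      unfolding q16_def K_def p_def cexp_mult
      by (rule cexp_cong) (use sixteenth_identities(1)[of "real m"] in simp_all)
    then show ?thesis using pt by simp
  qed
  moreover have "q16 * K * E / p = cexp 0 \<tau> 0 0 (real_of_int c * (real m + 1) / 4) * dedekind_eta (2 * \<tau>) ^ 3"
  proof -
    have "q16 * K * cexp 0 \<tau> 0 (1 / 16 - 1 / (16 * (real m + 1))) (real_of_int c / 4) = cexp 0 \<tau> 0 0 (real_of_int c * (real m + 1) / 4) * p"
      unfolding q16_def K_def p_def cexp_mult
      by (rule cexp_cong, simp, use sixteenth_identities(2)[of "real m"] in simp, simp add: field_simps)
    then have "q16 * K * E = cexp 0 \<tau> 0 0 (real_of_int c * (real m + 1) / 4) * dedekind_eta (2 * \<tau>) ^ 3 * p"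
      unfolding E_def by (simp only: mult.assoc[symmetric]) (simp only: mult_ac)
    then show ?thesis using pt by simp
  qed
  moreover have "q16 * C k = cexp 0 \<tau> 0 (- (1 / (16 * real m)) * (4 * real k - real m)\<^sup>2) (real_of_int c * real k / 2)" for k
    unfolding q16_def C_def cexp_mult by (rule cexp_cong) (use m0 in \<open>simp_all add: field_simps power2_eq_square\<close>)
  ultimately show ?thesis unfolding q16_def[symmetric] t_def[symmetric] S_def[symmetric] by simp
qed

lemma sum_over_even:
  assumes "odd m"
  shows "(\<Sum>k \<in> {k \<in> {0..m - 1}. even k}. f k) = (\<Sum>k \<in> {0..(m - 1) div 2}. f (2 * k :: nat))"
  by (rule sum.reindex_bij_witness[where i = "\<lambda>k. 2 * k" and j = "\<lambda>k. k div 2"]) (use assms in \<open>auto elim!: evenE\<close>)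

section \<open>The formula in terms of the original sums\<close>

definition phase :: "int \<Rightarrow> real \<Rightarrow> complex" where
  "phase c x = cexp 0 0 0 0 (real_of_int c * x / 4)"

lemma pair_weight_phase:
  assumes "m > 0" "x = 2 * e" "y = 2 * (real m * real j - e) \<or> y = 2 * (e - real m * real j)"
  shows "qpow \<tau> ((real m + 1) * (real j)\<^sup>2 - 1 / (4 * real m) * y\<^sup>2)
     * (phase c x * qpow \<tau> (- (1 / 4) * x) + phase c (- x) * qpow \<tau> (1 / 4 * x)) = pair_weight m c \<tau> j e"
proof -
  have "y\<^sup>2 = 4 * (e - real m * real j)\<^sup>2"
    using assms(3) by (elim disjE) (simp_all only: power2_eq_square, simp_all add: algebra_simps)
  then have y: "1 / (4 * real m) * y\<^sup>2 = (e - real m * real j)\<^sup>2 / real m" by simp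
  have ph: "phase c x = cexp 0 \<tau> 0 0 (real_of_int c * x / 4)" for x by (simp add: phase_def cexp_def)
  show ?thesis
    unfolding y pair_weight_def ph qpow_cexp[of \<tau> _ 0] cexp_mult assms(2) by (simp add: mult.commute)
qed

text \<open>The even index of the statement is \<open>2 k\<close>, for which \<open>theta_odd\<close> of level \<open>m\<close> is the odd combination of \<open>T k\<close>.\<close>

lemma inner_sums_eq:
  assumes m: "odd m" and j: "j \<ge> 1"
  shows "(\<Sum>r = 1..j. \<Sum>k \<in> {k \<in> {0..m - 1}. even k}. (- 1) ^ j
        * qpow \<tau> ((real m + 1) * (real j)\<^sup>2 - 1 / (4 * real m) * (2 * real m * (real j - real r) + real m - real k)\<^sup>2)
        * (phase c (2 * real m * real r - real m + real k) * qpow \<tau> (- (1 / 4) * (2 * real m * real r - real m + real k))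
           + phase c (- (2 * real m * real r - real m + real k)) * qpow \<tau> (1 / 4 * (2 * real m * real r - real m + real k)))
        * theta_odd (real k) (real m) \<tau> z) = upper_half_sum m c \<tau> z j" (is ?F)
    and "(\<Sum>r = 0..j - 1. \<Sum>k \<in> {k \<in> {0..m - 1}. even k}. (- 1) ^ j
        * qpow \<tau> ((real m + 1) * (real j)\<^sup>2 - 1 / (4 * real m) * (2 * real m * (real j - real r) - real m + real k)\<^sup>2)
        * (phase c (2 * real m * real r + real m - real k) * qpow \<tau> (- (1 / 4) * (2 * real m * real r + real m - real k))
           + phase c (- (2 * real m * real r + real m - real k)) * qpow \<tau> (1 / 4 * (2 * real m * real r + real m - real k)))
        * theta_odd (real k) (real m) \<tau> z) = lower_half_sum m c \<tau> z j" (is ?S)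
proof -
  have m0: "m > 0" using m by (auto intro: Nat.gr0I)
  show ?F unfolding upper_half_sum_def sum_over_even[OF m]
  proof (intro sum.cong refl)
    fix r k
    show "(- 1) ^ j
        * qpow \<tau> ((real m + 1) * (real j)\<^sup>2 - 1 / (4 * real m) * (2 * real m * (real j - real r) + real m - real (2 * k))\<^sup>2)
        * (phase c (2 * real m * real r - real m + real (2 * k)) * qpow \<tau> (- (1 / 4) * (2 * real m * real r - real m + real (2 * k)))
           + phase c (- (2 * real m * real r - real m + real (2 * k))) * qpow \<tau> (1 / 4 * (2 * real m * real r - real m + real (2 * k))))
        * theta_odd (real (2 * k)) (real m) \<tau> z
      = (-1) ^ j * pair_weight m c \<tau> j (real m * real r - real m / 2 + real k) * odd_level_theta m \<tau> z (real k)"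
      unfolding theta_odd_eq_odd_level_theta(1)[OF m0]
      by (subst pair_weight_phase[OF m0, of "2 * real m * real r - real m + real (2 * k)" "real m * real r - real m / 2 + real k" "2 * real m * (real j - real r) + real m - real (2 * k)" j \<tau> c, symmetric])
         (simp_all only: mult.assoc, simp_all add: algebra_simps)
  qed
  show ?S unfolding lower_half_sum_def sum_over_even[OF m]
  proof (intro sum.cong refl)
    fix r k
    show "(- 1) ^ j
        * qpow \<tau> ((real m + 1) * (real j)\<^sup>2 - 1 / (4 * real m) * (2 * real m * (real j - real r) - real m + real (2 * k))\<^sup>2)
        * (phase c (2 * real m * real r + real m - real (2 * k)) * qpow \<tau> (- (1 / 4) * (2 * real m * real r + real m - real (2 * k)))
           + phase c (- (2 * real m * real r + real m - real (2 * k))) * qpow \<tau> (1 / 4 * (2 * real m * real r + real m - real (2 * k))))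
        * theta_odd (real (2 * k)) (real m) \<tau> z
      = (-1) ^ j * pair_weight m c \<tau> j (real m * real r + real m / 2 - real k) * odd_level_theta m \<tau> z (real k)"
      unfolding theta_odd_eq_odd_level_theta(1)[OF m0]
      by (subst pair_weight_phase[OF m0, of "2 * real m * real r + real m - real (2 * k)" "real m * real r + real m / 2 - real k" "2 * real m * (real j - real r) - real m + real (2 * k)" j \<tau> c, symmetric])
         (simp_all only: mult.assoc, simp_all add: algebra_simps)
  qed
qed

lemma phase_0: "phase 0 x = 1"
  by (simp add: phase_def)

lemma phase_minus_one:
  "exp (- (of_real pi * \<i> / 2) * of_real x) = phase (-1) x"
  "exp (of_real pi * \<i> / 2 * of_real x) = phase (-1) (- x)"
  by (simp_all add: phase_def cexp_def field_simps)


lemma triple_sums_eq: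
  assumes m: "odd m"
  shows "(\<Sum>\<^sub>\<infinity>j\<in>{1::nat..}. \<Sum>r = 1..j. \<Sum>k \<in> {k \<in> {0..m - 1}. even k}. (- 1) ^ j
        * qpow \<tau> ((real m + 1) * (real j)\<^sup>2 - 1 / (4 * real m) * (2 * real m * (real j - real r) + real m - real k)\<^sup>2)
        * (phase c (2 * real m * real r - real m + real k) * qpow \<tau> (- (1 / 4) * (2 * real m * real r - real m + real k))
           + phase c (- (2 * real m * real r - real m + real k)) * qpow \<tau> (1 / 4 * (2 * real m * real r - real m + real k)))
        * theta_odd (real k) (real m) \<tau> z) = (\<Sum>\<^sub>\<infinity>j\<in>{1::nat..}. upper_half_sum m c \<tau> z j)"
    and "(\<Sum>\<^sub>\<infinity>j\<in>{1::nat..}. \<Sum>r = 0..j - 1. \<Sum>k \<in> {k \<in> {0..m - 1}. even k}. (- 1) ^ j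
        * qpow \<tau> ((real m + 1) * (real j)\<^sup>2 - 1 / (4 * real m) * (2 * real m * (real j - real r) - real m + real k)\<^sup>2)
        * (phase c (2 * real m * real r + real m - real k) * qpow \<tau> (- (1 / 4) * (2 * real m * real r + real m - real k))
           + phase c (- (2 * real m * real r + real m - real k)) * qpow \<tau> (1 / 4 * (2 * real m * real r + real m - real k)))
        * theta_odd (real k) (real m) \<tau> z) = (\<Sum>\<^sub>\<infinity>j\<in>{1::nat..}. lower_half_sum m c \<tau> z j)"
  by (rule infsum_cong, rule inner_sums_eq[OF m], simp)+

text \<open>
  The bookkeeping that distributes \<open>1 / R\<close> over the three parts, once for each of the two shapes of \<open>R\<close>: here
  \<open>d\<close>, \<open>e\<close>, \<open>f\<close> are \<open>\<eta>(\<tau>/2)\<close>, \<open>\<eta>(2 \<tau>)\<close>, \<open>\<eta>(\<tau>)^3\<close>, and \<open>P\<close> is the quotient of Mumford's theta functions.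
\<close>

lemma clear_superdenominator:
  fixes X :: complex
  assumes "X = A * e ^ 3 * (1 / t) * D - B * (1 / t) * S + L"
  shows "e \<noteq> 0 \<Longrightarrow> X * (1 / (d * e)) * P = A * (e ^ 2 / d) * P * (1 / t) * D - B * (1 / (d * e)) * P * (1 / t) * S + 1 / (d * e) * P * L"
    and "A = 1 \<Longrightarrow> X * (d / f) * P = d * e ^ 3 / f * P * (1 / t) * D - B * (d / f) * P * (1 / t) * S + d / f * P * (L :: complex)"
proof -
  assume "e \<noteq> 0"
  then have "e ^ 3 * (1 / (d * e)) = e ^ 2 / d" by (simp add: power3_eq_cube power2_eq_square)
  then show "X * (1 / (d * e)) * P = A * (e ^ 2 / d) * P * (1 / t) * D - B * (1 / (d * e)) * P * (1 / t) * S + 1 / (d * e) * P * L"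
    unfolding assms by (simp add: algebra_simps)
next
  assume "A = 1"
  then show "X * (d / f) * P = d * e ^ 3 / f * P * (1 / t) * D - B * (d / f) * P * (1 / t) * S + d / f * P * L"
    unfolding assms by (simp add: algebra_simps add_divide_distrib diff_divide_distrib)
qed

lemma single_sum_eq:
  assumes "m > 0" "c = -1 \<or> c = 0"
  shows "(\<Sum>k=1..l. (if c = 0 then 1 else (- 1) ^ k) * qpow \<tau> (- (1 / (16 * real m)) * (4 * real k - real m)\<^sup>2)
        * theta_odd (real k) (real m / 2) (2 * \<tau>) (2 * z))
    = (\<Sum>k=1..l. cexp 0 \<tau> 0 (- (1 / (16 * real m)) * (4 * real k - real m)\<^sup>2) (real_of_int c * real k / 2) * odd_level_theta m \<tau> z (real k))"
proof (rule sum.cong[OF refl])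
  fix k
  have "(if c = 0 then 1 else (- 1) ^ k) = cexp 0 \<tau> 0 0 (real_of_int c * real k / 2)"
    using assms(2) minus_one_powi_cexp[of "- int k" 0 \<tau>] by (auto simp: power_int_minus simp flip: power_inverse)
  then show "(if c = 0 then 1 else (- 1) ^ k) * qpow \<tau> (- (1 / (16 * real m)) * (4 * real k - real m)\<^sup>2)
        * theta_odd (real k) (real m / 2) (2 * \<tau>) (2 * z)
    = cexp 0 \<tau> 0 (- (1 / (16 * real m)) * (4 * real k - real m)\<^sup>2) (real_of_int c * real k / 2) * odd_level_theta m \<tau> z (real k)"
    unfolding theta_odd_eq_odd_level_theta(2)[OF assms(1)] qpow_cexp[of \<tau> _ 0] by (simp add: cexp_mult)
qed

lemma regular_ypow:
  assumes "mumford_theta 0 b \<tau> z \<noteq> 0" "int b = c + 1"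
  shows "ypow c \<tau> z 1 j \<noteq> 1" "ypow c \<tau> (- z) 1 j \<noteq> 1"
  using assms mumford_theta_0_zero[OF _ assms(2)] mumford_theta_0_even by metis+

text \<open>
  Both parts divide the formula for \<open>F z - F (- z)\<close> by the denominator \<open>R\<close>, which is nonzero at regular
  points. What is left is to recognise the constants: for \<open>c = -1\<close> the phase \<open>exp (\<pi> \<i> c (m + 1) / 2)\<close> of the
  theta quotient is \<open>- \<i> exp (- \<pi> \<i> m / 2)\<close>.
\<close>

theorem proposition4p2:
  fixes m :: nat
    and ch_plus ch_minus :: "complex \<Rightarrow> complex \<Rightarrow> complex"
  assumes "odd m"
    and "is_N3_character m 1 ch_plus"
    and "is_N3_supercharacter m 1 ch_minus"
  shows "(\<forall>\<tau> z. N3_regular_plus \<tau> z \<longrightarrow>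
      ch_plus \<tau> z =
        - \<i> * exp (- (of_real pi * \<i> * of_nat m / 2))
          * (dedekind_eta (2 * \<tau>) ^ 2 / dedekind_eta (\<tau> / 2))
          * (mumford_theta 0 0 \<tau> z / mumford_theta 1 1 \<tau> z)
          * (1 / theta (real m / 2) (real m + 1) \<tau> 0)
          * (theta (real m + 1 / 2) (real m + 1) \<tau> z / theta (- (1 / 2)) 1 \<tau> z
             - theta (- real m - 1 / 2) (real m + 1) \<tau> z / theta (1 / 2) 1 \<tau> z)
        - qpow \<tau> (- (real m / (16 * (real m + 1)))) * exp (- (of_real pi * \<i> * of_nat m / 2))
          * (1 / (dedekind_eta (\<tau> / 2) * dedekind_eta (2 * \<tau>)))
          * (mumford_theta 0 0 \<tau> z / mumford_theta 1 1 \<tau> z)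
          * (1 / theta (real m / 2) (real m + 1) \<tau> 0)
          * ((\<Sum>\<^sub>\<infinity>j\<in>{1::nat..}. \<Sum>r = 1..j. \<Sum>k \<in> {k \<in> {0..m - 1}. even k}.
                (- 1) ^ j
                * qpow \<tau> ((real m + 1) * (real j)\<^sup>2
                    - 1 / (4 * real m) * (2 * real m * (real j - real r) + real m - real k)\<^sup>2)
                * (exp (- (of_real pi * \<i> / 2) * of_real (2 * real m * real r - real m + real k))
                     * qpow \<tau> (- (1 / 4) * (2 * real m * real r - real m + real k))
                   + exp (of_real pi * \<i> / 2 * of_real (2 * real m * real r - real m + real k))
                     * qpow \<tau> (1 / 4 * (2 * real m * real r - real m + real k)))
                * theta_odd (real k) (real m) \<tau> z)
             - (\<Sum>\<^sub>\<infinity>j\<in>{1::nat..}. \<Sum>r = 0..j - 1. \<Sum>k \<in> {k \<in> {0..m - 1}. even k}.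
                (- 1) ^ j
                * qpow \<tau> ((real m + 1) * (real j)\<^sup>2
                    - 1 / (4 * real m) * (2 * real m * (real j - real r) - real m + real k)\<^sup>2)
                * (exp (- (of_real pi * \<i> / 2) * of_real (2 * real m * real r + real m - real k))
                     * qpow \<tau> (- (1 / 4) * (2 * real m * real r + real m - real k))
                   + exp (of_real pi * \<i> / 2 * of_real (2 * real m * real r + real m - real k))
                     * qpow \<tau> (1 / 4 * (2 * real m * real r + real m - real k)))
                * theta_odd (real k) (real m) \<tau> z))
        + 1 / (dedekind_eta (\<tau> / 2) * dedekind_eta (2 * \<tau>))
          * (mumford_theta 0 0 \<tau> z / mumford_theta 1 1 \<tau> z)
          * (\<Sum>k = 1..(m - 1) div 2. (- 1) ^ k
                * qpow \<tau> (- (1 / (16 * real m)) * (4 * real k - real m)\<^sup>2)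
                * theta_odd (real k) (real m / 2) (2 * \<tau>) (2 * z)))
    \<and> (\<forall>\<tau> z. N3_regular_minus \<tau> z \<longrightarrow>
      ch_minus \<tau> z =
        dedekind_eta (\<tau> / 2) * dedekind_eta (2 * \<tau>) ^ 3 / dedekind_eta \<tau> ^ 3
          * (mumford_theta 0 1 \<tau> z / mumford_theta 1 1 \<tau> z)
          * (1 / theta_minus (real m / 2) (real m + 1) \<tau> 0)
          * (theta_minus (real m + 1 / 2) (real m + 1) \<tau> z / theta_minus (- (1 / 2)) 1 \<tau> z
             - theta_minus (- real m - 1 / 2) (real m + 1) \<tau> z / theta_minus (1 / 2) 1 \<tau> z)
        - qpow \<tau> (- (real m / (16 * (real m + 1))))
          * (dedekind_eta (\<tau> / 2) / dedekind_eta \<tau> ^ 3)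
          * (mumford_theta 0 1 \<tau> z / mumford_theta 1 1 \<tau> z)
          * (1 / theta_minus (real m / 2) (real m + 1) \<tau> 0)
          * ((\<Sum>\<^sub>\<infinity>j\<in>{1::nat..}. \<Sum>r = 1..j. \<Sum>k \<in> {k \<in> {0..m - 1}. even k}.
                (- 1) ^ j
                * qpow \<tau> ((real m + 1) * (real j)\<^sup>2
                    - 1 / (4 * real m) * (2 * real m * (real j - real r) + real m - real k)\<^sup>2)
                * (qpow \<tau> (- (1 / 4) * (2 * real m * real r - real m + real k))
                   + qpow \<tau> (1 / 4 * (2 * real m * real r - real m + real k)))
                * theta_odd (real k) (real m) \<tau> z)
             - (\<Sum>\<^sub>\<infinity>j\<in>{1::nat..}. \<Sum>r = 0..j - 1. \<Sum>k \<in> {k \<in> {0..m - 1}. even k}.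
                (- 1) ^ j
                * qpow \<tau> ((real m + 1) * (real j)\<^sup>2
                    - 1 / (4 * real m) * (2 * real m * (real j - real r) - real m + real k)\<^sup>2)
                * (qpow \<tau> (- (1 / 4) * (2 * real m * real r + real m - real k))
                   + qpow \<tau> (1 / 4 * (2 * real m * real r + real m - real k)))
                * theta_odd (real k) (real m) \<tau> z))
        + dedekind_eta (\<tau> / 2) / dedekind_eta \<tau> ^ 3
          * (mumford_theta 0 1 \<tau> z / mumford_theta 1 1 \<tau> z)
          * (\<Sum>k = 1..(m - 1) div 2.
                qpow \<tau> (- (1 / (16 * real m)) * (4 * real k - real m)\<^sup>2)
                * theta_odd (real k) (real m / 2) (2 * \<tau>) (2 * z)))"
proof (intro conjI allI impI, goal_cases)
  case (1 \<tau> z)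
  define l where "l = (m - 1) div 2"
  have m: "m = 2 * l + 1" and m0: "m > 0" using \<open>odd m\<close> by (auto simp: l_def elim!: oddE)
  have \<tau>: "Im \<tau> > 0" and n11: "mumford_theta 1 1 \<tau> z \<noteq> 0" and n00: "mumford_theta 0 0 \<tau> z \<noteq> 0"
    using 1 by (auto simp: N3_regular_plus_def)
  define d where "d = dedekind_eta (\<tau> / 2)"
  define e where "e = dedekind_eta (2 * \<tau>)"
  have nz: "d \<noteq> 0" "e \<noteq> 0" unfolding d_def e_def by (rule dedekind_eta_nonzero; use \<tau> in simp)+
  have y: "ypow (-1) \<tau> z 1 j \<noteq> 1" "ypow (-1) \<tau> (- z) 1 j \<noteq> 1" for j
    using regular_ypow[OF n00, of "-1"] by auto
  define X where "X = cexp 0 \<tau> 0 (- (real m / 16)) 0 * (appell m (-1) \<tau> z 1 - appell m (-1) \<tau> (- z) 1)"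
  have "R_plus \<tau> z * ch_plus \<tau> z = X"
    using assms(2) 1 Phi_eq_appell[of m \<tau> z "-1"] unfolding is_N3_character_def X_def
    by (simp add: qpow_cexp[of \<tau> "- (real m / 16)" 0])
  then have ch: "ch_plus \<tau> z = X * (1 / (d * e)) * (mumford_theta 0 0 \<tau> z / mumford_theta 1 1 \<tau> z)"
    unfolding R_plus_def d_def[symmetric] e_def[symmetric] using nz n11 n00 by (auto simp: field_simps)
  note X = appell_difference_formula[OF \<tau> m y, folded X_def e_def]
  have i: "- \<i> = cexp 0 \<tau> 0 0 (- 1 / 4)"
  proof -
    have "exp (- (\<i> * of_real (pi / 2))) = - \<i>"
      unfolding exp_minus cis_conv_exp[symmetric] by simp
    then show ?thesis by (simp add: cexp_def algebra_simps)
  qed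
  have h: "exp (- (of_real pi * \<i> * of_nat m / 2)) = cexp 0 \<tau> 0 0 (real_of_int (-1) * real m / 4)"
    by (simp add: cexp_def algebra_simps)
  have A: "- \<i> * exp (- (of_real pi * \<i> * of_nat m / 2)) = cexp 0 \<tau> 0 0 (real_of_int (-1) * (real m + 1) / 4)"
    unfolding i h cexp_mult by (rule cexp_cong) simp_all
  have B: "qpow \<tau> (- (real m / (16 * (real m + 1)))) * exp (- (of_real pi * \<i> * of_nat m / 2))
     = cexp 0 \<tau> 0 (- (real m / (16 * (real m + 1)))) (real_of_int (-1) * real m / 4)"
    unfolding h qpow_cexp[of \<tau> _ 0] cexp_mult by simp
  note L = single_sum_eq[OF m0, where c = "-1" and l = l and \<tau> = \<tau> and z = z, simplified if_False neg_equal_0_iff_equal one_neq_zero]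
  show ?case
    unfolding A B phase_minus_one triple_sums_eq[OF \<open>odd m\<close>] l_def[symmetric] theta_eq_twisted_theta pole_difference_def[symmetric]
      d_def[symmetric] e_def[symmetric]
    using trans[OF ch clear_superdenominator(1)[OF X nz(2)]] L by simp
next
  case (2 \<tau> z)
  define l where "l = (m - 1) div 2"
  have m: "m = 2 * l + 1" and m0: "m > 0" using \<open>odd m\<close> by (auto simp: l_def elim!: oddE)
  have \<tau>: "Im \<tau> > 0" and n11: "mumford_theta 1 1 \<tau> z \<noteq> 0" and n01: "mumford_theta 0 1 \<tau> z \<noteq> 0"
    using 2 by (auto simp: N3_regular_minus_def)
  define d where "d = dedekind_eta (\<tau> / 2)"
  define e where "e = dedekind_eta (2 * \<tau>)"
  define f where "f = dedekind_eta \<tau> ^ 3"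
  have nz: "d \<noteq> 0" "f \<noteq> 0" unfolding d_def f_def using dedekind_eta_nonzero[of "\<tau> / 2"] dedekind_eta_nonzero[of \<tau>] \<tau> by auto
  have y: "ypow 0 \<tau> z 1 j \<noteq> 1" "ypow 0 \<tau> (- z) 1 j \<noteq> 1" for j
    using regular_ypow[OF n01, of 0] by auto
  define X where "X = cexp 0 \<tau> 0 (- (real m / 16)) 0 * (appell m 0 \<tau> z 1 - appell m 0 \<tau> (- z) 1)"
  have "R_minus \<tau> z * ch_minus \<tau> z = X"
    using assms(3) 2 Phi_eq_appell[of m \<tau> z 0] unfolding is_N3_supercharacter_def X_def
    by (simp add: qpow_cexp[of \<tau> "- (real m / 16)" 0])
  then have ch: "ch_minus \<tau> z = X * (d / f) * (mumford_theta 0 1 \<tau> z / mumford_theta 1 1 \<tau> z)"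
    unfolding R_minus_def d_def[symmetric] f_def[symmetric] using nz n11 n01 by (auto simp: field_simps)
  note X = appell_difference_formula[OF \<tau> m y, folded X_def e_def]
  have B: "qpow \<tau> (- (real m / (16 * (real m + 1)))) = cexp 0 \<tau> 0 (- (real m / (16 * (real m + 1)))) (real_of_int 0 * real m / 4)"
    unfolding qpow_cexp[of \<tau> _ 0] by simp
  have A: "cexp 0 \<tau> 0 0 (real_of_int 0 * (real m + 1) / 4) = 1" by simp
  note L = single_sum_eq[OF m0, where c = 0 and l = l and \<tau> = \<tau> and z = z, simplified if_True simp_thms mult_1_left]
  note S = triple_sums_eq[OF \<open>odd m\<close>, where \<tau> = \<tau> and c = 0 and z = z, unfolded phase_0 mult_1_left]
  show ?case
    unfolding B S l_def[symmetric] theta_minus_eq_twisted_theta pole_difference_def[symmetric]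
      d_def[symmetric] e_def[symmetric] f_def[symmetric]
    using trans[OF ch clear_superdenominator(2)[OF X A]] L by simp
qed

end
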